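(* Let $a,n\ge1$ be integers. Let $\alpha_1,\dots,\alpha_n$ be arbitrary distinct white boundary squares and $\beta_1,\dots,\beta_n$ arbitrary distinct black boundary squares of the Aztec Diamond $\mathrm{AD}(a)$, and let $\delta_1,\dots,\delta_{2n}$ be a cyclic listing (in the order along the boundary of $\mathrm{AD}(a)$) of the elements of $\{\alpha_1,\dots,\alpha_n\}\cup\{\beta_1,\dots,\beta_n\}$. Then $$\mathrm{M}\big(\mathrm{AD}(a)\setminus\{\alpha_1,\dots,\alpha_n,\beta_1,\dots,\beta_n\}\big)=\frac{1}{[\mathrm{M}(\mathrm{AD}(a))]^{n-1}}\,\mathrm{Pf}\Big[\big(\mathrm{M}(\mathrm{AD}(a)\setminus\{\delta_i,\delta_j\})\big)_{1\le i<j\le 2n}\Big],$$ where the Pfaffian is that of the skew-symmetric matrix with the indicated entries above the diagonal, and the entries are given explicitly as follows. (1) For a white boundary square $\alpha$ and a black boundary square $\beta$ (which necessarily lie on two adjacent sides of $\mathrm{AD}(a)$), let $i$ be the position of $\alpha$ on its side and $j$ the position of $\beta$ on its side, each counted starting from $1$ at the end of the side away from the corner common to the two sides. Then $$\mathrm{M}(\mathrm{AD}(a)\setminus\{\alpha,\beta\})=2^{a(a-1)/2}\binom{a-1}{i-1}\binom{a-1}{j-1}\;{}_3F_2\left[{1,\,1-i,\,1-j\atop 1-a,\,1-a};2\right].$$ (2) $\mathrm{M}(\mathrm{AD}(a)\setminus\{\alpha_i,\alpha_j\})=\mathrm{M}(\mathrm{AD}(a)\setminus\{\beta_i,\beta_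j\})=0$.
   Context: A domino is the union of two unit squares sharing an edge; $\mathrm{M}(R)$ is the number of tilings of a region $R$ (a finite union of unit squares) by dominoes, without gaps or overlaps. $R\setminus\{\dots\}$ means removing the listed unit squares. The Aztec Diamond $\mathrm{AD}(a)$ of order $a$ is the union of all unit lattice squares inside the contour $|x|+|y|=a+1$. Up to translation, it is the union of the white unit squares $W(p,q)$, $0\le p\le a$, $1\le q\le a$, centred at $(q-p-\frac12,\;q+p-\frac12)$, and the black unit squares $B(p,q)$, $1\le p\le a$, $0\le q\le a$, centred at $(q-p+\frac12,\;q+p-\frac12)$; it has the checkerboard colouring in which adjacent squares have opposite colours. The sides, each containing $a$ boundary squares, are: southeastern $W(0,1),\dots,W(0,a)$ (from south corner to east corner); northeastern $B(1,a),\dots,B(a,a)$ (from east to north); northwestern $W(a,a),\dots,W(a,1)$ (from north to west); southwestern $B(a,0),\dots,B(1,0)$ (from west to south). This list is also the cyclic order of the boundary squares. The white boundary squares are those on the southeastern and northwestern sides, the black ones those on the northeastern and southwestern sides. Hypergeometric series: ${}_3F_2\left[{a_1,a_2,a_3\atop b_1,b_2};z\right]=\sum_{m\ge0}\frac{(a_1)_m(a_2)_m(a_3)_m}{(b_1)_m(b_2)_m}\frac{z^m}{m!}$ with $(x)_m=x(x+1)\cdots(x+m-1)$; here it is read as the finite sum over $0\le m\le\min(i,j)-1$ (the later terms having vanishing numerators). *)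

theory Defs
  imports Complex_Main "HOL-Combinatorics.Permutations" "HOL-Library.Disjoint_Sets"
begin

text \<open>
  The unit lattice square with lower left corner (x, y) is represented by the pair (x, y), and a
  region (finite union of unit squares) by the finite set of the squares it consists of.
\<close>

type_synonym cell = "int \<times> int"

definition unit_square :: "cell \<Rightarrow> (real \<times> real) set" where
  "unit_square c = {of_int (fst c) .. of_int (fst c) + 1} \<times> {of_int (snd c) .. of_int (snd c) + 1}"

definition share_edge :: "cell \<Rightarrow> cell \<Rightarrow> bool" where
  "share_edge c d \<longleftrightarrow> \<bar>fst c - fst d\<bar> + \<bar>snd c - snd d\<bar> = 1"

definition dominoes :: "cell set set" where
  "dominoes = {{c, d} | c d. share_edge c d}"

definition domino_tilings :: "cell set \<Rightarrow> cell set set set" where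
  "domino_tilings R = {T. T \<subseteq> dominoes \<and> disjoint T \<and> \<Union>T = R}"

definition M :: "cell set \<Rightarrow> nat" where
  "M R = card (domino_tilings R)"

definition aztec_diamond :: "nat \<Rightarrow> cell set" where
  "aztec_diamond a = {c. unit_square c \<subseteq> {(x, y). \<bar>x\<bar> + \<bar>y\<bar> \<le> real a + 1}}"

text \<open>
  In the coordinates in which the white square W(p,q) is centred at (q - p - 1/2, q + p - 1/2) and
  the black square B(p,q) at (q - p + 1/2, q + p - 1/2), the Aztec diamond is centred at (0, a).
  Translating by (0, -a) moves it to the one centred at the origin, and passing from centres to
  lower left corners subtracts a further (1/2, 1/2).
\<close>

definition white_square :: "nat \<Rightarrow> nat \<Rightarrow> nat \<Rightarrow> cell" where
  "white_square a p q = (int q - int p - 1, int q + int p - 1 - int a)"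

definition black_square :: "nat \<Rightarrow> nat \<Rightarrow> nat \<Rightarrow> cell" where
  "black_square a p q = (int q - int p, int q + int p - 1 - int a)"

datatype side = SE | NE | NW | SW

datatype corner = South | East | North | West

text \<open>Each side is traversed counterclockwise, from its first corner to its last corner.\<close>

fun first_corner :: "side \<Rightarrow> corner" where
  "first_corner SE = South"
| "first_corner NE = East"
| "first_corner NW = North"
| "first_corner SW = West"

fun last_corner :: "side \<Rightarrow> corner" where
  "last_corner SE = East"
| "last_corner NE = North"
| "last_corner NW = West"
| "last_corner SW = South"

fun side_squares :: "nat \<Rightarrow> side \<Rightarrow> cell list" where
  "side_squares a SE = map (\<lambda>q. white_square a 0 q) [1..<a+1]"
| "side_squares a NE = map (\<lambda>p. black_square a p a) [1..<a+1]"
| "side_squares a NW = map (\<lambda>q. white_square a a q) (rev [1..<a+1])"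
| "side_squares a SW = map (\<lambda>p. black_square a p 0) (rev [1..<a+1])"

definition boundary_squares :: "nat \<Rightarrow> cell list" where
  "boundary_squares a =
     side_squares a SE @ side_squares a NE @ side_squares a NW @ side_squares a SW"

definition white_boundary :: "nat \<Rightarrow> cell set" where
  "white_boundary a = set (side_squares a SE) \<union> set (side_squares a NW)"

definition black_boundary :: "nat \<Rightarrow> cell set" where
  "black_boundary a = set (side_squares a NE) \<union> set (side_squares a SW)"

text \<open>A cyclic listing may start at any of the squares listed.\<close>

definition cyclic_listing :: "nat \<Rightarrow> cell set \<Rightarrow> cell list \<Rightarrow> bool" where
  "cyclic_listing a S ds \<longleftrightarrow>
     (\<exists>k. ds = rotate k (filter (\<lambda>c. c \<in> S) (boundary_squares a)))"

definition common_corner :: "side \<Rightarrow> side \<Rightarrow> corner \<Rightarrow> bool" where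
  "common_corner s t c \<longleftrightarrow>
     s \<noteq> t \<and> c \<in> {first_corner s, last_corner s} \<and> c \<in> {first_corner t, last_corner t}"

text \<open>
  \<open>position_on a s c x i\<close>: the square \<open>x\<close> is the \<open>i\<close>-th square (counting from 1) of the side \<open>s\<close>,
  where \<open>c\<close> is an end of \<open>s\<close> and counting starts at the other end.
\<close>

definition position_on :: "nat \<Rightarrow> side \<Rightarrow> corner \<Rightarrow> cell \<Rightarrow> nat \<Rightarrow> bool" where
  "position_on a s c x i \<longleftrightarrow>
     1 \<le> i \<and> i \<le> a \<and>
     (if c = last_corner s then side_squares a s else rev (side_squares a s)) ! (i - 1) = x"

text \<open>
  The Pfaffian of the skew-symmetric \<open>2n \<times> 2n\<close> matrix \<open>A\<close>, with rows and columns indexed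
  by \<open>1, \<dots>, 2n\<close>.
\<close>

definition pfaffian :: "nat \<Rightarrow> (nat \<Rightarrow> nat \<Rightarrow> real) \<Rightarrow> real" where
  "pfaffian n A =
     (\<Sum>\<sigma> | \<sigma> permutes {1..2*n}. of_int (sign \<sigma>) * (\<Prod>i=1..n. A (\<sigma> (2*i - 1)) (\<sigma> (2*i))))
       / (2 ^ n * fact n)"

definition skew_matrix :: "(nat \<Rightarrow> nat \<Rightarrow> real) \<Rightarrow> nat \<Rightarrow> nat \<Rightarrow> real" where
  "skew_matrix f i j = (if i < j then f i j else if j < i then - f j i else 0)"

text \<open>
  The sum of the first \<open>N\<close> terms of the hypergeometric series 3F2. It is used with numerator
  parameters \<open>1 - i\<close>, \<open>1 - j\<close> and \<open>N = min i j\<close>, where all later numerators vanish. The explicit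
  truncation avoids the terms 0 / 0 arising from the nonpositive integer denominator parameters.
\<close>

definition hyp_3F2 :: "nat \<Rightarrow> real \<Rightarrow> real \<Rightarrow> real \<Rightarrow> real \<Rightarrow> real \<Rightarrow> real \<Rightarrow> real" where
  "hyp_3F2 N a1 a2 a3 b1 b2 z =
     (\<Sum>m<N. pochhammer a1 m * pochhammer a2 m * pochhammer a3 m
               / (pochhammer b1 m * pochhammer b2 m) * (z ^ m / fact m))"

lemma aztec_diamond_iff:
  "(x, y) \<in> aztec_diamond a \<longleftrightarrow>
     max \<bar>x\<bar> \<bar>x + 1\<bar> + max \<bar>y\<bar> \<bar>y + 1\<bar> \<le> int a + 1"
proof
  assume "(x, y) \<in> aztec_diamond a"
  then have sub: "unit_square (x, y) \<subseteq> {(u, v). \<bar>u\<bar> + \<bar>v\<bar> \<le> real a + 1}"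
    by (simp add: aztec_diamond_def)
  have "\<bar>s\<bar> + \<bar>t\<bar> \<le> int a + 1" if "s \<in> {x, x + 1}" "t \<in> {y, y + 1}" for s t
  proof -
    have "(real_of_int s, real_of_int t) \<in> unit_square (x, y)"
      using that by (auto simp: unit_square_def)
    then have "\<bar>real_of_int s\<bar> + \<bar>real_of_int t\<bar> \<le> real a + 1" using sub by blast
    then show ?thesis by linarith
  qed
  from this[of x y] this[of x "y+1"] this[of "x+1" y] this[of "x+1" "y+1"]
  show "max \<bar>x\<bar> \<bar>x + 1\<bar> + max \<bar>y\<bar> \<bar>y + 1\<bar> \<le> int a + 1"
    by (simp add: max_def)
next
  assume le: "max \<bar>x\<bar> \<bar>x + 1\<bar> + max \<bar>y\<bar> \<bar>y + 1\<bar> \<le> int a + 1"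
  have "\<bar>u\<bar> + \<bar>v\<bar> \<le> real a + 1"
    if "real_of_int x \<le> u" "u \<le> real_of_int x + 1" "real_of_int y \<le> v" "v \<le> real_of_int y + 1"
    for u v :: real
  proof -
    have "\<bar>u\<bar> \<le> real_of_int (max \<bar>x\<bar> \<bar>x + 1\<bar>)" using that by (auto simp: max_def)
    moreover have "\<bar>v\<bar> \<le> real_of_int (max \<bar>y\<bar> \<bar>y + 1\<bar>)" using that by (auto simp: max_def)
    ultimately show ?thesis using le by linarith
  qed
  then show "(x, y) \<in> aztec_diamond a"
    by (auto simp: aztec_diamond_def unit_square_def)
qed

lemma aztec_diamond_eq:
  "aztec_diamond a =
     {white_square a p q | p q. p \<le> a \<and> 1 \<le> q \<and> q \<le> a} \<union>
     {black_square a p q | p q. 1 \<le> p \<and> p \<le> a \<and> q \<le> a}" (is "_ = ?W \<union> ?B")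
proof (rule set_eqI, rule iffI)
  fix c assume "c \<in> aztec_diamond a"
  then obtain x y where c: "c = (x, y)"
    and le: "max \<bar>x\<bar> \<bar>x + 1\<bar> + max \<bar>y\<bar> \<bar>y + 1\<bar> \<le> int a + 1"
    by (cases c) (auto simp: aztec_diamond_iff)
  show "c \<in> ?W \<union> ?B"
  proof (cases "even (x + y + int a)")
    case True
    then obtain k where k: "x + y + int a = 2 * k" by blast
    have "0 \<le> k - x" "k - x \<le> int a" "1 \<le> k + 1" "k + 1 \<le> int a"
      using k le by linarith+
    then have "c = white_square a (nat (k - x)) (nat (k + 1))"
      "nat (k - x) \<le> a" "1 \<le> nat (k + 1)" "nat (k + 1) \<le> a"
      using k by (auto simp: white_square_def c)
    then show ?thesis by blast
  next
    case False
    then obtain k where k: "x + y + int a = 2 * k + 1" by (elim oddE)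
    have "1 \<le> k + 1 - x" "k + 1 - x \<le> int a" "0 \<le> k + 1" "k + 1 \<le> int a"
      using k le by linarith+
    then have "c = black_square a (nat (k + 1 - x)) (nat (k + 1))"
      "1 \<le> nat (k + 1 - x)" "nat (k + 1 - x) \<le> a" "nat (k + 1) \<le> a"
      using k by (auto simp: black_square_def c)
    then show ?thesis by blast
  qed
next
  fix c assume "c \<in> ?W \<union> ?B"
  then show "c \<in> aztec_diamond a"
    by (auto simp: white_square_def black_square_def aztec_diamond_iff)
qed

lemma position_on_exists:
  assumes "x \<in> set (side_squares a s)"
  shows "\<exists>i. position_on a s c x i"
proof -
  let ?xs = "if c = last_corner s then side_squares a s else rev (side_squares a s)"
  have "length ?xs = a" by (cases s) simp_all
  moreover have "x \<in> set ?xs" using assms by simp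
  ultimately obtain k where "k < a" "?xs ! k = x" by (metis in_set_conv_nth)
  then have "position_on a s c x (Suc k)" by (simp add: position_on_def)
  then show ?thesis ..
qed

end

theory Submission
  imports Defs "Jordan_Normal_Form.Determinant" "HOL-Computational_Algebra.Polynomial"
begin

text \<open>
  The tilings of a planar bipartite region correspond to the nonzero terms of the determinant of a
  signed adjacency matrix between its white and its black squares, and a suitable choice of signs
  makes all terms equal. Here the sign is \<open>-1\<close> on the dominoes whose black square
  lies directly below the white one; every \<open>2 \<times> 2\<close> block contains exactly one
  such pair. Removing squares is expressed by replacing, in this matrix \<open>K\<close>, the row
  of the \<open>k\<close>-th removed white square by the unit vector of the \<open>k\<close>-th
  removed black square. The permutations that contribute to the new determinant are the tilings of
  the smaller region, extended by pairing the removed squares in order.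

  That all these permutations contribute with the same sign, and with which one, is the
  combinatorial core (\<open>kasteleyn_sign\<close>). White and black squares are numbered row by
  row, so that a tiling becomes a permutation, and its inversions are counted directly. Their
  number has the right parity because among the dominoes that stay within a row, those of weight
  \<open>-1\<close> are the ones shifted by a column, and this shift appears in the number of
  inversions of the domino (\<open>c_down\<close>). What remains depends only on how many dominoes
  stay within each row of the numbering, which is determined by the removed squares
  (\<open>card_Dn\<close>). The resulting sign is explicit, as it has to be, because signs for
  different sets of removed squares are compared afterwards.

  The Jacobi identity for complementary minors (\<open>det_unit_rows_jacobi\<close>) writes the
  determinant with \<open>n\<close> replaced rows, multiplied by \<open>(det K) ^ (n - 1)\<close>,
  as an \<open>n \<times> n\<close> determinant in entries of the adjugate of \<open>K\<close>.
  Such an entry is the case of a single pair of removed squares, hence up to sign the number of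
  tilings that remain when one white and one black square are removed. On the other side, two
  squares of the same colour leave an unbalanced region, so the matrix of the Pfaffian is
  bipartite, and its Pfaffian is an \<open>n \<times> n\<close> determinant as well
  (\<open>pfaffian_bipartite\<close>), up to the sign of the permutation that sorts the removed
  squares along the boundary. This sign is found by counting inversions once more, and all signs
  cancel (\<open>pfaffian_listing\<close>). The starting point of the cyclic listing is irrelevant
  because a cycle of length \<open>2 n\<close> is odd, which makes up for the sign change in one
  row and column of a skew-symmetric matrix (\<open>pfaffian_rotate\<close>).

  For the entries, a row of the inverse of \<open>K\<close> belonging to a southwestern black
  square is read off from polynomials \<open>Y_p\<close>, one for each row \<open>p\<close> of
  white squares, subject to \<open>(1 + z) Y_(p-1) - (1 - z) Y_p = 0\<close>, with
  \<open>1\<close> on the right in a single row. They come from a Bezout identity for powers of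
  \<open>(1 + z) / 2\<close> and \<open>(1 - z) / 2\<close> (\<open>bezout_binomial\<close>,
  \<open>green_row\<close>), and the coefficients of \<open>Y_0\<close> are the sums of products
  of two binomial coefficients that make up the hypergeometric series. The factor in front
  requires the number of tilings of the whole diamond: removing the east and the west corner
  square forces all dominoes along the two northern sides and leaves a smaller diamond, so the
  same formula yields the recursion behind \<open>M_aztec_diamond\<close>. The four corners are
  related by reflections.
\<close>

section \<open>The sign of a permutation counts its inversions\<close>

text \<open>
  For a two-element set \<open>e\<close> this is \<open>-1\<close> exactly if \<open>p\<close>
  inverts the pair. Working with sets rather than ordered pairs makes the value multiplicative
  under composition.
\<close>

definition order_sign :: "('a::linorder \<Rightarrow> 'a) \<Rightarrow> 'a set \<Rightarrow> int" where
  "order_sign p e = (if \<forall>x\<in>e. \<forall>y\<in>e. x < y \<longrightarrow> p x < p y then 1 else -1)"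

lemma order_sign_cases: "order_sign p e = 1 \<or> order_sign p e = -1"
  by (simp add: order_sign_def)

lemma order_sign_comp:
  assumes "inj q" "inj p" "card e = 2"
  shows "order_sign (p \<circ> q) e = order_sign p (q ` e) * order_sign q e"
proof -
  obtain x y where e: "e = {x, y}" "x < y"
    using assms(3) by (metis card_2_iff insert_commute linorder_neq_iff)
  have "q x \<noteq> q y" "p (q x) \<noteq> p (q y)"
    using assms e by (auto dest: injD)
  then show ?thesis using e by (auto simp: order_sign_def)
qed

definition inversion_sign :: "'a::linorder set \<Rightarrow> ('a \<Rightarrow> 'a) \<Rightarrow> int" where
  "inversion_sign A p = (\<Prod>e | e \<subseteq> A \<and> card e = 2. order_sign p e)"

lemma bij_betw_image_pairs:
  assumes "q permutes A"
  shows "bij_betw ((`) q) {e. e \<subseteq> A \<and> card e = 2} {e. e \<subseteq> A \<and> card e = 2}"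
proof (rule bij_betwI[where g = "(`) (Hilbert_Choice.inv q)"])
  have q: "inj q" "inj (Hilbert_Choice.inv q)" and b: "bij q" and q': "Hilbert_Choice.inv q permutes A"
    using assms by (auto simp: permutes_inj permutes_inv permutes_bij bij_is_inj bij_imp_bij_inv)
  show "(`) q \<in> {e. e \<subseteq> A \<and> card e = 2} \<rightarrow> {e. e \<subseteq> A \<and> card e = 2}"
    using q assms by (auto simp: card_image inj_on_subset permutes_in_image)
  show "(`) (Hilbert_Choice.inv q) \<in> {e. e \<subseteq> A \<and> card e = 2} \<rightarrow> {e. e \<subseteq> A \<and> card e = 2}"
    using q q' by (auto simp: card_image inj_on_subset permutes_in_image)
  show "Hilbert_Choice.inv q ` q ` e = e" for e using q by (simp add: image_inv_f_f)
  show "q ` Hilbert_Choice.inv q ` e = e" for e using b by (metis bij_is_surj image_f_inv_f)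
qed

lemma inversion_sign_comp:
  assumes "p permutes A" "q permutes A"
  shows "inversion_sign A (p \<circ> q) = inversion_sign A p * inversion_sign A q"
proof -
  have "inversion_sign A (p \<circ> q) =
      (\<Prod>e | e \<subseteq> A \<and> card e = 2. order_sign p (q ` e) * order_sign q e)"
    unfolding inversion_sign_def
    using assms by (intro prod.cong refl order_sign_comp) (auto simp: permutes_inj)
  also have "\<dots> = (\<Prod>e | e \<subseteq> A \<and> card e = 2. order_sign p (q ` e)) * inversion_sign A q"
    by (simp add: prod.distrib inversion_sign_def)
  also have "(\<Prod>e | e \<subseteq> A \<and> card e = 2. order_sign p (q ` e)) = inversion_sign A p"
    unfolding inversion_sign_def
    by (rule prod.reindex_bij_betw[OF bij_betw_image_pairs[OF assms(2)]])
  finally show ?thesis .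
qed

text \<open>
  The pairs that meet \<open>{a, b}\<close> in one element are matched with each other by the
  transposition, and matched pairs are inverted simultaneously. Only the pair \<open>{a,
  b}\<close> itself remains.
\<close>

lemma inversion_sign_transpose:
  assumes fin: "finite A" and ab: "a \<in> A" "b \<in> A" "a < b"
  shows "inversion_sign A (transpose a b) = -1"
proof -
  let ?t = "transpose a b"
  let ?P = "{e. e \<subseteq> A \<and> card e = 2}"
  let ?X = "{e \<in> ?P. a \<in> e \<and> b \<notin> e}" and ?Y = "{e \<in> ?P. a \<notin> e \<and> b \<in> e}"
    and ?Z = "{e \<in> ?P. a \<notin> e \<and> b \<notin> e}"
  have finP: "finite ?P" using fin by simp
  then have finX: "finite ?X" "finite ?Y" "finite ?Z"
    by (auto elim: rev_finite_subset)
  have t: "?t permutes A" using ab by (simp add: permutes_swap_id)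
  \<comment> \<open>the four classes of pairs according to their intersection with \<open>{a, b}\<close>\<close>
  have dec: "?P = insert {a, b} (?X \<union> ?Y \<union> ?Z)"
    using ab by (auto simp: card_2_iff)
  have "inversion_sign A ?t = (\<Prod>e\<in>insert {a, b} (?X \<union> ?Y \<union> ?Z). order_sign ?t e)"
    unfolding inversion_sign_def by (subst dec) simp
  also have "\<dots> = order_sign ?t {a, b} * (\<Prod>e\<in>?X \<union> ?Y \<union> ?Z. order_sign ?t e)"
    using finX by (subst prod.insert) auto
  also have "(\<Prod>e\<in>?X \<union> ?Y \<union> ?Z. order_sign ?t e) =
      (\<Prod>e\<in>?X. order_sign ?t e) * (\<Prod>e\<in>?Y. order_sign ?t e) * (\<Prod>e\<in>?Z. order_sign ?t e)"
    using finX by (subst prod.union_disjoint; (subst prod.union_disjoint)?) auto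
  also have "(\<Prod>e\<in>?Z. order_sign ?t e) = 1"
  proof (rule prod.neutral, rule ballI)
    fix e assume "e \<in> ?Z"
    then have "?t x = x" if "x \<in> e" for x using that by (auto simp: transpose_def)
    then show "order_sign ?t e = 1" by (simp add: order_sign_def)
  qed
  also have "(\<Prod>e\<in>?Y. order_sign ?t e) = (\<Prod>e\<in>?X. order_sign ?t (?t ` e))"
  proof (rule prod.reindex_bij_betw[symmetric], rule bij_betwI[where g = "(`) ?t"])
    have im: "?t ` e \<subseteq> A \<and> card (?t ` e) = 2" if "e \<subseteq> A" "card e = 2" for e
      using image_mono[OF that(1), of ?t] permutes_image[OF t] that(2)
      by (simp add: card_image)
    have mem: "a \<in> ?t ` e \<longleftrightarrow> b \<in> e" "b \<in> ?t ` e \<longleftrightarrow> a \<in> e" for e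
      by (auto simp: transpose_def image_iff)
    show "(`) ?t \<in> ?X \<rightarrow> ?Y" "(`) ?t \<in> ?Y \<rightarrow> ?X"
      unfolding Pi_iff mem_Collect_eq Ball_def mem using im by blast+
    show "?t ` ?t ` e = e" for e by (simp add: image_comp)
    then show "?t ` ?t ` e = e" for e .
  qed
  also have "\<dots> = (\<Prod>e\<in>?X. order_sign ?t e)"
  proof (rule prod.cong, rule refl)
    fix e assume "e \<in> ?X"
    then have "order_sign (?t \<circ> ?t) e = order_sign ?t (?t ` e) * order_sign ?t e"
      by (intro order_sign_comp) (auto intro: inj_on_subset)
    moreover have "order_sign (?t \<circ> ?t) e = 1" by (simp add: order_sign_def)
    ultimately show "order_sign ?t (?t ` e) = order_sign ?t e"
      using order_sign_cases[of ?t e] order_sign_cases[of ?t "?t ` e"] by auto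
  qed
  also have "(\<Prod>e\<in>?X. order_sign ?t e) * (\<Prod>e\<in>?X. order_sign ?t e) = 1"
  proof -
    have "order_sign ?t e * order_sign ?t e = 1" for e using order_sign_cases[of ?t e] by auto
    then show ?thesis by (simp add: prod.distrib[symmetric])
  qed
  also have "order_sign ?t {a, b} = -1"
    using ab by (auto simp: order_sign_def)
  finally show ?thesis by simp
qed

text \<open>
  Both sides are multiplicative and equal to \<open>-1\<close> on transpositions, which generate.
\<close>

lemma sign_eq_inversion_sign:
  assumes "finite A" "p permutes A"
  shows "sign p = inversion_sign A p"
  using assms
proof (induction rule: permutes_rev_induct)
  case id
  then show ?case by (auto simp: inversion_sign_def order_sign_def intro!: prod.neutral[symmetric])
next
  case (swap a b p)
  show ?case
  proof (cases "a = b")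
    case False
    have tr: "inversion_sign A (transpose a b) = -1"
      using False inversion_sign_transpose[of A a b] inversion_sign_transpose[of A b a] swap assms
      by (metis transpose_commute linorder_neq_iff)
    have t: "transpose a b permutes A" using swap by (simp add: permutes_swap_id)
    have "sign (p \<circ> transpose a b) = sign p * sign (transpose a b)"
      using swap t assms(1) by (intro sign_compose) (auto simp: permutes_imp_permutation)
    also have "\<dots> = - sign p" using False by (simp add: sign_swap_id)
    also have "\<dots> = inversion_sign A p * inversion_sign A (transpose a b)"
      using swap tr by simp
    also have "\<dots> = inversion_sign A (p \<circ> transpose a b)"
      by (rule inversion_sign_comp[symmetric]) fact+
    finally show ?thesis .
  qed (use swap in simp)
qed

lemma sign_eq_inversions:
  fixes A :: "'a::linorder set"
  assumes fin: "finite A" and p: "p permutes A"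
  shows "sign p = (-1) ^ card {(i, j). i \<in> A \<and> j \<in> A \<and> i < j \<and> p j < p i}"
proof -
  let ?P = "{e. e \<subseteq> A \<and> card e = 2}" 
  let ?I = "{(i, j). i \<in> A \<and> j \<in> A \<and> i < j \<and> p j < p i}"
  let ?N = "{e \<in> ?P. order_sign p e = -1}"
  have inj: "inj p" using p by (rule permutes_inj)
  have "inversion_sign A p = (\<Prod>e\<in>?P. if order_sign p e = -1 then -1 else 1)"
    unfolding inversion_sign_def by (intro prod.cong) (auto simp: order_sign_def)
  also have "\<dots> = (-1) ^ card ?N"
    using fin by (subst prod.inter_filter[symmetric]) auto
  also have "?N = (\<lambda>(i, j). {i, j}) ` ?I"
  proof safe
    fix e assume e: "e \<subseteq> A" "card e = 2" "order_sign p e = -1"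
    obtain x y where xy: "e = {x, y}" "x < y"
      using e(2) by (metis card_2_iff insert_commute linorder_neq_iff)
    have "p x \<noteq> p y" using inj xy by (auto dest: injD)
    then have "p y < p x" using e xy by (auto simp: order_sign_def split: if_splits)
    then show "e \<in> (\<lambda>(i, j). {i, j}) ` ?I" using xy e by (auto intro!: image_eqI[of _ _ "(x, y)"])
  next
    fix i j :: 'a assume "i < j" "p j < p i" 
    then show "order_sign p {i, j} = - 1" by (auto simp: order_sign_def)
  qed auto
  also have "card ((\<lambda>(i, j). {i, j}) ` ?I) = card ?I"
    by (intro card_image inj_onI) (auto simp: doubleton_eq_iff)
  finally show ?thesis using sign_eq_inversion_sign[OF fin p] by simp
qed

section \<open>Determinants with rows replaced by unit vectors, and the Jacobi identity\<close>

definition unit_rows :: "'a::comm_ring_1 mat \<Rightarrow> nat set \<Rightarrow> (nat \<Rightarrow> nat) \<Rightarrow> 'a mat" where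
  "unit_rows A S b = mat (dim_row A) (dim_col A)
     (\<lambda>(i, j). if i \<in> S then if j = b i then 1 else 0 else A $$ (i, j))"

lemma unit_rows_carrier: "A \<in> carrier_mat N N \<Longrightarrow> unit_rows A S b \<in> carrier_mat N N"
  by (auto simp: unit_rows_def)

text \<open>
  In the Leibniz expansion only those permutations survive that send every \<open>i \<in>
  S\<close> to \<open>b i\<close>. This is the algebraic counterpart of prescribing the partners
  of the rows in \<open>S\<close>.
\<close>

lemma det_unit_rows:
  assumes A: "A \<in> carrier_mat N N" and S: "S \<subseteq> {0..<N}"
  shows "det (unit_rows A S b) =
    (\<Sum>p | p permutes {0..<N} \<and> (\<forall>i\<in>S. p i = b i). signof p * (\<Prod>i\<in>{0..<N} - S. A $$ (i, p i)))"
proof -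
  let ?R = "unit_rows A S b"
  have R: "?R \<in> carrier_mat N N" using A by (rule unit_rows_carrier)
  have fS: "finite S" using S finite_subset by blast
  have leibniz_term: "(\<Prod>i = 0..<N. ?R $$ (i, p i)) =
      (if \<forall>i\<in>S. p i = b i then \<Prod>i\<in>{0..<N} - S. A $$ (i, p i) else 0)"
    if p: "p permutes {0..<N}" for p
  proof -
    have lt: "p i < N" if "i < N" for i using p that permutes_in_image[of p "{0..<N}" i] by simp
    have "(\<Prod>i = 0..<N. ?R $$ (i, p i)) =
        (\<Prod>i\<in>S. ?R $$ (i, p i)) * (\<Prod>i\<in>{0..<N} - S. ?R $$ (i, p i))"
      using prod.subset_diff[OF S, of "\<lambda>i. ?R $$ (i, p i)"] by (simp add: mult.commute)
    also have "(\<Prod>i\<in>{0..<N} - S. ?R $$ (i, p i)) = (\<Prod>i\<in>{0..<N} - S. A $$ (i, p i))"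
      using A lt by (intro prod.cong) (auto simp: unit_rows_def)
    also have "(\<Prod>i\<in>S. ?R $$ (i, p i)) = (\<Prod>i\<in>S. if p i = b i then 1 else 0)"
    proof (rule prod.cong[OF refl])
      fix i assume "i \<in> S"
      then show "?R $$ (i, p i) = (if p i = b i then 1 else 0)"
        using A S lt[of i] by (simp add: unit_rows_def subset_eq)
    qed
    also have "\<dots> = (if \<forall>i\<in>S. p i = b i then 1 else 0)"
      using fS by (auto intro!: prod.neutral prod_zero)
    finally show ?thesis by simp
  qed
  have "det ?R = (\<Sum>p | p permutes {0..<N}. signof p * (\<Prod>i = 0..<N. ?R $$ (i, p i)))"
    using det_def'[OF R] .
  also have "\<dots> = (\<Sum>p | p permutes {0..<N}. if \<forall>i\<in>S. p i = b i
      then signof p * (\<Prod>i\<in>{0..<N} - S. A $$ (i, p i)) else 0)"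
    by (intro sum.cong refl) (simp add: leibniz_term)
  also have "\<dots> = (\<Sum>p | p permutes {0..<N} \<and> (\<forall>i\<in>S. p i = b i).
      signof p * (\<Prod>i\<in>{0..<N} - S. A $$ (i, p i)))"
    by (subst sum.inter_filter[symmetric]) (auto simp: finite_permutations)
  finally show ?thesis .
qed

lemma adj_mat_entry_eq_det_unit_rows:
  assumes A: "A \<in> carrier_mat N N" and w: "w < N" and b: "b < N"
  shows "adj_mat A $$ (b, w) = det (unit_rows A {w} (\<lambda>_. b))"
proof -
  let ?R = "unit_rows A {w} (\<lambda>_. b)"
  have R: "?R \<in> carrier_mat N N" using A by (rule unit_rows_carrier)
  have "det ?R = (\<Sum>j<N. ?R $$ (w, j) * cofactor ?R w j)"
    by (rule laplace_expansion_row[OF R w])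
  also have "\<dots> = (\<Sum>j<N. if j = b then cofactor ?R w b else 0)"
    using A w by (intro sum.cong) (auto simp: unit_rows_def)
  also have "\<dots> = cofactor ?R w b" using b by simp
  also have "mat_delete ?R w b = mat_delete A w b"
    using A w b by (intro eq_matI) (auto simp: mat_delete_def unit_rows_def)
  then have "cofactor ?R w b = cofactor A w b" by (simp add: cofactor_def)
  also have "\<dots> = adj_mat A $$ (b, w)" using A w b by (simp add: adj_mat_def)
  finally show ?thesis ..
qed

text \<open>
  The product of \<open>unit_rows A S b\<close> with the adjugate of \<open>A\<close> has the rows
  \<open>b i\<close> of the adjugate in the positions \<open>i \<in> S\<close> and multiples of
  unit vectors elsewhere. Its determinant is therefore a power of \<open>det A\<close> times a
  minor of the adjugate.
\<close>

lemma det_unit_rows_jacobi: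
  fixes A :: "'a::field mat"
  assumes A: "A \<in> carrier_mat N N" and nz: "det A \<noteq> 0"
    and S: "S \<subseteq> {0..<N}" "S \<noteq> {}" and b: "b ` S \<subseteq> {0..<N}"
  shows "det (unit_rows A S b) * det A ^ (card S - 1) =
    (\<Sum>p | p permutes S. signof p * (\<Prod>i\<in>S. adj_mat A $$ (b i, p i)))"
proof -
  let ?R = "unit_rows A S b" and ?d = "det A" and ?n = "card S"
  let ?Q = "?R * adj_mat A"
  have R: "?R \<in> carrier_mat N N" using A by (rule unit_rows_carrier)
  note adj = adj_mat[OF A]
  have fS: "finite S" using S finite_subset by blast
  have n: "?n > 0" "?n \<le> N" using S fS card_mono[of "{0..<N}" S] by (auto simp: card_gt_0_iff)
  have Q: "?Q \<in> carrier_mat N N" using R adj by simp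
  have QS: "?Q $$ (i, j) = adj_mat A $$ (b i, j)" if "i \<in> S" "j < N" for i j
  proof -
    have "i < N" "b i < N" using that S b by auto
    then have "?Q $$ (i, j) = (\<Sum>k<N. (if k = b i then 1 else 0) * adj_mat A $$ (k, j))"
      using R adj A that by (auto simp: scalar_prod_def unit_rows_def atLeast0LessThan intro!: sum.cong)
    also have "\<dots> = (\<Sum>k<N. if k = b i then adj_mat A $$ (b i, j) else 0)"
      by (intro sum.cong) auto
    finally show ?thesis using \<open>b i < N\<close> by simp
  qed
  have QN: "?Q $$ (i, j) = (if i = j then ?d else 0)" if "i < N" "i \<notin> S" "j < N" for i j
  proof -
    have "?Q $$ (i, j) = (A * adj_mat A) $$ (i, j)"
      using R adj(1) A that by (auto simp: scalar_prod_def unit_rows_def intro!: sum.cong)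
    also have "\<dots> = (?d \<cdot>\<^sub>m 1\<^sub>m N) $$ (i, j)" by (simp only: adj(2))
    finally show ?thesis using that by simp
  qed
  have leibniz_term: "(\<Prod>i = 0..<N. ?Q $$ (i, p i)) =
      (if p permutes S then ?d ^ (N - ?n) * (\<Prod>i\<in>S. adj_mat A $$ (b i, p i)) else 0)"
    if p: "p permutes {0..<N}" for p
  proof (cases "p permutes S")
    case True
    have lt: "p i < N" if "i < N" for i using p that permutes_in_image[of p "{0..<N}" i] by simp
    have "(\<Prod>i = 0..<N. ?Q $$ (i, p i)) =
        (\<Prod>i\<in>{0..<N} - S. ?Q $$ (i, p i)) * (\<Prod>i\<in>S. ?Q $$ (i, p i))"
      using prod.subset_diff[OF S(1), of "\<lambda>i. ?Q $$ (i, p i)"] by simp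
    also have "(\<Prod>i\<in>{0..<N} - S. ?Q $$ (i, p i)) = (\<Prod>i\<in>{0..<N} - S. ?d)"
      using QN lt permutes_not_in[OF True] by (intro prod.cong) auto
    also have "\<dots> = ?d ^ (N - ?n)" using S fS by (simp add: card_Diff_subset)
    also have "(\<Prod>i\<in>S. ?Q $$ (i, p i)) = (\<Prod>i\<in>S. adj_mat A $$ (b i, p i))"
      using QS lt S by (intro prod.cong) auto
    finally show ?thesis using True by simp
  next
    case False
    then obtain i where i: "i \<in> {0..<N} - S" "p i \<noteq> i"
      using p permutes_superset[OF p, of S] by blast
    then have "?Q $$ (i, p i) = 0"
      using p permutes_in_image[of p "{0..<N}" i] by (subst QN) auto
    then show ?thesis using False i by (auto intro!: prod_zero)
  qed
  have "det ?R * det (adj_mat A) = det ?Q" using det_mult[OF R adj(1)] ..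
  also have "\<dots> = (\<Sum>p | p permutes {0..<N}. if p permutes S
      then signof p * (?d ^ (N - ?n) * (\<Prod>i\<in>S. adj_mat A $$ (b i, p i))) else 0)"
    unfolding det_def'[OF Q] by (intro sum.cong refl) (simp add: leibniz_term)
  also have "\<dots> = (\<Sum>p | p permutes {0..<N} \<and> p permutes S.
      signof p * (?d ^ (N - ?n) * (\<Prod>i\<in>S. adj_mat A $$ (b i, p i))))"
    by (subst sum.inter_filter[symmetric]) (auto simp: finite_permutations)
  also have "{p. p permutes {0..<N} \<and> p permutes S} = {p. p permutes S}"
    using S(1) permutes_subset by blast
  also have "(\<Sum>p | p permutes S. signof p * (?d ^ (N - ?n) * (\<Prod>i\<in>S. adj_mat A $$ (b i, p i)))) =
      ?d ^ (N - ?n) * (\<Sum>p | p permutes S. signof p * (\<Prod>i\<in>S. adj_mat A $$ (b i, p i)))"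
    by (simp add: sum_distrib_left mult_ac)
  finally have eq: "det ?R * det (adj_mat A) =
      ?d ^ (N - ?n) * (\<Sum>p | p permutes S. signof p * (\<Prod>i\<in>S. adj_mat A $$ (b i, p i)))"
    (is "_ = _ * ?X") .
  have "?d * det (adj_mat A) = det (A * adj_mat A)" using det_mult[OF A adj(1)] ..
  also have "\<dots> = ?d ^ N" by (simp add: adj)
  finally have dadj: "?d * det (adj_mat A) = ?d ^ N" .
  have "N = Suc (N - ?n + (?n - 1))" using n by simp
  then have "?d ^ N = ?d * ?d ^ (N - ?n) * ?d ^ (?n - 1)"
    by (metis power_Suc power_add mult.assoc)
  then have "?d * ?d ^ (N - ?n) * (det ?R * ?d ^ (?n - 1)) = det ?R * ?d ^ N"
    by (simp add: mult_ac)
  also have "\<dots> = ?d * (det ?R * det (adj_mat A))" by (simp add: dadj[symmetric] mult_ac)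
  also have "\<dots> = ?d * ?d ^ (N - ?n) * ?X" by (simp only: eq mult.assoc)
  finally show ?thesis using nz by simp
qed

section \<open>Pfaffians\<close>

lemma sign_compose_permutes:
  assumes "finite A" "p permutes A" "q permutes A"
  shows "sign (p \<circ> q) = sign p * sign q"
  using assms by (intro sign_compose permutes_imp_permutation)

lemma permutes_mem: "p permutes A \<Longrightarrow> x \<in> A \<Longrightarrow> p x \<in> A"
  by (simp only: permutes_in_image)

lemma prod_pairs: "(\<Prod>i=1..2*n. g i) = (\<Prod>k=1..n. g (2*k - 1) * g (2*k :: nat) :: 'a::comm_monoid_mult)"
proof (induction n)
  case (Suc n)
  have "{1..2 * Suc n} = insert (2 * Suc n) (insert (2 * Suc n - 1) {1..2*n})" by auto
  then have "(\<Prod>i=1..2 * Suc n. g i) = g (2 * Suc n) * (g (2 * Suc n - 1) * (\<Prod>i=1..2*n. g i))"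
    by simp
  then show ?case using Suc by (simp add: mult_ac)
qed simp

lemma pfaffian_cong:
  assumes "\<And>i j. i \<in> {1..2*n} \<Longrightarrow> j \<in> {1..2*n} \<Longrightarrow> A i j = B i j"
  shows "pfaffian n A = pfaffian n B"
proof -
  have "A (\<sigma> (2*k - 1)) (\<sigma> (2*k)) = B (\<sigma> (2*k - 1)) (\<sigma> (2*k))"
    if "\<sigma> permutes {1..2*n}" "k \<in> {1..n}" for \<sigma> k
    using that(2) by (intro assms permutes_mem[OF that(1)]) auto
  then show ?thesis
    unfolding pfaffian_def
    by (intro arg_cong2[of _ _ _ _ "(/)"] sum.cong arg_cong2[of _ _ _ _ "(*)"] prod.cong refl) auto
qed

lemma pfaffian_relabel:
  assumes "\<tau> permutes {1..2*n}"
  shows "pfaffian n A = of_int (sign \<tau>) * pfaffian n (\<lambda>i j. A (\<tau> i) (\<tau> j))"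
proof -
  have "(\<Sum>\<sigma> | \<sigma> permutes {1..2*n}. of_int (sign \<sigma>) * (\<Prod>i=1..n. A (\<sigma> (2*i - 1)) (\<sigma> (2*i)))) =
    (\<Sum>\<sigma> | \<sigma> permutes {1..2*n}. of_int (sign (\<tau> \<circ> \<sigma>)) *
       (\<Prod>i=1..n. A ((\<tau> \<circ> \<sigma>) (2*i - 1)) ((\<tau> \<circ> \<sigma>) (2*i))))"
    by (rule setum_permutations_compose_left[OF assms])
  also have "\<dots> = (\<Sum>\<sigma> | \<sigma> permutes {1..2*n}. of_int (sign \<tau>) * (of_int (sign \<sigma>) *
       (\<Prod>i=1..n. A (\<tau> (\<sigma> (2*i - 1))) (\<tau> (\<sigma> (2*i))))))"
  proof (intro sum.cong refl)
    fix \<sigma> assume "\<sigma> \<in> {\<sigma>. \<sigma> permutes {1..2*n}}"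
    then have "sign (\<tau> \<circ> \<sigma>) = sign \<tau> * sign \<sigma>"
      using assms by (intro sign_compose_permutes[of "{1..2*n}"]) auto
    then show "of_int (sign (\<tau> \<circ> \<sigma>)) * (\<Prod>i=1..n. A ((\<tau> \<circ> \<sigma>) (2*i - 1)) ((\<tau> \<circ> \<sigma>) (2*i))) =
      of_int (sign \<tau>) * (of_int (sign \<sigma>) * (\<Prod>i=1..n. A (\<tau> (\<sigma> (2*i - 1))) (\<tau> (\<sigma> (2*i)))))"
      by (simp only: of_int_mult comp_apply mult.assoc)
  qed
  finally show ?thesis by (simp add: pfaffian_def sum_distrib_left)
qed

text \<open>
  Every product in the Pfaffian uses each index exactly once.
\<close>

lemma pfaffian_rescale:
  "pfaffian n (\<lambda>i j. e i * e j * B i j) = (\<Prod>i=1..2*n. e i) * pfaffian n B"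
proof -
  have "(\<Prod>k=1..n. e (\<sigma> (2*k - 1)) * e (\<sigma> (2*k)) * B (\<sigma> (2*k - 1)) (\<sigma> (2*k))) =
      (\<Prod>i=1..2*n. e i) * (\<Prod>k=1..n. B (\<sigma> (2*k - 1)) (\<sigma> (2*k)))"
    if "\<sigma> permutes {1..2*n}" for \<sigma>
  proof -
    have "(\<Prod>i=1..2*n. e i) = (\<Prod>i=1..2*n. e (\<sigma> i))"
      using prod.permute[OF that, of e] by simp
    also have "\<dots> = (\<Prod>k=1..n. e (\<sigma> (2*k - 1)) * e (\<sigma> (2*k)))" by (rule prod_pairs)
    finally show ?thesis by (simp add: prod.distrib)
  qed
  then show ?thesis by (simp add: pfaffian_def sum_distrib_left mult_ac)
qed

definition rotation :: "nat \<Rightarrow> nat \<Rightarrow> nat" where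
  "rotation m i = (if i = m then 1 else if 1 \<le> i \<and> i < m then i + 1 else i)"

lemma rotation_permutes: "m \<ge> 1 \<Longrightarrow> rotation m permutes {1..m}"
proof (rule bij_imp_permutes)
  assume "m \<ge> 1"
  show "bij_betw (rotation m) {1..m} {1..m}"
    using \<open>m \<ge> 1\<close>
    by (intro bij_betwI[where g = "\<lambda>i. if i = 1 then m else i - 1"]) (auto simp: rotation_def)
qed (auto simp: rotation_def)

lemma sign_rotation:
  assumes "m \<ge> 1" shows "sign (rotation m) = (-1) ^ (m - 1)"
proof -
  have "{(i, j). i \<in> {1..m} \<and> j \<in> {1..m} \<and> i < j \<and> rotation m j < rotation m i} = {1..<m} \<times> {m}"
    by (auto simp: rotation_def split: if_splits)
  then show ?thesis
    using sign_eq_inversions[OF _ rotation_permutes[OF assms]] by (simp add: card_cartesian_product)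
qed

text \<open>
  Rotating the indices moves the first row and column to the end, where the signs of their entries
  in a skew-symmetric matrix are reversed; this contributes one factor \<open>-1\<close>, and the
  rotation itself, a cycle of even length, contributes another.
\<close>

lemma pfaffian_rotate:
  assumes n: "n \<ge> 1" and sym: "\<And>i j. f i j = f j i"
  shows "pfaffian n (skew_matrix (\<lambda>i j. f (rotation (2*n) i) (rotation (2*n) j))) =
    pfaffian n (skew_matrix f)"
proof -
  let ?c = "rotation (2*n)"
  \<comment> \<open>the rotation sends \<open>2 * n\<close> to \<open>1\<close>, so it reverses the order of exactly the pairs that contain \<open>2 * n\<close>\<close>
  define e where "e i = (if i = 2*n then -1 else 1 :: real)" for i
  have c: "?c permutes {1..2*n}" using n by (intro rotation_permutes) auto
  have "pfaffian n (skew_matrix (\<lambda>i j. f (?c i) (?c j))) =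
    pfaffian n (\<lambda>i j. e i * e j * skew_matrix f (?c i) (?c j))"
    by (rule pfaffian_cong) (auto simp: skew_matrix_def rotation_def e_def sym)
  also have "\<dots> = (\<Prod>i=1..2*n. e i) * pfaffian n (\<lambda>i j. skew_matrix f (?c i) (?c j))"
    by (rule pfaffian_rescale)
  also have "(\<Prod>i=1..2*n. e i) = -1"
  proof -
    have "{1..2*n} = insert (2*n) {1..<2*n}" using n by auto
    then have "(\<Prod>i=1..2*n. e i) = e (2*n) * (\<Prod>i\<in>{1..<2*n}. e i)" by simp
    also have "(\<Prod>i\<in>{1..<2*n}. e i) = 1" by (rule prod.neutral) (auto simp: e_def)
    finally show ?thesis by (simp add: e_def)
  qed
  also have "pfaffian n (\<lambda>i j. skew_matrix f (?c i) (?c j)) = - pfaffian n (skew_matrix f)"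
    using pfaffian_relabel[OF c, of "skew_matrix f"] sign_rotation[of "2*n"] n
    by (simp add: uminus_power_if)
  finally show ?thesis by simp
qed

text \<open>
  The sum defining a Pfaffian, with a separate matrix for each of the \<open>n\<close> factors, so
  that the two indices of one factor can be interchanged while the other factors stay as they are.
\<close>

definition pair_sum :: "nat \<Rightarrow> (nat \<Rightarrow> nat \<Rightarrow> nat \<Rightarrow> real) \<Rightarrow> real" where
  "pair_sum n B = (\<Sum>\<sigma> | \<sigma> permutes {1..2*n}. of_int (sign \<sigma>) * (\<Prod>k=1..n. B k (\<sigma> (2*k - 1)) (\<sigma> (2*k))))"

text \<open>
  Composing with the transposition of the indices of the \<open>m\<close>-th factor turns the
  transposed term into the original one, with the opposite sign.
\<close>

lemma pair_sum_fold:
  assumes m: "m \<in> {1..n}"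
  shows "pair_sum n (B(m := \<lambda>i j. C i j - C j i)) = 2 * pair_sum n (B(m := C))"
proof -
  let ?t = "transpose (2*m - 1) (2*m)"
  let ?P = "\<lambda>\<sigma> X. \<Prod>k=1..n. (B(m := X)) k (\<sigma> (2*k - 1)) (\<sigma> (2*k))"
  let ?Q = "\<lambda>\<sigma>. \<Prod>k\<in>{1..n} - {m}. B k (\<sigma> (2*k - 1)) (\<sigma> (2*k))"
  have split: "?P \<sigma> X = X (\<sigma> (2*m - 1)) (\<sigma> (2*m)) * ?Q \<sigma>" for \<sigma> X
    using m by (subst prod.remove[of _ m]) (auto intro!: prod.cong)
  have t: "?t permutes {1..2*n}" using m by (intro permutes_swap_id) auto
  have "(\<Sum>\<sigma> | \<sigma> permutes {1..2*n}. of_int (sign \<sigma>) * ?P \<sigma> (\<lambda>i j. C j i)) =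
      (\<Sum>\<sigma> | \<sigma> permutes {1..2*n}. of_int (sign (\<sigma> \<circ> ?t)) * ?P (\<sigma> \<circ> ?t) (\<lambda>i j. C j i))"
    by (rule sum_permutations_compose_right[OF t])
  also have "\<dots> = (\<Sum>\<sigma> | \<sigma> permutes {1..2*n}. - (of_int (sign \<sigma>) * ?P \<sigma> C))"
  proof (intro sum.cong refl)
    fix \<sigma> assume s: "\<sigma> \<in> {\<sigma>. \<sigma> permutes {1..2*n}}"
    have "2*m - 1 \<noteq> 2*m" using m by auto
    then have "sign (\<sigma> \<circ> ?t) = - sign \<sigma>"
      using s t by (subst sign_compose_permutes[of "{1..2*n}"]) (simp_all add: sign_swap_id)
    moreover have "?Q (\<sigma> \<circ> ?t) = ?Q \<sigma>"
    proof (intro prod.cong refl)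
      fix k assume "k \<in> {1..n} - {m}"
      then have "?t (2*k - 1) = 2*k - 1" "?t (2*k) = 2*k"
        using m by (auto simp: transpose_def)
      then show "B k ((\<sigma> \<circ> ?t) (2*k - 1)) ((\<sigma> \<circ> ?t) (2*k)) = B k (\<sigma> (2*k - 1)) (\<sigma> (2*k))"
        by simp
    qed
    ultimately show "of_int (sign (\<sigma> \<circ> ?t)) * ?P (\<sigma> \<circ> ?t) (\<lambda>i j. C j i) = - (of_int (sign \<sigma>) * ?P \<sigma> C)"
      unfolding split by simp
  qed
  finally have swap: "(\<Sum>\<sigma> | \<sigma> permutes {1..2*n}. of_int (sign \<sigma>) * ?P \<sigma> (\<lambda>i j. C j i)) =
      - pair_sum n (B(m := C))"
    by (simp add: pair_sum_def sum_negf)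
  have "pair_sum n (B(m := \<lambda>i j. C i j - C j i)) = (\<Sum>\<sigma> | \<sigma> permutes {1..2*n}.
      of_int (sign \<sigma>) * ?P \<sigma> C - of_int (sign \<sigma>) * ?P \<sigma> (\<lambda>i j. C j i))"
    unfolding pair_sum_def split by (intro sum.cong refl) (simp add: algebra_simps)
  also have "\<dots> = pair_sum n (B(m := C)) - (\<Sum>\<sigma> | \<sigma> permutes {1..2*n}. of_int (sign \<sigma>) * ?P \<sigma> (\<lambda>i j. C j i))"
    by (simp add: sum_subtractf pair_sum_def)
  finally show ?thesis using swap by simp
qed

lemma pair_sum_antisymmetrize:
  assumes "m \<le> n"
  shows "pair_sum n (\<lambda>k. if k \<le> m then \<lambda>i j. C i j - C j i else C) = 2 ^ m * pair_sum n (\<lambda>_. C)"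
  using assms
proof (induction m)
  case 0
  then show ?case by (auto simp: pair_sum_def intro!: sum.cong prod.cong)
next
  case (Suc m)
  let ?B = "\<lambda>m k. if k \<le> m then \<lambda>i j. C i j - C j i else C"
  have "?B (Suc m) = (?B m)(Suc m := \<lambda>i j. C i j - C j i)" "?B m = (?B m)(Suc m := C)"
    by (auto simp: fun_eq_iff)
  then show ?case
    using pair_sum_fold[of "Suc m" n "?B m" C] Suc by simp
qed

text \<open>
  Acts as \<open>\<pi>\<close> on the odd and as \<open>\<rho>\<close> on the even numbers, both
  enumerated from \<open>1\<close>. These are the parity-preserving permutations of \<open>{1..2 *
  n}\<close>.
\<close>

definition interleave_permutations :: "nat \<Rightarrow> (nat \<Rightarrow> nat) \<Rightarrow> (nat \<Rightarrow> nat) \<Rightarrow> nat \<Rightarrow> nat" where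
  "interleave_permutations n \<pi> \<rho> =
     map_permutation {1..n} (\<lambda>k. 2*k - 1) \<pi> \<circ> map_permutation {1..n} (\<lambda>k. 2*k) \<rho>"

lemma
  assumes p: "\<pi> permutes {1..n}" "\<rho> permutes {1..n}"
  shows interleave_permutations_permutes: "interleave_permutations n \<pi> \<rho> permutes {1..2*n}"
    and sign_interleave_permutations: "sign (interleave_permutations n \<pi> \<rho>) = sign \<pi> * sign \<rho>"
    and interleave_permutations_odd:
      "k \<in> {1..n} \<Longrightarrow> interleave_permutations n \<pi> \<rho> (2*k - 1) = 2 * \<pi> k - 1"
    and interleave_permutations_even:
      "k \<in> {1..n} \<Longrightarrow> interleave_permutations n \<pi> \<rho> (2*k) = 2 * \<rho> k"
proof -
  let ?I = "{1..n}" and ?od = "\<lambda>k::nat. 2*k - 1" and ?ev = "\<lambda>k::nat. 2*k"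
  have inj: "inj_on ?od ?I" "inj_on ?ev ?I" by (auto simp: inj_on_def)
  have perm: "map_permutation ?I ?od \<pi> permutes ?od ` ?I" "map_permutation ?I ?ev \<rho> permutes ?ev ` ?I"
    using p inj by (auto intro!: map_permutation_permutes simp: bij_betw_def)
  have "?od ` ?I \<subseteq> {1..2*n}" "?ev ` ?I \<subseteq> {1..2*n}" by auto
  then have perm2: "map_permutation ?I ?od \<pi> permutes {1..2*n}" "map_permutation ?I ?ev \<rho> permutes {1..2*n}"
    using perm by (blast intro: permutes_subset)+
  show "interleave_permutations n \<pi> \<rho> permutes {1..2*n}"
    unfolding interleave_permutations_def using perm2 by (intro permutes_compose)
  show "sign (interleave_permutations n \<pi> \<rho>) = sign \<pi> * sign \<rho>"
    unfolding interleave_permutations_def using perm2 p inj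
    by (subst sign_compose_permutes[of "{1..2*n}"]) (simp_all add: sign_map_permutation)
  have odd_ev: "?od j \<noteq> ?ev k" if "j \<in> ?I" for j k using that by (auto; presburger)
  then have "2 * k \<noteq> 2 * j - 1" if "j \<in> ?I" for j k using that by metis
  with odd_ev have disj: "?od k \<notin> ?ev ` ?I" "?ev k \<notin> ?od ` ?I" if "k \<in> ?I" for k
    using that by blast+
  show "interleave_permutations n \<pi> \<rho> (2*k - 1) = 2 * \<pi> k - 1" if "k \<in> ?I"
    unfolding interleave_permutations_def comp_apply
      permutes_not_in[OF perm(2) disj(1)[OF that]]
    by (rule map_permutation_apply[OF inj(1) that])
  show "interleave_permutations n \<pi> \<rho> (2*k) = 2 * \<rho> k" if "k \<in> ?I"
    unfolding interleave_permutations_def comp_apply map_permutation_apply[OF inj(2) that]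
    by (rule permutes_not_in[OF perm(1) disj(2)[OF permutes_mem[OF p(2) that]]])
qed

lemma bij_betw_interleave_permutations:
  "bij_betw (\<lambda>(\<pi>, \<rho>). interleave_permutations n \<pi> \<rho>)
    ({\<pi>. \<pi> permutes {1..n}} \<times> {\<rho>. \<rho> permutes {1..n}})
    {\<sigma>. \<sigma> permutes {1..2*n} \<and> (\<forall>k\<in>{1..n}. odd (\<sigma> (2*k - 1)) \<and> even (\<sigma> (2*k)))}"
    (is "bij_betw ?F _ ?T")
proof -
  let ?I = "{1..n}"
  note val = interleave_permutations_odd interleave_permutations_even
  show "bij_betw ?F ({\<pi>. \<pi> permutes ?I} \<times> {\<rho>. \<rho> permutes ?I}) ?T"
    unfolding bij_betw_def
  proof (intro conjI)
    show "inj_on ?F ({\<pi>. \<pi> permutes ?I} \<times> {\<rho>. \<rho> permutes ?I})"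
    proof (rule inj_onI, clarify)
      fix \<pi> \<rho> \<pi>' \<rho>' assume p: "\<pi> permutes ?I" "\<rho> permutes ?I" "\<pi>' permutes ?I" "\<rho>' permutes ?I"
        and eq: "interleave_permutations n \<pi> \<rho> = interleave_permutations n \<pi>' \<rho>'"
      have "\<pi> k = \<pi>' k \<and> \<rho> k = \<rho>' k" for k
      proof (cases "k \<in> ?I")
        case True
        then have "2 * \<pi> k - 1 = 2 * \<pi>' k - 1" "2 * \<rho> k = 2 * \<rho>' k"
          using val[OF p(1,2) True] val[OF p(3,4) True] eq by auto
        moreover have "\<pi> k \<in> ?I" "\<pi>' k \<in> ?I" using p True by (blast intro: permutes_mem)+
        ultimately show ?thesis by auto
      next
        case False
        then show ?thesis using p by (simp add: permutes_not_in)
      qed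
      then show "\<pi> = \<pi>' \<and> \<rho> = \<rho>'" by auto
    qed
    show "?F ` ({\<pi>. \<pi> permutes ?I} \<times> {\<rho>. \<rho> permutes ?I}) = ?T"
    proof (intro equalityI subsetI)
      fix \<sigma> assume "\<sigma> \<in> ?F ` ({\<pi>. \<pi> permutes ?I} \<times> {\<rho>. \<rho> permutes ?I})"
      then obtain \<pi> \<rho> where p: "\<pi> permutes ?I" "\<rho> permutes ?I" and s: "\<sigma> = ?F (\<pi>, \<rho>)" by auto
      have "odd (2 * \<pi> k - 1)" if "k \<in> ?I" for k using permutes_mem[OF p(1) that] by auto
      then show "\<sigma> \<in> ?T"
        using interleave_permutations_permutes[OF p]
        unfolding s by (simp add: val[OF p] del: One_nat_def)
    next
      fix \<sigma> assume "\<sigma> \<in> ?T"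
      then have s: "\<sigma> permutes {1..2*n}" and odd: "\<And>k. k \<in> ?I \<Longrightarrow> odd (\<sigma> (2*k - 1))"
        and even: "\<And>k. k \<in> ?I \<Longrightarrow> even (\<sigma> (2*k))" by auto
      have inj_s: "\<sigma> x = \<sigma> y \<Longrightarrow> x = y" for x y using permutes_inj[OF s] by (auto dest: injD)
      have range: "\<sigma> (2*k - 1) \<in> {1..2*n}" "\<sigma> (2*k) \<in> {1..2*n}" if "k \<in> ?I" for k
        using that by (intro permutes_mem[OF s]; auto)+
      define \<pi> where "\<pi> k = (if k \<in> ?I then (\<sigma> (2*k - 1) + 1) div 2 else k)" for k
      define \<rho> where "\<rho> k = (if k \<in> ?I then \<sigma> (2*k) div 2 else k)" for k
      have \<pi>: "2 * \<pi> k - 1 = \<sigma> (2*k - 1)" "\<pi> k \<in> ?I" if "k \<in> ?I" for k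
        using odd[OF that] range[OF that] that by (auto simp: \<pi>_def elim!: oddE)
      have \<rho>: "2 * \<rho> k = \<sigma> (2*k)" "\<rho> k \<in> ?I" if "k \<in> ?I" for k
        using even[OF that] range[OF that] that by (auto simp: \<rho>_def elim!: evenE)
      have p\<pi>: "\<pi> permutes ?I"
      proof (rule bij_imp_permutes)
        have "inj_on \<pi> ?I"
        proof (rule inj_onI)
          fix x y assume xy: "x \<in> ?I" "y \<in> ?I" "\<pi> x = \<pi> y"
          then have "\<sigma> (2*x - 1) = \<sigma> (2*y - 1)" using \<pi>(1) by metis
          then have "2*x - 1 = 2*y - 1" by (rule inj_s)
          then show "x = y" using xy by auto
        qed
        then show "bij_betw \<pi> ?I ?I"
          using \<pi>(2) by (intro bij_betw_imageI endo_inj_surj) auto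
      qed (auto simp: \<pi>_def)
      have p\<rho>: "\<rho> permutes ?I"
      proof (rule bij_imp_permutes)
        have "inj_on \<rho> ?I"
        proof (rule inj_onI)
          fix x y assume xy: "x \<in> ?I" "y \<in> ?I" "\<rho> x = \<rho> y"
          then have "\<sigma> (2*x) = \<sigma> (2*y)" using \<rho>(1) by metis
          then have "2*x = 2*y" by (rule inj_s)
          then show "x = y" by auto
        qed
        then show "bij_betw \<rho> ?I ?I"
          using \<rho>(2) by (intro bij_betw_imageI endo_inj_surj) auto
      qed (auto simp: \<rho>_def)
      have "\<sigma> i = ?F (\<pi>, \<rho>) i" for i
      proof (cases "i \<in> {1..2*n}")
        case True
        then consider k where "k \<in> ?I" "i = 2*k - 1" | k where "k \<in> ?I" "i = 2*k"
        proof (cases "even i")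
          case True
          then show ?thesis using \<open>i \<in> {1..2*n}\<close> that(2)[of "i div 2"] by auto
        next
          case False
          then show ?thesis using \<open>i \<in> {1..2*n}\<close> that(1)[of "(i + 1) div 2"] by (auto elim!: oddE)
        qed
        then show ?thesis using val[OF p\<pi> p\<rho>] \<pi>(1) \<rho>(1) by cases auto
      next
        case False
        then have "?F (\<pi>, \<rho>) i = i"
          using interleave_permutations_permutes[OF p\<pi> p\<rho>] by (simp add: permutes_not_in)
        then show ?thesis using s False by (simp add: permutes_not_in)
      qed
      then show "\<sigma> \<in> ?F ` ({\<pi>. \<pi> permutes ?I} \<times> {\<rho>. \<rho> permutes ?I})"
        using p\<pi> p\<rho> by (intro image_eqI[of _ _ "(\<pi>, \<rho>)"]) auto
    qed
  qed
qed

text \<open>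
  Only parity-preserving permutations contribute. Such a permutation is a pair \<open>(\<pi>,
  \<rho>)\<close>, whose contribution depends only on \<open>\<rho> \<circ> inv \<pi>\<close>;
  this accounts for the factor \<open>n!\<close>.
\<close>

lemma pair_sum_odd_even:
  assumes supp: "\<And>i j. C i j \<noteq> 0 \<Longrightarrow> odd i \<and> even j"
  shows "pair_sum n (\<lambda>_. C) =
    fact n * (\<Sum>\<pi> | \<pi> permutes {1..n}. of_int (sign \<pi>) * (\<Prod>k=1..n. C (2*k - 1) (2 * \<pi> k)))"
proof -
  let ?I = "{1..n}" and ?S = "{\<pi>. \<pi> permutes {1..n}}"
  let ?T = "{\<sigma>. \<sigma> permutes {1..2*n} \<and> (\<forall>k\<in>{1..n}. odd (\<sigma> (2*k - 1)) \<and> even (\<sigma> (2*k)))}"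
  let ?F = "interleave_permutations n"
  let ?g = "\<lambda>\<sigma>. of_int (sign \<sigma>) * (\<Prod>k=1..n. C (\<sigma> (2*k - 1)) (\<sigma> (2*k)))"
  let ?h = "\<lambda>\<theta>. of_int (sign \<theta>) * (\<Prod>k=1..n. C (2*k - 1) (2 * \<theta> k))"
  have "pair_sum n (\<lambda>_. C) = (\<Sum>\<sigma>\<in>?T. ?g \<sigma>)"
    unfolding pair_sum_def
  proof (rule sum.mono_neutral_right)
    show "\<forall>\<sigma>\<in>{\<sigma>. \<sigma> permutes {1..2*n}} - ?T. ?g \<sigma> = 0"
    proof
      fix \<sigma> assume "\<sigma> \<in> {\<sigma>. \<sigma> permutes {1..2*n}} - ?T"
      then obtain k where "k \<in> {1..n}" "\<not> (odd (\<sigma> (2*k - 1)) \<and> even (\<sigma> (2*k)))" by blast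
      then have "C (\<sigma> (2*k - 1)) (\<sigma> (2*k)) = 0" using supp by blast
      then show "?g \<sigma> = 0" using \<open>k \<in> {1..n}\<close> by (auto intro!: prod_zero)
    qed
  qed (auto simp: finite_permutations)
  also have "\<dots> = (\<Sum>(\<pi>, \<rho>)\<in>?S \<times> ?S. ?g (?F \<pi> \<rho>))"
    using sum.reindex_bij_betw[OF bij_betw_interleave_permutations[of n], of ?g]
    by (simp add: case_prod_unfold)
  also have "\<dots> = (\<Sum>\<pi>\<in>?S. \<Sum>\<rho>\<in>?S. of_int (sign \<pi>) * of_int (sign \<rho>) * (\<Prod>k=1..n. C (2 * \<pi> k - 1) (2 * \<rho> k)))"
    unfolding sum.cartesian_product
  proof (intro sum.cong refl, clarify)
    fix \<pi> \<rho> assume p: "\<pi> permutes ?I" "\<rho> permutes ?I"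
    show "?g (?F \<pi> \<rho>) = of_int (sign \<pi>) * of_int (sign \<rho>) * (\<Prod>k=1..n. C (2 * \<pi> k - 1) (2 * \<rho> k))"
      unfolding sign_interleave_permutations[OF p] of_int_mult
      using interleave_permutations_odd[OF p] interleave_permutations_even[OF p]
      by (intro arg_cong2[of _ _ _ _ "(*)"] prod.cong refl) auto
  qed
  also have "\<dots> = (\<Sum>\<pi>\<in>?S. \<Sum>\<theta>\<in>?S. ?h \<theta>)"
  proof (rule sum.cong[OF refl])
    fix \<pi> assume "\<pi> \<in> ?S"
    then have p: "\<pi> permutes ?I" by simp
    have "(\<Sum>\<rho>\<in>?S. of_int (sign \<pi>) * of_int (sign \<rho>) * (\<Prod>k=1..n. C (2 * \<pi> k - 1) (2 * \<rho> k))) =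
      (\<Sum>\<theta>\<in>?S. of_int (sign \<pi>) * of_int (sign (\<theta> \<circ> \<pi>)) * (\<Prod>k=1..n. C (2 * \<pi> k - 1) (2 * (\<theta> \<circ> \<pi>) k)))"
      by (rule sum_permutations_compose_right[OF p])
    also have "\<dots> = (\<Sum>\<theta>\<in>?S. ?h \<theta>)"
    proof (rule sum.cong[OF refl])
      fix \<theta> assume "\<theta> \<in> ?S"
      then have "sign (\<theta> \<circ> \<pi>) = sign \<theta> * sign \<pi>"
        using p by (intro sign_compose_permutes[of ?I]) auto
      moreover have "sign \<pi> * sign \<pi> = 1" by simp
      ultimately have "sign \<pi> * sign (\<theta> \<circ> \<pi>) = sign \<theta>" by (metis mult.commute mult.left_commute mult_1)
      moreover have "(\<Prod>k=1..n. C (2 * \<pi> k - 1) (2 * (\<theta> \<circ> \<pi>) k)) = (\<Prod>k=1..n. C (2 * k - 1) (2 * \<theta> k))"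
        using prod.permute[OF p, of "\<lambda>k. C (2 * k - 1) (2 * \<theta> k)"] by (simp add: o_def)
      ultimately show "of_int (sign \<pi>) * of_int (sign (\<theta> \<circ> \<pi>)) * (\<Prod>k=1..n. C (2 * \<pi> k - 1) (2 * (\<theta> \<circ> \<pi>) k)) = ?h \<theta>"
        by (simp only: of_int_mult[symmetric])
    qed
    finally show "(\<Sum>\<rho>\<in>?S. of_int (sign \<pi>) * of_int (sign \<rho>) * (\<Prod>k=1..n. C (2 * \<pi> k - 1) (2 * \<rho> k))) = (\<Sum>\<theta>\<in>?S. ?h \<theta>)" .
  qed
  also have "\<dots> = fact n * (\<Sum>\<theta>\<in>?S. ?h \<theta>)"
    by (simp add: card_permutations)
  finally show ?thesis .
qed

text \<open>
  After relabelling, nonzero entries join odd and even indices, and the matrix is the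
  antisymmetrization of its part \<open>C\<close> with odd rows and even columns. Replacing the
  matrix by \<open>C\<close> in each factor cancels the power of two in the definition of the
  Pfaffian, and the parity-preserving permutations cancel the factorial.
\<close>

lemma pfaffian_bipartite:
  fixes A :: "nat \<Rightarrow> nat \<Rightarrow> real"
  assumes \<tau>: "\<tau> permutes {1..2*n}"
    and skew: "\<And>i j. A i j = - A j i"
    and bip: "\<And>i j. i \<in> {1..2*n} \<Longrightarrow> j \<in> {1..2*n} \<Longrightarrow> even i \<longleftrightarrow> even j \<Longrightarrow> A (\<tau> i) (\<tau> j) = 0"
  shows "pfaffian n A =
    of_int (sign \<tau>) * (\<Sum>\<pi> | \<pi> permutes {1..n}. of_int (sign \<pi>) * (\<Prod>k=1..n. A (\<tau> (2*k - 1)) (\<tau> (2 * \<pi> k))))"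
proof -
  define C where "C i j = (if odd i \<and> even j then A (\<tau> i) (\<tau> j) else 0)" for i j
  have "A (\<tau> i) (\<tau> j) = C i j - C j i" if "i \<in> {1..2*n}" "j \<in> {1..2*n}" for i j
    using bip[OF that] skew[of "\<tau> i" "\<tau> j"] by (auto simp: C_def)
  then have "pfaffian n (\<lambda>i j. A (\<tau> i) (\<tau> j)) = pfaffian n (\<lambda>i j. C i j - C j i)"
    by (rule pfaffian_cong)
  also have "\<dots> = pair_sum n (\<lambda>k. if k \<le> n then \<lambda>i j. C i j - C j i else C) / (2 ^ n * fact n)"
    by (simp add: pfaffian_def pair_sum_def)
  also have "\<dots> = pair_sum n (\<lambda>_. C) / fact n"
    by (simp add: pair_sum_antisymmetrize)
  also have "\<dots> = (\<Sum>\<pi> | \<pi> permutes {1..n}. of_int (sign \<pi>) * (\<Prod>k=1..n. C (2*k - 1) (2 * \<pi> k)))"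
    by (subst pair_sum_odd_even) (auto simp: C_def split: if_splits)
  also have "\<dots> = (\<Sum>\<pi> | \<pi> permutes {1..n}. of_int (sign \<pi>) * (\<Prod>k=1..n. A (\<tau> (2*k - 1)) (\<tau> (2 * \<pi> k))))"
    by (intro sum.cong arg_cong2[of _ _ _ _ "(*)"] prod.cong refl) (auto simp: C_def)
  finally show ?thesis using pfaffian_relabel[OF \<tau>, of A] by simp
qed

section \<open>Domino tilings and perfect matchings\<close>

lemma share_edge_sym: "share_edge c d \<longleftrightarrow> share_edge d c"
  by (auto simp: share_edge_def abs_minus_commute)

lemma share_edge_parity: "share_edge c d \<Longrightarrow> even (fst c + snd c) \<longleftrightarrow> odd (fst d + snd d)"
proof -
  assume "share_edge c d"
  then have "odd (\<bar>fst c - fst d\<bar> + \<bar>snd c - snd d\<bar>)" by (simp add: share_edge_def)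
  then have "odd ((fst c - fst d) + (snd c - snd d))"
    by (metis even_abs_add_iff even_add_abs_iff)
  then show ?thesis by presburger
qed

lemma share_edge_neq: "share_edge c d \<Longrightarrow> c \<noteq> d"
  by (auto simp: share_edge_def)

lemma domino_tilingsD:
  assumes "T \<in> domino_tilings R"
  shows "\<And>D. D \<in> T \<Longrightarrow> \<exists>c d. D = {c, d} \<and> share_edge c d \<and> c \<in> R \<and> d \<in> R"
    and "\<And>c. c \<in> R \<Longrightarrow> \<exists>D\<in>T. c \<in> D"
    and "\<And>D E c. D \<in> T \<Longrightarrow> E \<in> T \<Longrightarrow> c \<in> D \<Longrightarrow> c \<in> E \<Longrightarrow> D = E"
proof -
  have sub: "T \<subseteq> dominoes" and disj: "disjoint T" and R: "\<Union>T = R"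
    using assms by (simp_all add: domino_tilings_def)
  show "\<exists>c d. D = {c, d} \<and> share_edge c d \<and> c \<in> R \<and> d \<in> R" if D: "D \<in> T" for D
  proof -
    obtain c d where "D = {c, d}" "share_edge c d" using sub D by (auto simp: dominoes_def)
    then show ?thesis using R D by blast
  qed
  show "\<exists>D\<in>T. c \<in> D" if "c \<in> R" for c using R that by blast
  show "D = E" if "D \<in> T" "E \<in> T" "c \<in> D" "c \<in> E" for D E c
    using disjointD[OF disj that(1,2)] that(3,4) by blast
qed

lemma domino_covering:
  assumes T: "T \<in> domino_tilings R" and c: "c \<in> R"
  shows "\<exists>d\<in>R. {c, d} \<in> T \<and> share_edge c d"
proof -
  obtain D where D: "D \<in> T" "c \<in> D" using domino_tilingsD(2)[OF T c] by blast
  then obtain x y where "D = {x, y}" "share_edge x y" "x \<in> R" "y \<in> R"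
    using domino_tilingsD(1)[OF T] by blast
  then show ?thesis using D by (metis insertE insert_commute share_edge_sym singletonD)
qed

text \<open>
  Every tiling pairs each square with a neighbour of the other colour.
\<close>

lemma tiling_balanced:
  assumes T: "T \<in> domino_tilings R" and fin: "finite R"
  shows "card {c \<in> R. even (fst c + snd c)} = card {c \<in> R. odd (fst c + snd c)}"
proof -
  let ?E = "{c \<in> R. even (fst c + snd c)}" and ?O = "{c \<in> R. odd (fst c + snd c)}"
  \<comment> \<open>the partner of a square, an involution that exchanges the colours\<close>
  define m where "m c = (SOME d. d \<in> R \<and> {c, d} \<in> T \<and> share_edge c d)" for c
  have m: "m c \<in> R" "{c, m c} \<in> T" "share_edge c (m c)" if "c \<in> R" for c
  proof -
    have "m c \<in> R \<and> {c, m c} \<in> T \<and> share_edge c (m c)"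
      unfolding m_def by (rule someI_ex) (use domino_covering[OF T that] in blast)
    then show "m c \<in> R" "{c, m c} \<in> T" "share_edge c (m c)" by simp_all
  qed
  have mm: "m (m c) = c" if "c \<in> R" for c
  proof -
    have "{m c, m (m c)} = {c, m c}"
      using m[OF that] m[OF m(1)[OF that]] domino_tilingsD(3)[OF T] by blast
    then show ?thesis using share_edge_neq[OF m(3)[OF m(1)[OF that]]] by (auto simp: doubleton_eq_iff)
  qed
  have par: "even (fst (m c) + snd (m c)) \<longleftrightarrow> odd (fst c + snd c)" if "c \<in> R" for c
    using share_edge_parity[OF m(3)[OF that]] by blast
  have "bij_betw m ?E ?O"
  proof (rule bij_betwI[where g = m])
    show "m \<in> ?E \<rightarrow> ?O" "m \<in> ?O \<rightarrow> ?E"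
      using m(1) par unfolding Pi_iff mem_Collect_eq by blast+
  qed (use mm in blast)+
  then show ?thesis by (rule bij_betw_same_card)
qed

lemma M_isometry:
  assumes fg: "\<And>c. f (g c) = c" "\<And>c. g (f c) = c"
    and edge: "\<And>c d. share_edge (f c) (f d) \<longleftrightarrow> share_edge c d"
  shows "M (f ` R) = M R"
proof -
  have img: "(`) h ` T \<in> domino_tilings (h ` R)"
    if T: "T \<in> domino_tilings R" and h: "inj h"
      and hedge: "\<And>c d. share_edge (h c) (h d) \<longleftrightarrow> share_edge c d" for h T R
  proof -
    have "(`) h ` T \<subseteq> dominoes"
    proof
      fix D assume "D \<in> (`) h ` T"
      then obtain c d where "D = h ` {c, d}" "share_edge c d"
        using domino_tilingsD(1)[OF T] by blast
      then have "D = {h c, h d}" "share_edge (h c) (h d)" using hedge by simp_all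
      then show "D \<in> dominoes" unfolding dominoes_def by blast
    qed
    moreover have "disjoint ((`) h ` T)"
      using T h by (intro disjoint_image) (auto simp: domino_tilings_def intro: inj_on_subset)
    ultimately show ?thesis using T by (auto simp: domino_tilings_def)
  qed
  have f: "inj f" and g: "inj g" using fg by (metis injI)+
  have edge': "share_edge (g c) (g d) \<longleftrightarrow> share_edge c d" for c d
    using edge[of "g c" "g d"] by (simp add: fg)
  have inv1: "g ` f ` A = A" "f ` g ` A = A" for A by (auto simp: image_image fg)
  have "bij_betw ((`) ((`) f)) (domino_tilings R) (domino_tilings (f ` R))"
  proof (rule bij_betwI[where g = "(`) ((`) g)"])
    show "(`) ((`) f) \<in> domino_tilings R \<rightarrow> domino_tilings (f ` R)"
      using img[OF _ f edge] by blast
    show "(`) ((`) g) \<in> domino_tilings (f ` R) \<rightarrow> domino_tilings R"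
      using img[OF _ g edge', of _ "f ` R"] by (auto simp: inv1)
  qed (simp_all add: image_image fg)
  then show ?thesis unfolding M_def by (rule bij_betw_same_card[symmetric])
qed

text \<open>
  A square with a single possible partner is covered by the same domino in all tilings.
\<close>

lemma M_forced_domino:
  assumes c: "c \<in> R" and d: "d \<in> R" and cd: "share_edge c d"
    and forced: "\<And>e. e \<in> R \<Longrightarrow> share_edge c e \<Longrightarrow> e = d"
  shows "M R = M (R - {c, d})"
proof -
  have mem: "{c, d} \<in> T" if "T \<in> domino_tilings R" for T
    using domino_covering[OF that c] forced by blast
  have "bij_betw (\<lambda>T. T - {{c, d}}) (domino_tilings R) (domino_tilings (R - {c, d}))"
  proof (rule bij_betwI[where g = "insert {c, d}"])
    show "(\<lambda>T. T - {{c, d}}) \<in> domino_tilings R \<rightarrow> domino_tilings (R - {c, d})"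
    proof
      fix T assume T: "T \<in> domino_tilings R"
      note m = mem[OF T]
      have disj: "disjoint T" and sub: "T \<subseteq> dominoes" and R: "\<Union>T = R"
        using T by (auto simp: domino_tilings_def)
      have "\<Union>(T - {{c, d}}) = R - {c, d}"
      proof
        show "\<Union>(T - {{c, d}}) \<subseteq> R - {c, d}"
        proof
          fix x assume "x \<in> \<Union>(T - {{c, d}})"
          then obtain D where D: "D \<in> T" "D \<noteq> {c, d}" "x \<in> D" by blast
          then have "D \<inter> {c, d} = {}" using disj m by (simp add: disjointD)
          then show "x \<in> R - {c, d}" using D R by blast
        qed
      qed (use R in blast)
      then show "T - {{c, d}} \<in> domino_tilings (R - {c, d})"
        using pairwise_subset[OF disj, of "T - {{c, d}}"] sub by (auto simp: domino_tilings_def)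
    qed
    show "insert {c, d} \<in> domino_tilings (R - {c, d}) \<rightarrow> domino_tilings R"
    proof
      fix T assume T: "T \<in> domino_tilings (R - {c, d})"
      then have U: "\<Union>T = R - {c, d}" and "disjoint T" "T \<subseteq> dominoes"
        by (auto simp: domino_tilings_def)
      moreover have "disjoint (insert {c, d} T)"
      proof -
        have "{c, d} \<inter> D = {}" "D \<inter> {c, d} = {}" if "D \<in> T" for D using U that by blast+
        then show ?thesis using \<open>disjoint T\<close> by (simp add: pairwise_insert disjnt_def)
      qed
      moreover have "{c, d} \<in> dominoes" using cd unfolding dominoes_def by blast
      ultimately show "insert {c, d} T \<in> domino_tilings R"
        using c d by (auto simp: domino_tilings_def)
    qed
    show "insert {c, d} (T - {{c, d}}) = T" if "T \<in> domino_tilings R" for T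
      using mem[OF that] by blast
    show "insert {c, d} T - {{c, d}} = T" if "T \<in> domino_tilings (R - {c, d})" for T
      using that by (auto simp: domino_tilings_def)
  qed
  then show ?thesis unfolding M_def by (rule bij_betw_same_card)
qed

text \<open>
  A tiling is a perfect matching between the remaining white and black squares, that is a
  bijection between \<open>I - S\<close> and \<open>I - b ` S\<close>. Extending it by
  \<open>b\<close> on the removed squares gives a permutation of the whole index set, whatever
  squares are removed; this is the form in which tilings occur as terms of the determinant of a
  matrix of fixed size.
\<close>

lemma M_eq_card_permutations:
  fixes wc bc :: "'i \<Rightarrow> cell"
  assumes I: "finite I" and wc: "inj_on wc I" and bc: "inj_on bc I"
    and white: "\<And>i j. i \<in> I \<Longrightarrow> j \<in> I \<Longrightarrow> \<not> share_edge (wc i) (wc j)"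
    and black: "\<And>i j. i \<in> I \<Longrightarrow> j \<in> I \<Longrightarrow> \<not> share_edge (bc i) (bc j)"
    and wb: "\<And>i j. i \<in> I \<Longrightarrow> j \<in> I \<Longrightarrow> wc i \<noteq> bc j"
    and S: "S \<subseteq> I" "inj_on b S" "b ` S \<subseteq> I"
  shows "M ((wc ` I \<union> bc ` I) - (wc ` S \<union> bc ` b ` S)) =
    card {p. p permutes I \<and> (\<forall>i\<in>S. p i = b i) \<and> (\<forall>i\<in>I - S. share_edge (wc i) (bc (p i)))}"
    (is "M ?R = card ?P")
proof -
  let ?F = "\<lambda>p. (\<lambda>i. {wc i, bc (p i)}) ` (I - S)"
  have R: "?R = wc ` (I - S) \<union> bc ` (I - b ` S)"
  proof -
    have "wc ` (I - S) = wc ` I - wc ` S" "bc ` (I - b ` S) = bc ` I - bc ` b ` S"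
      using S by (auto intro!: inj_on_image_set_diff[OF wc] inj_on_image_set_diff[OF bc])
    moreover have "wc ` I \<inter> bc ` I = {}"
      by (rule equals0I) (metis IntE imageE wb)
    moreover have "wc ` S \<subseteq> wc ` I" "bc ` b ` S \<subseteq> bc ` I" using S by (auto intro: image_mono)
    moreover have "(A \<union> B) - (C \<union> D) = (A - C) \<union> (B - D)"
      if "A \<inter> B = {}" "C \<subseteq> A" "D \<subseteq> B" for A B C D :: "cell set"
      using that by blast
    ultimately show ?thesis by presburger
  qed
  have injw: "i = j" if "wc i = wc j" "i \<in> I" "j \<in> I" for i j using that wc by (auto dest: inj_onD)
  have injb: "i = j" if "bc i = bc j" "i \<in> I" "j \<in> I" for i j using that bc by (auto dest: inj_onD)
  have "bij_betw ?F ?P (domino_tilings ?R)"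
    unfolding bij_betw_def
  proof (intro conjI)
    show "inj_on ?F ?P"
    proof (rule inj_onI)
      fix p q assume p: "p \<in> ?P" and q: "q \<in> ?P" and eq: "?F p = ?F q"
      have "p i = q i" for i
      proof (cases "i \<in> I - S")
        case True
        then have "{wc i, bc (p i)} \<in> ?F q" using eq by blast
        then obtain j where j: "j \<in> I - S" "{wc i, bc (p i)} = {wc j, bc (q j)}" by blast
        have mem: "p i \<in> I" "q j \<in> I" using p q True j by (auto simp: permutes_in_image)
        then have "wc i = wc j" "bc (p i) = bc (q j)"
          using j True wb by (auto simp: doubleton_eq_iff)
        then show ?thesis using injw[of i j] injb[of "p i" "q j"] j True mem by auto
      next
        case False
        then show ?thesis using p q by (cases "i \<in> S") (auto simp: permutes_not_in)
      qed
      then show "p = q" by auto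
    qed
    show "?F ` ?P = domino_tilings ?R"
    proof (intro equalityI subsetI)
      fix T assume "T \<in> ?F ` ?P"
      then obtain p where T: "T = ?F p" and p: "p permutes I" "\<And>i. i \<in> S \<Longrightarrow> p i = b i"
        and e: "\<And>i. i \<in> I - S \<Longrightarrow> share_edge (wc i) (bc (p i))" by auto
      have pI: "p i \<in> I" if "i \<in> I" for i using that p by (simp add: permutes_in_image)
      have "p ` (I - S) = I - b ` S"
        using p S(1) by (simp add: image_set_diff[OF permutes_inj] permutes_image cong: image_cong)
      moreover have "\<Union>T = wc ` (I - S) \<union> bc ` p ` (I - S)" unfolding T by auto
      ultimately have "\<Union>T = ?R" unfolding R by simp
      moreover have "T \<subseteq> dominoes" using e unfolding T dominoes_def by blast
      moreover have "disjoint T"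
      proof -
        have "{wc i, bc (p i)} \<inter> {wc j, bc (p j)} = {}" if ij: "i \<in> I" "j \<in> I" "i \<noteq> j" for i j
        proof -
          have "p i \<noteq> p j" using permutes_inj[OF p(1)] ij by (auto dest: injD)
          then have "bc (p i) \<noteq> bc (p j)" "wc i \<noteq> wc j"
            using ij injb injw pI by blast+
          moreover have "wc i \<noteq> bc (p j)" "wc j \<noteq> bc (p i)" using wb ij pI by blast+
          ultimately show ?thesis by auto
        qed
        then have "disjnt {wc i, bc (p i)} {wc j, bc (p j)}"
          if "i \<in> I" "j \<in> I" "i \<noteq> j" for i j
          using that by (simp add: disjnt_def)
        then show ?thesis unfolding T by (auto intro!: pairwise_imageI)
      qed
      ultimately show "T \<in> domino_tilings ?R" by (simp add: domino_tilings_def)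
    next
      fix T assume "T \<in> domino_tilings ?R"
      define Q where "Q = wc ` (I - S) \<union> bc ` (I - b ` S)"
      have T: "T \<in> domino_tilings Q"
        using \<open>T \<in> domino_tilings ?R\<close> unfolding R Q_def .
      have ex: "\<exists>j. j \<in> I - b ` S \<and> {wc i, bc j} \<in> T \<and> share_edge (wc i) (bc j)" if i: "i \<in> I - S" for i
      proof -
        have "wc i \<in> Q" using i unfolding Q_def by blast
        from domino_covering[OF T this] obtain d where
          d: "d \<in> Q" "{wc i, d} \<in> T" "share_edge (wc i) d" by blast
        then have "d \<notin> wc ` I" using white i by auto
        then obtain j where "j \<in> I - b ` S" "d = bc j" using d(1) unfolding Q_def by auto
        then show ?thesis using d by auto
      qed
      define m where "m i = (SOME j. j \<in> I - b ` S \<and> {wc i, bc j} \<in> T \<and> share_edge (wc i) (bc j))" for i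
      have m: "m i \<in> I - b ` S" "{wc i, bc (m i)} \<in> T" "share_edge (wc i) (bc (m i))"
        if "i \<in> I - S" for i
      proof -
        have "m i \<in> I - b ` S \<and> {wc i, bc (m i)} \<in> T \<and> share_edge (wc i) (bc (m i))"
          unfolding m_def by (rule someI_ex[OF ex[OF that]])
        then show "m i \<in> I - b ` S" "{wc i, bc (m i)} \<in> T" "share_edge (wc i) (bc (m i))" by simp_all
      qed
      define p where "p i = (if i \<in> S then b i else if i \<in> I then m i else i)" for i
      have "inj_on p I"
      proof (rule inj_onI)
        fix i j assume ij: "i \<in> I" "j \<in> I" "p i = p j"
        show "i = j"
        proof (cases "i \<in> S \<or> j \<in> S")
          case True
          have off: "b x \<noteq> m y" if "x \<in> S" "y \<in> I - S" for x y
            using m(1)[OF that(2)] that(1) by (metis DiffD2 imageI)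
          from True show ?thesis
            using ij off[of i j] off[of j i] S(2) by (auto simp: p_def dest: inj_onD split: if_splits)
        next
          case False
          then have iS: "i \<in> I - S" and jS: "j \<in> I - S" and mij: "m i = m j"
            using ij by (auto simp: p_def)
          have "{wc i, bc (m i)} = {wc j, bc (m j)}"
            by (rule domino_tilingsD(3)[OF T m(2)[OF iS] m(2)[OF jS], of "bc (m j)"]) (simp_all add: mij)
          moreover have "wc i \<noteq> bc (m j)" using wb m(1)[of j] False ij by auto
          ultimately show ?thesis using injw[of i j] ij by (auto simp: doubleton_eq_iff)
        qed
      qed
      moreover have "p ` I \<subseteq> I" using m(1) S by (auto simp: p_def)
      ultimately have p: "p permutes I"
        using S(1) I by (intro bij_imp_permutes bij_betw_imageI endo_inj_surj) (auto simp: p_def)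
      have pm: "p i = m i" if "i \<in> I - S" for i using that by (simp add: p_def)
      have "?F p = T"
      proof (intro equalityI subsetI)
        fix D assume "D \<in> ?F p"
        then show "D \<in> T" using m(2) pm by auto
      next
        fix D assume D: "D \<in> T"
        then obtain c d where cd: "D = {c, d}" "share_edge c d" "c \<in> Q" "d \<in> Q"
          using domino_tilingsD(1)[OF T D] by blast
        have "\<exists>i\<in>I - S. wc i \<in> D"
        proof (rule ccontr)
          assume "\<not> ?thesis"
          then have "c \<in> bc ` I" "d \<in> bc ` I" using cd unfolding Q_def by auto
          then show False using black cd(2) by auto
        qed
        then obtain i where i: "i \<in> I - S" "wc i \<in> D" by blast
        then have "D = {wc i, bc (m i)}" using m(2)[OF i(1)] domino_tilingsD(3)[OF T] D by blast
        then show "D \<in> ?F p" using i pm by auto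
      qed
      moreover have "p \<in> ?P" using p m pm by (auto simp: p_def)
      ultimately show "T \<in> ?F ` ?P" by blast
    qed
  qed
  then show ?thesis unfolding M_def by (rule bij_betw_same_card[symmetric])
qed

section \<open>Kasteleyn weights on the Aztec diamond with boundary defects\<close>

text \<open>
  The square \<open>W(p, q)\<close> has the number \<open>p * a + (q - 1)\<close> and \<open>B(p,
  q)\<close> the number \<open>(p - 1) * (a + 1) + q\<close>. Both colours are thereby numbered
  lexicographically by row \<open>p\<close> and column \<open>q\<close>, and both use the numbers
  below \<open>a * (a + 1)\<close>, although the rows of white squares have length
  \<open>a\<close> and those of black squares length \<open>a + 1\<close>.
\<close>

definition wrow :: "nat \<Rightarrow> nat \<Rightarrow> nat" where "wrow a i = i div a"
definition wcol :: "nat \<Rightarrow> nat \<Rightarrow> nat" where "wcol a i = i mod a + 1"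
definition brow :: "nat \<Rightarrow> nat \<Rightarrow> nat" where "brow a j = j div (a + 1) + 1"
definition bcol :: "nat \<Rightarrow> nat \<Rightarrow> nat" where "bcol a j = j mod (a + 1)"

text \<open>
  The square \<open>W(p, q)\<close> is adjacent to \<open>B(p, q)\<close>, \<open>B(p, q -
  1)\<close>, \<open>B(p + 1, q)\<close> and \<open>B(p + 1, q - 1)\<close>. The weight
  \<open>-1\<close> is on the second of these, the black square directly below the white one.
\<close>

definition kast :: "nat \<Rightarrow> nat \<Rightarrow> nat \<Rightarrow> real" where
  "kast a i j =
    (if brow a j = wrow a i then
       if bcol a j = wcol a i then 1 else if bcol a j + 1 = wcol a i then -1 else 0
     else if brow a j = wrow a i + 1 \<and> (bcol a j = wcol a i \<or> bcol a j + 1 = wcol a i) then 1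
     else 0)"

lemma white_code: "a > 0 \<Longrightarrow> i = wrow a i * a + wcol a i - 1" "a > 0 \<Longrightarrow> 1 \<le> wcol a i \<and> wcol a i \<le> a"
  by (auto simp: wrow_def wcol_def Suc_leI)

lemma black_code: "j + a + 1 = brow a j * (a + 1) + bcol a j" "bcol a j \<le> a" "brow a j \<ge> 1"
proof -
  have "j = j div (a + 1) * (a + 1) + j mod (a + 1)" by (rule div_mult_mod_eq[symmetric])
  then show "j + a + 1 = brow a j * (a + 1) + bcol a j" by (simp add: brow_def bcol_def algebra_simps)
  have "j mod (a + 1) < a + 1" by (rule mod_less_divisor) simp
  then show "bcol a j \<le> a" by (simp add: bcol_def)
qed (simp add: brow_def)

lemma white_code_less: "a > 0 \<Longrightarrow> i < i' \<longleftrightarrow> wrow a i < wrow a i' \<or> wrow a i = wrow a i' \<and> wcol a i < wcol a i'"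
proof -
  assume a: "a > 0"
  have "i = i div a * a + i mod a" "i' = i' div a * a + i' mod a" by simp_all
  then have "i' < i" if "i' div a < i div a" for i i'
    using that div_le_mono[of i i' a] by linarith
  then show ?thesis
    unfolding wrow_def wcol_def by (smt (verit) a add_less_cancel_left add_less_cancel_right div_mult_mod_eq linorder_neqE_nat less_asym')
qed

lemma black_code_less: "j < j' \<longleftrightarrow> brow a j < brow a j' \<or> brow a j = brow a j' \<and> bcol a j < bcol a j'"
  using white_code_less[of "a + 1" j j'] by (simp add: wrow_def wcol_def brow_def bcol_def)

lemma wrow_le: "a > 0 \<Longrightarrow> i < a * (a + 1) \<Longrightarrow> wrow a i \<le> a"
  unfolding wrow_def using less_mult_imp_div_less[of i "a + 1" a] by (simp add: mult.commute)

lemma brow_le: "a > 0 \<Longrightarrow> j < a * (a + 1) \<Longrightarrow> brow a j \<le> a"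
  unfolding brow_def using less_mult_imp_div_less[of j a "a + 1"] by simp

lemma neg_one_power_eqI: "even (x + y) \<Longrightarrow> (-1) ^ x = ((-1) ^ y :: 'a::ring_1)"
  by (auto simp: minus_one_power_iff)

text \<open>
  The removed white squares are on the southeastern side (row \<open>0\<close>) or the
  northwestern side (row \<open>a\<close>), the removed black squares on the southwestern side
  (column \<open>0\<close>) or the northeastern side (column \<open>a\<close>). Both are listed in
  increasing order, so that pairing \<open>w k\<close> with \<open>b k\<close> creates no
  inversion among the removed squares.
\<close>

locale defects =
  fixes a n :: nat and w b :: "nat \<Rightarrow> nat"
  assumes a: "a \<ge> 1"
    and w_mono: "strict_mono_on {1..n} w"
    and b_mono: "strict_mono_on {1..n} b"
    and w_range: "\<And>k. k \<in> {1..n} \<Longrightarrow> w k < a * (a + 1)"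
    and b_range: "\<And>k. k \<in> {1..n} \<Longrightarrow> b k < a * (a + 1)"
    and w_row: "\<And>k. k \<in> {1..n} \<Longrightarrow> wrow a (w k) = 0 \<or> wrow a (w k) = a"
    and b_col: "\<And>k. k \<in> {1..n} \<Longrightarrow> bcol a (b k) = 0 \<or> bcol a (b k) = a"
begin

abbreviation "N \<equiv> a * (a + 1)"

definition far :: "nat set" where "far = {k \<in> {1..n}. wrow a (w k) = a}"
definition right :: "nat set" where "right = {k \<in> {1..n}. bcol a (b k) = a}"

lemma w_less: "k \<in> {1..n} \<Longrightarrow> l \<in> {1..n} \<Longrightarrow> w k < w l \<longleftrightarrow> k < l"
  using strict_mono_on_less[OF w_mono] by blast

lemma b_less: "k \<in> {1..n} \<Longrightarrow> l \<in> {1..n} \<Longrightarrow> b k < b l \<longleftrightarrow> k < l"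
  using strict_mono_on_less[OF b_mono] by blast

lemma inj_w: "inj_on w {1..n}" and inj_b: "inj_on b {1..n}"
  using w_mono b_mono by (auto intro: strict_mono_on_imp_inj_on)

end

text \<open>
  A tiling of the region without the removed squares, seen as a permutation that also maps
  \<open>w k\<close> to \<open>b k\<close>.
\<close>

locale defect_matching = defects +
  fixes p :: "nat \<Rightarrow> nat"
  assumes p: "p permutes {0..<a * (a + 1)}"
    and pw: "\<And>k. k \<in> {1..n} \<Longrightarrow> p (w k) = b k"
    and adjacent: "\<And>i. i \<in> {0..<a * (a + 1)} - w ` {1..n} \<Longrightarrow> kast a i (p i) \<noteq> 0"
begin

definition "S = w ` {1..n}"
definition "U = {0..<N} - S"
text \<open>
  For a white square in row \<open>r\<close>, its partner is in row \<open>r\<close>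
  (\<open>Dn\<close>) or in row \<open>r + 1\<close> (\<open>Up\<close>). The inversions among
  squares that are not removed are counted by \<open>c\<close>, at the larger of the two white
  squares; \<open>e\<close> and \<open>z\<close> are the corrections due to removed squares in the
  same row.
\<close>

definition "Dn r = {i \<in> U. wrow a i = r \<and> brow a (p i) = r}"
definition "Up r = {i \<in> U. wrow a i = r \<and> brow a (p i) = r + 1}"
definition "c i = card {j \<in> U. j < i \<and> p i < p j}"
definition "e r = card {k \<in> right. brow a (b k) = r}"
definition "z i = card {k \<in> {1..n}. wrow a (w k) = wrow a i \<and> w k < i}"

lemma fin: "finite S" "finite U" "finite (Dn r)" "finite (Up r)" "finite right" "finite far"
  by (auto simp: S_def U_def Dn_def Up_def right_def far_def)

lemma p_lt: "i < N \<Longrightarrow> p i < N" using permutes_mem[OF p, of i] by simp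

lemma p_inj: "p i = p j \<longleftrightarrow> i = j" using permutes_inj[OF p] by (auto dest: injD)

lemma step:
  assumes "i \<in> U"
  shows "brow a (p i) = wrow a i \<or> brow a (p i) = wrow a i + 1"
    and "bcol a (p i) = wcol a i \<or> bcol a (p i) + 1 = wcol a i"
  using adjacent[of i] assms by (auto simp: U_def S_def kast_def split: if_splits)

lemma U_cases: "i \<in> U \<Longrightarrow> i \<in> Dn (wrow a i) \<or> i \<in> Up (wrow a i)"
  using step(1)[of i] by (auto simp: Dn_def Up_def)

lemma U_lt: "i \<in> U \<Longrightarrow> i < N" by (simp add: U_def)

text \<open>
  Two dominoes joining the same row of white squares to the same row of black squares do not
  cross, because a column changes by at most one along a domino.
\<close>

lemma row_mono:
  assumes "i \<in> U" "j \<in> U" "wrow a i = wrow a j" "brow a (p i) = brow a (p j)"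
  shows "i < j \<longleftrightarrow> p i < p j"
proof -
  have *: "p i < p j" if "i \<in> U" "j \<in> U" "wrow a i = wrow a j" "brow a (p i) = brow a (p j)" "i < j" for i j
  proof -
    have "wcol a i < wcol a j" using that a white_code_less[of a i j] by simp
    then have "bcol a (p i) \<le> bcol a (p j)" using step(2)[OF that(1)] step(2)[OF that(2)] by linarith
    moreover have "p i \<noteq> p j" using that p_inj by simp
    ultimately show ?thesis
      using that black_code_less[of "p i" "p j" a] black_code_less[of "p j" "p i" a] by auto
  qed
  show ?thesis
    using *[OF assms] *[OF assms(2,1)] assms p_inj[of i j] by (metis less_asym' linorder_neqE_nat)
qed

text \<open>
  The partner of an earlier white square can lie beyond \<open>p i\<close> only if the two white
  squares share a row and their partners do as well; but then \<open>row_mono\<close> applies.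
\<close>

lemma c_up: "i \<in> Up r \<Longrightarrow> c i = 0"
proof -
  assume i: "i \<in> Up r"
  have False if j: "j \<in> U" "j < i" "p i < p j" for j
  proof -
    have "wrow a j \<le> wrow a i" using j a white_code_less[of a j i] by auto
    moreover have "brow a (p i) \<le> brow a (p j)" using j black_code_less[of "p i" "p j" a] by auto
    ultimately have "wrow a j = wrow a i" "brow a (p j) = brow a (p i)"
      using i step(1)[OF j(1)] by (auto simp: Up_def)
    then have "p j < p i" using row_mono[of j i] i j by (auto simp: Up_def)
    then show False using j by simp
  qed
  then show "c i = 0" by (auto simp: c_def)
qed

lemma card_row_less: "card {j. j < N \<and> wrow a j = wrow a i \<and> j < i} = wcol a i - 1" if "i < N"
proof -
  have "{j. j < N \<and> wrow a j = wrow a i \<and> j < i} = {i div a * a ..< i}"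
  proof safe
    fix j assume "wrow a j = wrow a i"
    then have "j div a = i div a" by (simp add: wrow_def)
    then show "j \<in> {i div a * a..<i}" if "j < i" using that div_times_less_eq_dividend[of j a] by simp
  next
    fix j assume j: "j \<in> {i div a * a..<i}"
    then have "i div a \<le> j div a" "j div a \<le> i div a"
      using a div_le_mono[of "i div a * a" j a] div_le_mono[of j i a] by auto
    then show "wrow a j = wrow a i" by (simp add: wrow_def)
    show "j < N" using j that by simp
  qed auto
  moreover have "i - i div a * a = i mod a" by (simp add: minus_div_mult_eq_mod)
  ultimately show ?thesis by (simp add: wcol_def)
qed

lemma card_brow_greater: "card {x. x < N \<and> brow a x = brow a y \<and> y < x} = a - bcol a y" if "y < N"
proof -
  have "{x. x < N \<and> brow a x = brow a y \<and> y < x} = {y <..< brow a y * (a + 1)}"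
  proof safe
    fix x assume x: "x < N" "brow a x = brow a y" "y < x"
    have "x < brow a x * (a + 1)" using black_code(1)[of x a] black_code(2)[of a x] by linarith
    then show "x \<in> {y <..< brow a y * (a + 1)}" using x by simp
  next
    fix x assume x: "x \<in> {y <..< brow a y * (a + 1)}"
    have "brow a y \<le> a" using brow_le[of a y] that a by simp
    then have "brow a y * (a + 1) \<le> N" by (rule mult_le_mono1)
    then show "x < N" using x by simp
    have "x div (a + 1) < brow a y" using x by (simp add: less_mult_imp_div_less)
    moreover have "y div (a + 1) \<le> x div (a + 1)" using x by (intro div_le_mono) auto
    ultimately show "brow a x = brow a y" by (simp add: brow_def)
    show "y < x" using x by simp
  qed
  then have "card {x. x < N \<and> brow a x = brow a y \<and> y < x} = brow a y * (a + 1) - Suc y" by simp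
  then show ?thesis using black_code(1)[of y a] black_code(2)[of a y] by linarith
qed

text \<open>
  The inversions come from two sources: the white squares before \<open>i\<close> in row
  \<open>r\<close> that are matched to the next row, and the white squares of row \<open>r -
  1\<close> whose partners lie in row \<open>r\<close> beyond \<open>p i\<close>. Together with
  the members of \<open>Dn r\<close> before and after \<open>i\<close> and with removed squares,
  the former exhaust the white squares before \<open>i\<close> in its row, and the latter the
  black squares behind \<open>p i\<close> in its row. There are \<open>wcol a i - 1\<close> and
  \<open>a - bcol a (p i)\<close> of these.
\<close>

lemma c_down:
  assumes i: "i \<in> Dn r"
  shows "c i + card (Dn r) + e r + z i = (wcol a i - bcol a (p i)) + a"
proof -
  have iU: "i \<in> U" "wrow a i = r" "brow a (p i) = r" "i < N" using i U_lt by (auto simp: Dn_def)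
  have r: "r \<ge> 1" using black_code(3)[of a "p i"] iU by simp
  \<comment> \<open>\<open>?A\<close> and \<open>?B\<close> form inversions with \<open>i\<close>; \<open>?L\<close> and \<open>?G\<close> are the rest of \<open>Dn r\<close>\<close>
  let ?A = "{j \<in> Up r. j < i}" and ?B = "{j \<in> Up (r - 1). p i < p j}"
  let ?L = "{j \<in> Dn r. j < i}" and ?G = "{j \<in> Dn r. i < j}"
  have cAB: "c i = card ?A + card ?B"
  proof -
    have "{j \<in> U. j < i \<and> p i < p j} = ?A \<union> ?B"
    proof (intro equalityI subsetI)
      fix j assume j: "j \<in> {j \<in> U. j < i \<and> p i < p j}"
      have "wrow a j \<le> r" using j a white_code_less[of a j i] iU by auto
      moreover have "r \<le> brow a (p j)" using j black_code_less[of "p i" "p j" a] iU by auto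
      moreover have "j \<notin> Dn r" using row_mono[of j i] iU j by (auto simp: Dn_def)
      ultimately show "j \<in> ?A \<union> ?B" using j step(1)[of j] by (auto simp: Up_def Dn_def)
    next
      fix j assume j: "j \<in> ?A \<union> ?B"
      then have jU: "j \<in> U" by (auto simp: Up_def)
      show "j \<in> {j \<in> U. j < i \<and> p i < p j}"
      proof (cases "j \<in> ?A")
        case True
        then have "p i < p j" using iU black_code_less[of "p i" "p j" a] by (auto simp: Up_def)
        then show ?thesis using True jU by auto
      next
        case False
        then have "j \<in> ?B" using j by blast
        then have "wrow a j < wrow a i" using iU r by (auto simp: Up_def)
        then show ?thesis using \<open>j \<in> ?B\<close> jU a white_code_less[of a j i] by auto
      qed
    qed
    moreover have "?A \<inter> ?B = {}" using r by (auto simp: Up_def)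
    ultimately show ?thesis using fin by (simp add: c_def card_Un_disjoint)
  qed
  have A: "card ?A + card ?L + z i = wcol a i - 1"
  proof -
    let ?Z = "w ` {k \<in> {1..n}. wrow a (w k) = wrow a i \<and> w k < i}"
    have "{j. j < N \<and> wrow a j = wrow a i \<and> j < i} = (?A \<union> ?L) \<union> ?Z"
    proof (intro equalityI subsetI)
      fix j assume j: "j \<in> {j. j < N \<and> wrow a j = wrow a i \<and> j < i}"
      show "j \<in> (?A \<union> ?L) \<union> ?Z"
      proof (cases "j \<in> S")
        case True
        then show ?thesis using j by (auto simp: S_def)
      next
        case False
        then have "j \<in> U" using j by (simp add: U_def)
        then show ?thesis using U_cases[of j] j iU by auto
      qed
    next
      fix j assume "j \<in> (?A \<union> ?L) \<union> ?Z"
      then show "j \<in> {j. j < N \<and> wrow a j = wrow a i \<and> j < i}"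
        using iU w_range U_lt by (auto simp: Up_def Dn_def)
    qed
    moreover have "?A \<inter> ?L = {}" by (auto simp: Up_def Dn_def)
    moreover have "(?A \<union> ?L) \<inter> ?Z = {}" by (auto simp: Up_def Dn_def U_def S_def)
    moreover have "card ?Z = z i"
      unfolding z_def by (rule card_image[OF inj_on_subset[OF inj_w]]) auto
    ultimately show ?thesis
      using card_row_less[OF iU(4)] fin by (simp add: card_Un_disjoint)
  qed
  have B: "card ?B + card ?G + e r = a - bcol a (p i)"
  proof -
    let ?Z = "b ` {k \<in> right. brow a (b k) = r}"
    have "{x. x < N \<and> brow a x = brow a (p i) \<and> p i < x} = p ` (?B \<union> ?G) \<union> ?Z"
    proof (intro equalityI subsetI)
      fix x assume x: "x \<in> {x. x < N \<and> brow a x = brow a (p i) \<and> p i < x}"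
      then obtain j where j: "j < N" "x = p j"
      proof -
        have "x \<in> p ` {0..<N}" using x permutes_image[OF p] by simp
        then show ?thesis using that by auto
      qed
      show "x \<in> p ` (?B \<union> ?G) \<union> ?Z"
      proof (cases "j \<in> S")
        case True
        then obtain k where k: "k \<in> {1..n}" "j = w k" by (auto simp: S_def)
        then have xb: "x = b k" using pw j by simp
        then have "bcol a (b k) > 0"
          using x black_code_less[of "p i" x a] by auto
        then show ?thesis using k xb x iU b_col[OF k(1)] by (auto simp: right_def)
      next
        case False
        then have jU: "j \<in> U" using j by (simp add: U_def)
        then have "j \<in> ?B \<union> ?G"
          using U_cases[OF jU] step(1)[OF jU] x j iU row_mono[of i j] by (auto simp: Up_def Dn_def)
        then show ?thesis using j by blast
      qed
    next
      fix x assume "x \<in> p ` (?B \<union> ?G) \<union> ?Z"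
      then consider j where "j \<in> ?B" "x = p j" | j where "j \<in> ?G" "x = p j"
        | k where "k \<in> right" "brow a (b k) = r" "x = b k" by blast
      then show "x \<in> {x. x < N \<and> brow a x = brow a (p i) \<and> p i < x}"
      proof cases
        case 1
        then show ?thesis using iU r p_lt U_lt by (auto simp: Up_def)
      next
        case 2
        then show ?thesis using iU p_lt U_lt row_mono[of i j] by (auto simp: Dn_def)
      next
        case 3
        then have k: "k \<in> {1..n}" "bcol a (b k) = a" by (auto simp: right_def)
        have "p i \<noteq> b k" using pw[OF k(1)] p_inj[of i "w k"] iU k by (auto simp: U_def S_def)
        moreover have "bcol a (p i) \<le> a" by (rule black_code)
        ultimately have "\<not> b k < p i" using black_code_less[of "b k" "p i" a] 3 k iU by auto
        then show ?thesis using 3 b_range[OF k(1)] iU \<open>p i \<noteq> b k\<close> by auto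
      qed
    qed
    moreover have "p ` (?B \<union> ?G) \<inter> ?Z = {}"
    proof -
      have False if "j \<in> U" "k \<in> {1..n}" "p j = b k" for j k
        using that pw[OF that(2)] p_inj[of j "w k"] by (auto simp: U_def S_def)
      then show ?thesis by (auto simp: Up_def Dn_def right_def)
    qed
    moreover have "card ?Z = e r"
      unfolding e_def by (rule card_image[OF inj_on_subset[OF inj_b]]) (auto simp: right_def)
    moreover have "card (p ` (?B \<union> ?G)) = card (?B \<union> ?G)"
      using p_inj by (intro card_image inj_onI) auto
    moreover have "?B \<inter> ?G = {}" using r by (auto simp: Up_def Dn_def)
    ultimately show ?thesis
      using card_brow_greater[OF p_lt[OF iU(4)]] fin by (simp add: card_Un_disjoint)
  qed
  have "Dn r = insert i (?L \<union> ?G)" using i by auto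
  moreover have "card (insert i (?L \<union> ?G)) = Suc (card ?L + card ?G)"
    using fin by (subst card_insert_disjoint) (auto simp: card_Un_disjoint disjoint_iff)
  ultimately have d: "card (Dn r) = Suc (card ?L + card ?G)" by simp
  have "bcol a (p i) \<le> wcol a i" "wcol a i \<ge> 1" "bcol a (p i) \<le> a"
    using step(2)[OF iU(1)] white_code(2)[of a i] a black_code(2)[of a "p i"] by auto
  then show ?thesis using cAB A B d by linarith
qed
end

section \<open>Inversions of a matching, row by row\<close>

lemma complementary_parity: "(x :: nat) + d + e + z = y + a \<Longrightarrow> even ((x + y) + (a + d + e + z))"
  by presburger

lemma reflected_parity: "(x :: nat) + (n - k) = a - q \<Longrightarrow> q \<le> a \<Longrightarrow> k \<le> n \<Longrightarrow> even (x + (a + q + n + k))"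
  by presburger

context defect_matching begin

text \<open>
  The weight is the parity of the column shift, which is the variable part of
  \<open>c_down\<close>.
\<close>

lemma kast_down: "i \<in> Dn r \<Longrightarrow> kast a i (p i) = (-1) ^ (wcol a i - bcol a (p i))"
proof -
  assume i: "i \<in> Dn r"
  then have row: "brow a (p i) = wrow a i" and "i \<in> U" by (auto simp: Dn_def)
  from step(2)[OF this(2)] show ?thesis
  proof
    assume "bcol a (p i) + 1 = wcol a i"
    then have "wcol a i - bcol a (p i) = 1" "bcol a (p i) \<noteq> wcol a i" "bcol a (p i) + 1 = wcol a i" by auto
    then show ?thesis using row by (simp add: kast_def)
  qed (simp add: kast_def row)
qed

lemma kast_up: "i \<in> Up r \<Longrightarrow> kast a i (p i) = 1"
  using step(2)[of i] by (auto simp: Up_def kast_def)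

lemma z_inner: "1 \<le> r \<Longrightarrow> r < a \<Longrightarrow> i \<in> Dn r \<Longrightarrow> z i = 0"
  using w_row by (fastforce simp: z_def Dn_def)

text \<open>
  The weights absorb the dependence of the inversion numbers on the individual dominoes: each
  domino in \<open>Dn r\<close> is left with the sign \<open>(-1) ^ (a + card (Dn r) + e r + z
  i)\<close>, and those in \<open>Up r\<close> with \<open>1\<close>.
\<close>

lemma normal_sign:
  "(-1) ^ (\<Sum>i\<in>U. c i) * (\<Prod>i\<in>U. kast a i (p i)) =
    (-1) ^ ((\<Sum>r=1..a. card (Dn r) * (a + card (Dn r) + e r)) + (\<Sum>i\<in>Dn a. z i))"
proof -
  let ?h = "\<lambda>r i. (-1 :: real) ^ (a + card (Dn r) + e r + z i)"
  let ?D = "\<Union>r\<in>{1..a}. Dn r"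
  have D_sub: "?D \<subseteq> U" by (auto simp: Dn_def)
  have down: "(-1) ^ c i * kast a i (p i) = ?h r i" if "i \<in> Dn r" for i r
  proof -
    note complementary_parity[OF c_down[OF that]]
    then show ?thesis
      unfolding kast_down[OF that] power_add[symmetric] by (rule neg_one_power_eqI)
  qed
  have up: "(-1) ^ c i * kast a i (p i) = 1" if i: "i \<in> U - ?D" for i
  proof -
    have "i \<in> Up (wrow a i)"
    proof (rule ccontr)
      assume "i \<notin> Up (wrow a i)"
      then have "i \<in> Dn (wrow a i)" using U_cases i by blast
      moreover have "1 \<le> wrow a i" "wrow a i \<le> a"
        using calculation black_code(3)[of a "p i"] wrow_le[of a i] U_lt[of i] i a by (auto simp: Dn_def)
      ultimately show False using i by auto
    qed
    then show ?thesis using c_up kast_up by simp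
  qed
  have "(-1) ^ (\<Sum>i\<in>U. c i) * (\<Prod>i\<in>U. kast a i (p i)) = (\<Prod>i\<in>U. (-1) ^ c i * kast a i (p i))"
    by (simp add: power_sum prod.distrib)
  also have "\<dots> = (\<Prod>i\<in>?D. (-1) ^ c i * kast a i (p i))"
    using up fin D_sub by (intro prod.mono_neutral_right) auto
  also have "\<dots> = (\<Prod>r=1..a. \<Prod>i\<in>Dn r. (-1) ^ c i * kast a i (p i))"
    using fin by (intro prod.UNION_disjoint) (auto simp: Dn_def)
  also have "\<dots> = (\<Prod>r=1..a. \<Prod>i\<in>Dn r. ?h r i)"
    using down by (intro prod.cong refl) auto
  also have "\<dots> = (\<Prod>r=1..a. (-1) ^ (card (Dn r) * (a + card (Dn r) + e r)) * (-1) ^ (\<Sum>i\<in>Dn r. z i))"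
  proof (intro prod.cong refl)
    fix r
    have "(\<Prod>i\<in>Dn r. ?h r i) = (\<Prod>i\<in>Dn r. (-1) ^ (a + card (Dn r) + e r)) * (\<Prod>i\<in>Dn r. (-1) ^ z i)"
      by (simp add: power_add prod.distrib)
    also have "(\<Prod>i\<in>Dn r. (-1 :: real) ^ (a + card (Dn r) + e r)) =
        (-1) ^ (card (Dn r) * (a + card (Dn r) + e r))"
      by (simp add: power_mult[symmetric] mult.commute)
    finally show "(\<Prod>i\<in>Dn r. ?h r i) =
        (-1) ^ (card (Dn r) * (a + card (Dn r) + e r)) * (-1) ^ (\<Sum>i\<in>Dn r. z i)"
      by (simp add: power_sum)
  qed
  also have "\<dots> = (-1) ^ (\<Sum>r=1..a. card (Dn r) * (a + card (Dn r) + e r)) *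
      (-1) ^ (\<Sum>r=1..a. \<Sum>i\<in>Dn r. z i)"
    by (simp add: prod.distrib power_sum)
  also have "(\<Sum>r=1..a. \<Sum>i\<in>Dn r. z i) = (\<Sum>r\<in>{a}. \<Sum>i\<in>Dn r. z i)"
    using a z_inner by (intro sum.mono_neutral_right) (auto intro!: sum.neutral)
  finally show ?thesis by (simp add: power_add)
qed

lemma card_row_greater: "card {j. j < N \<and> wrow a j = wrow a i \<and> i < j} = a - wcol a i" if "i < N"
proof -
  have "{j. j < N \<and> wrow a j = wrow a i \<and> i < j} = {i <..< (wrow a i + 1) * a}"
  proof safe
    fix j assume "wrow a j = wrow a i" "i < j"
    then show "j \<in> {i <..< (wrow a i + 1) * a}"
      using white_code[of a j] a by (auto simp: algebra_simps)
  next
    fix j assume j: "j \<in> {i <..< (wrow a i + 1) * a}"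
    have "wrow a i + 1 \<le> a + 1" using wrow_le[of a i] that a by simp
    then have "(wrow a i + 1) * a \<le> (a + 1) * a" by (rule mult_le_mono1)
    moreover have "j < (wrow a i + 1) * a" using j by simp
    ultimately show "j < N" by (metis mult.commute order_less_le_trans)
    have "j div a < wrow a i + 1" using j by (intro less_mult_imp_div_less) simp
    moreover have "i div a \<le> j div a" using j by (intro div_le_mono) auto
    ultimately show "wrow a j = wrow a i" by (simp add: wrow_def)
    show "i < j" using j by simp
  qed
  then have "card {j. j < N \<and> wrow a j = wrow a i \<and> i < j} = (wrow a i + 1) * a - Suc i" by simp
  moreover have complement: "(x + 1) * a - Suc i = a - q" if "i = x * a + q - 1" "1 \<le> q" "q \<le> a" for x q
    using that by (simp add: algebra_simps)
  have "(wrow a i + 1) * a - Suc i = a - wcol a i"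
    using a by (intro complement white_code(1) conjunct1[OF white_code(2)] conjunct2[OF white_code(2)]) auto
  ultimately show ?thesis by (simp only:)
qed

text \<open>
  All remaining white squares of the last row are in \<open>Dn a\<close>, since the black squares
  have no row \<open>a + 1\<close>. Summing over removed squares instead, \<open>w k\<close> is
  counted once for each remaining square behind it; there are \<open>a - wcol a (w k)\<close>
  squares behind it, of which the \<open>n - k\<close> later ones on the list are removed.
\<close>

lemma far_sum_parity: "even ((\<Sum>i\<in>Dn a. z i) + (\<Sum>k\<in>far. a + wcol a (w k) + n + k))"
proof -
  have count: "card {i \<in> Dn a. w k < i} + (n - k) = a - wcol a (w k)" if k: "k \<in> far" for k
  proof -
    have k1: "k \<in> {1..n}" "wrow a (w k) = a" using k by (auto simp: far_def)
    have "{j. j < N \<and> wrow a j = wrow a (w k) \<and> w k < j} = {i \<in> Dn a. w k < i} \<union> w ` {k<..n}"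
    proof (intro equalityI subsetI)
      fix j assume j: "j \<in> {j. j < N \<and> wrow a j = wrow a (w k) \<and> w k < j}"
      show "j \<in> {i \<in> Dn a. w k < i} \<union> w ` {k<..n}"
      proof (cases "j \<in> S")
        case True
        then show ?thesis using j k1 w_less by (auto simp: S_def)
      next
        case False
        then have "j \<in> U" using j by (simp add: U_def)
        moreover have "brow a (p j) \<le> a" using brow_le[of a "p j"] p_lt j a by simp
        ultimately show ?thesis using step(1)[of j] j k1 by (auto simp: Dn_def)
      qed
    next
      fix j assume j: "j \<in> {i \<in> Dn a. w k < i} \<union> w ` {k<..n}"
      then consider "j \<in> Dn a" "w k < j" | l where "l \<in> {k<..n}" "j = w l" by blast
      then show "j \<in> {j. j < N \<and> wrow a j = wrow a (w k) \<and> w k < j}"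
      proof cases
        case 1
        then show ?thesis using k1 U_lt by (auto simp: Dn_def)
      next
        case 2
        then have l: "l \<in> {1..n}" "w k < w l" using k1 w_less[of k l] by auto
        then have "wrow a (w k) \<le> wrow a (w l)" using white_code_less[of a "w k" "w l"] a by auto
        then show ?thesis using 2 l w_row[OF l(1)] w_range[OF l(1)] k1 by auto
      qed
    qed
    moreover have "{i \<in> Dn a. w k < i} \<inter> w ` {k<..n} = {}"
      using k1 by (auto simp: Dn_def U_def S_def)
    moreover have "card (w ` {k<..n}) = n - k"
    proof -
      have "{k<..n} \<subseteq> {1..n}" using k1 by auto
      then show ?thesis using card_image[OF inj_on_subset[OF inj_w]] by simp
    qed
    ultimately show ?thesis
      using card_row_greater[OF w_range[OF k1(1)]] fin by (simp add: card_Un_disjoint)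
  qed
  have "(\<Sum>i\<in>Dn a. z i) = (\<Sum>i\<in>Dn a. \<Sum>k\<in>far. if w k < i then 1 else 0)"
  proof (intro sum.cong refl)
    fix i assume "i \<in> Dn a"
    then have "{k \<in> {1..n}. wrow a (w k) = wrow a i \<and> w k < i} = {k \<in> far. w k < i}"
      by (auto simp: Dn_def far_def)
    then show "z i = (\<Sum>k\<in>far. if w k < i then 1 else 0)"
      using fin by (simp add: z_def sum.If_cases Int_def)
  qed
  also have "\<dots> = (\<Sum>k\<in>far. \<Sum>i\<in>Dn a. if w k < i then 1 else 0)" by (rule sum.swap)
  also have "\<dots> = (\<Sum>k\<in>far. card {i \<in> Dn a. w k < i})"
    using fin by (simp add: sum.If_cases Int_def)
  finally have "(\<Sum>i\<in>Dn a. z i) + (\<Sum>k\<in>far. a + wcol a (w k) + n + k) =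
      (\<Sum>k\<in>far. card {i \<in> Dn a. w k < i} + (a + wcol a (w k) + n + k))"
    by (simp add: sum.distrib)
  also have "even \<dots>"
  proof (rule dvd_sum)
    fix k assume k: "k \<in> far"
    then have "k \<le> n" by (auto simp: far_def)
    moreover have "wcol a (w k) \<le> a" using white_code(2)[of a] a by auto
    ultimately show "even (card {i \<in> Dn a. w k < i} + (a + wcol a (w k) + n + k))"
      using reflected_parity[OF count[OF k]] by blast
  qed
  finally show ?thesis .
qed

text \<open>
  The black squares of the first \<open>r\<close> rows are matched with the white squares of the
  rows before \<open>r\<close> and with those in \<open>Dn r\<close>. There are \<open>r * (a +
  1)\<close> black and \<open>r * a\<close> white ones before squares are removed.
\<close>

lemma card_Dn:
  assumes r: "1 \<le> r" "r \<le> a"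
  shows "card (Dn r) + card {k \<in> {1..n}. brow a (b k) \<le> r} = r + card ({1..n} - far)"
proof -
  let ?L = "{i \<in> U. wrow a i < r}" and ?K = "{k \<in> {1..n}. brow a (b k) \<le> r}"
  have ra: "r * a \<le> N" "r * (a + 1) \<le> N" 
    using mult_le_mono[OF r(2), of a "a + 1"] mult_le_mono[OF r(2), of "a + 1" "a + 1"] by simp_all
  have wlt: "wrow a j < r \<longleftrightarrow> j < r * a" for j
    using a by (simp add: wrow_def div_less_iff_less_mult)
  have blt: "brow a j \<le> r \<longleftrightarrow> j < r * (a + 1)" for j
    by (simp add: brow_def Suc_le_eq div_less_iff_less_mult del: mult_Suc_right)
  have "{0..<r * a} = ?L \<union> w ` ({1..n} - far)"
  proof (intro equalityI subsetI)
    fix j assume j: "j \<in> {0..<r * a}"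
    show "j \<in> ?L \<union> w ` ({1..n} - far)"
      using j ra wlt[of j] r by (cases "j \<in> S") (auto simp: U_def S_def far_def)
  next
    fix j assume "j \<in> ?L \<union> w ` ({1..n} - far)"
    then have "wrow a j < r" using w_row r by (fastforce simp: far_def)
    then show "j \<in> {0..<r * a}" using wlt by simp
  qed
  moreover have "?L \<inter> w ` ({1..n} - far) = {}" by (auto simp: U_def S_def)
  moreover have "card (w ` ({1..n} - far)) = card ({1..n} - far)"
    by (rule card_image[OF inj_on_subset[OF inj_w]]) auto
  ultimately have L: "card ?L + card ({1..n} - far) = r * a"
    using fin by (metis (no_types, lifting) card_Un_disjoint card_atLeastLessThan diff_zero finite_Un finite_atLeastLessThan)
  have "{0..<r * (a + 1)} = p ` ((?L \<union> Dn r) \<union> w ` ?K)"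
  proof (intro equalityI subsetI)
    fix x assume x: "x \<in> {0..<r * (a + 1)}"
    then have "x \<in> p ` {0..<N}" using ra permutes_image[OF p] by simp
    then obtain j where j: "j < N" "x = p j" by auto
    have "brow a (p j) \<le> r" using blt[of x] x j by simp
    then have "j \<in> (?L \<union> Dn r) \<union> w ` ?K"
      using step(1)[of j] j pw by (cases "j \<in> S") (auto simp: S_def U_def Dn_def)
    then show "x \<in> p ` ((?L \<union> Dn r) \<union> w ` ?K)" using j by blast
  next
    fix x assume "x \<in> p ` ((?L \<union> Dn r) \<union> w ` ?K)"
    then obtain j where j: "x = p j" "j \<in> (?L \<union> Dn r) \<union> w ` ?K" by blast
    have "brow a (p j) \<le> r"
      using j(2) step(1)[of j] pw by (auto simp: Dn_def)
    then show "x \<in> {0..<r * (a + 1)}" using blt j by simp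
  qed
  moreover have "card (p ` ((?L \<union> Dn r) \<union> w ` ?K)) = card ((?L \<union> Dn r) \<union> w ` ?K)"
    using p_inj by (intro card_image inj_onI) auto
  moreover have "(?L \<union> Dn r) \<inter> w ` ?K = {}" "?L \<inter> Dn r = {}" by (auto simp: Dn_def U_def S_def)
  moreover have "card (w ` ?K) = card ?K"
    by (rule card_image[OF inj_on_subset[OF inj_w]]) auto
  moreover have "card ((?L \<union> Dn r) \<union> w ` ?K) = card ?L + card (Dn r) + card (w ` ?K)"
    using fin calculation(3,4) by (simp add: card_Un_disjoint)
  ultimately have "card {0..<r * (a + 1)} = card ?L + card (Dn r) + card ?K"
    by (simp only:)
  then have "card ?L + card (Dn r) + card ?K = r * (a + 1)" by simp
  then show ?thesis using L by simp
qed

text \<open>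
  The inversions that involve the removed pair \<open>w k\<close>, \<open>b k\<close>.
\<close>

definition "mix k = card {i \<in> U. i < w k \<and> b k < p i} + card {i \<in> U. w k < i \<and> p i < b k}"

text \<open>
  Modulo two, the squares \<open>i\<close> with \<open>i < w k\<close> and \<open>p i < b
  k\<close> may be counted twice in addition. The sum is then the number of remaining white
  squares before \<open>w k\<close> plus that of remaining black squares before \<open>b
  k\<close>, and \<open>k - 1\<close> squares of either colour have been removed there.
\<close>

lemma mix_parity: "even (mix k + (w k + b k))" if k: "k \<in> {1..n}"
proof -
  let ?q = "{i \<in> U. i < w k \<and> p i < b k}"
  have inS: "w ` {1..<k} \<subseteq> S" using k by (auto simp: S_def)
  have "{0..<w k} = ({i \<in> U. i < w k \<and> b k < p i} \<union> ?q) \<union> w ` {1..<k}"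
  proof (intro equalityI subsetI)
    fix i assume i: "i \<in> {0..<w k}"
    show "i \<in> ({i \<in> U. i < w k \<and> b k < p i} \<union> ?q) \<union> w ` {1..<k}"
    proof (cases "i \<in> S")
      case True
      then show ?thesis using i k w_less by (auto simp: S_def)
    next
      case False
      then have "p i \<noteq> b k" using p_inj[of i "w k"] pw k by (auto simp: S_def)
      then show ?thesis using False i w_range[OF k] by (auto simp: U_def)
    qed
  qed (use k w_less in auto)
  moreover have "({i \<in> U. i < w k \<and> b k < p i} \<union> ?q) \<inter> w ` {1..<k} = {}"
    using inS by (auto simp: U_def)
  moreover have "card (w ` {1..<k}) = k - 1"
  proof -
    have "{1..<k} \<subseteq> {1..n}" using k by auto
    then show ?thesis using card_image[OF inj_on_subset[OF inj_w]] by simp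
  qed
  moreover have "card ({i \<in> U. i < w k \<and> b k < p i} \<union> ?q) =
      card {i \<in> U. i < w k \<and> b k < p i} + card ?q"
    using fin by (intro card_Un_disjoint) auto
  moreover from calculation(2) have "card (({i \<in> U. i < w k \<and> b k < p i} \<union> ?q) \<union> w ` {1..<k}) =
      card ({i \<in> U. i < w k \<and> b k < p i} \<union> ?q) + card (w ` {1..<k})"
    using fin by (intro card_Un_disjoint) auto
  ultimately have "card {0..<w k} = card {i \<in> U. i < w k \<and> b k < p i} + card ?q + (k - 1)"
    by (simp only:)
  then have W: "card {i \<in> U. i < w k \<and> b k < p i} + card ?q + (k - 1) = w k" by simp
  have "{0..<b k} = p ` (({i \<in> U. w k < i \<and> p i < b k} \<union> ?q) \<union> w ` {1..<k})"
  proof (intro equalityI subsetI)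
    fix x assume x: "x \<in> {0..<b k}"
    then have "x \<in> p ` {0..<N}" using b_range[OF k] permutes_image[OF p] by simp
    then obtain i where i: "i < N" "x = p i" by auto
    have "i \<in> ({i \<in> U. w k < i \<and> p i < b k} \<union> ?q) \<union> w ` {1..<k}"
    proof (cases "i \<in> S")
      case True
      then obtain l where l: "l \<in> {1..n}" "i = w l" by (auto simp: S_def)
      then have "l < k" using x i pw b_less[OF l(1) k] by simp
      then show ?thesis using l by auto
    next
      case False
      then have "i \<noteq> w k" using k by (auto simp: S_def)
      then show ?thesis using False i x by (auto simp: U_def)
    qed
    then show "x \<in> p ` (({i \<in> U. w k < i \<and> p i < b k} \<union> ?q) \<union> w ` {1..<k})" using i by blast
  next
    fix x assume "x \<in> p ` (({i \<in> U. w k < i \<and> p i < b k} \<union> ?q) \<union> w ` {1..<k})"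
    then show "x \<in> {0..<b k}" using k pw b_less by auto
  qed
  moreover have "card (p ` (({i \<in> U. w k < i \<and> p i < b k} \<union> ?q) \<union> w ` {1..<k})) =
      card (({i \<in> U. w k < i \<and> p i < b k} \<union> ?q) \<union> w ` {1..<k})"
    using p_inj by (intro card_image inj_onI) auto
  moreover have "({i \<in> U. w k < i \<and> p i < b k} \<union> ?q) \<inter> w ` {1..<k} = {}"
    using inS by (auto simp: U_def)
  moreover have "card (w ` {1..<k}) = k - 1"
  proof -
    have "{1..<k} \<subseteq> {1..n}" using k by auto
    then show ?thesis using card_image[OF inj_on_subset[OF inj_w]] by simp
  qed
  moreover have "card ({i \<in> U. w k < i \<and> p i < b k} \<union> ?q) =
      card {i \<in> U. w k < i \<and> p i < b k} + card ?q"
    using fin by (intro card_Un_disjoint) auto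
  moreover from calculation(3) have "card (({i \<in> U. w k < i \<and> p i < b k} \<union> ?q) \<union> w ` {1..<k}) =
      card ({i \<in> U. w k < i \<and> p i < b k} \<union> ?q) + card (w ` {1..<k})"
    using fin by (intro card_Un_disjoint) auto
  ultimately have "card {0..<b k} = card {i \<in> U. w k < i \<and> p i < b k} + card ?q + (k - 1)"
    by (simp only:)
  then have "card {i \<in> U. w k < i \<and> p i < b k} + card ?q + (k - 1) = b k" by simp
  then have "w k + b k = mix k + 2 * (card ?q + (k - 1))" using W by (simp add: mix_def)
  then show ?thesis by simp
qed

lemma card_inversions:
  "card {(i, j). i \<in> {0..<N} \<and> j \<in> {0..<N} \<and> i < j \<and> p j < p i} = (\<Sum>i\<in>U. c i) + (\<Sum>k=1..n. mix k)"
proof -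
  let ?I = "{1..n}"
  let ?A = "SIGMA i:U. {j \<in> U. j < i \<and> p i < p j}"
  let ?B = "SIGMA k:?I. {i \<in> U. i < w k \<and> b k < p i}"
  let ?C = "SIGMA k:?I. {i \<in> U. w k < i \<and> p i < b k}"
  let ?fA = "\<lambda>(i, j). (j, i)" and ?fB = "\<lambda>(k, i). (i, w k)" and ?fC = "\<lambda>(k, i). (w k, i)"
  have U: "i \<in> U \<longleftrightarrow> i < N \<and> i \<notin> S" for i by (auto simp: U_def)
  have "{(i, j). i \<in> {0..<N} \<and> j \<in> {0..<N} \<and> i < j \<and> p j < p i} = ?fA ` ?A \<union> ?fB ` ?B \<union> ?fC ` ?C"
  proof (intro equalityI subsetI)
    fix x assume "x \<in> {(i, j). i \<in> {0..<N} \<and> j \<in> {0..<N} \<and> i < j \<and> p j < p i}"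
    then obtain i j where x: "x = (i, j)" "i < N" "j < N" "i < j" "p j < p i" by auto
    consider "i \<in> U" "j \<in> U" | k where "i \<in> U" "k \<in> ?I" "j = w k" | k where "k \<in> ?I" "i = w k" "j \<in> U"
      | k l where "k \<in> ?I" "l \<in> ?I" "i = w k" "j = w l"
    proof -
      have "i \<in> U \<or> (\<exists>k\<in>?I. i = w k)" "j \<in> U \<or> (\<exists>k\<in>?I. j = w k)"
        using x U by (auto simp: S_def)
      then show ?thesis using that by blast
    qed
    then show "x \<in> ?fA ` ?A \<union> ?fB ` ?B \<union> ?fC ` ?C"
    proof cases
      case 1
      then have "x \<in> ?fA ` ?A" using x by (intro image_eqI[of _ _ "(j, i)"]) auto
      then show ?thesis by blast
    next
      case 2
      then have "x \<in> ?fB ` ?B" using x pw by (intro image_eqI[of _ _ "(k, i)"]) auto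
      then show ?thesis by blast
    next
      case 3
      then have "x \<in> ?fC ` ?C" using x pw by (intro image_eqI[of _ _ "(k, j)"]) auto
      then show ?thesis by blast
    next
      case 4
      then show ?thesis using x pw w_less[of k l] b_less[of l k] by auto
    qed
  next
    fix x assume "x \<in> ?fA ` ?A \<union> ?fB ` ?B \<union> ?fC ` ?C"
    then show "x \<in> {(i, j). i \<in> {0..<N} \<and> j \<in> {0..<N} \<and> i < j \<and> p j < p i}"
      using U_lt w_range pw by auto
  qed
  moreover have "?fA ` ?A \<inter> ?fB ` ?B = {}" "(?fA ` ?A \<union> ?fB ` ?B) \<inter> ?fC ` ?C = {}"
    by (auto simp: U_def S_def)
  moreover have "inj_on ?fA ?A" "inj_on ?fB ?B" "inj_on ?fC ?C"
    by (rule inj_onI; auto dest: inj_onD[OF inj_w])+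
  then have "card (?fA ` ?A) = card ?A" "card (?fB ` ?B) = card ?B" "card (?fC ` ?C) = card ?C"
    by (simp_all only: card_image)
  moreover have "finite (?fA ` ?A)" "finite (?fB ` ?B)" "finite (?fC ` ?C)"
    using fin by auto
  ultimately have "card {(i, j). i \<in> {0..<N} \<and> j \<in> {0..<N} \<and> i < j \<and> p j < p i} =
      card ?A + card ?B + card ?C"
    by (simp add: card_Un_disjoint)
  also have "card ?A = (\<Sum>i\<in>U. c i)" using fin by (simp add: c_def)
  also have "card ?B = (\<Sum>k\<in>?I. card {i \<in> U. i < w k \<and> b k < p i})" using fin by simp
  also have "card ?C = (\<Sum>k\<in>?I. card {i \<in> U. w k < i \<and> p i < b k})" using fin by simp
  finally show ?thesis by (simp add: mix_def sum.distrib)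
qed
end

section \<open>All matchings of a defective Aztec diamond have the same sign\<close>

context defects begin

definition near_count :: nat where "near_count = card ({1..n} - far)"

text \<open>
  The value matters only modulo two. The first summand is the exponent for the undamaged diamond.
  The others are sums over removed squares, on the southeastern, northwestern and northeastern
  side.
\<close>

definition sign_exponent :: nat where
  "sign_exponent = (a + 1) * (\<Sum>r=1..a. r)
    + (\<Sum>k\<in>{1..n} - far. w k) + (\<Sum>k\<in>far. 1 + n + k)
    + (\<Sum>k\<in>right. a + brow a (b k) + near_count + k)"

end

lemma shifted_parity: "(x :: nat) + k = y + z \<Longrightarrow> even (x + (y + z + k))"
  by presburger

lemma column_parity:
  fixes x :: nat
  assumes "x + a + 1 = r * (a + 1) + s" "r \<le> a"
  shows "even ((a + 1) * (a + 1 - r) + (x + s))"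
proof -
  obtain y where y: "a = r + y" using assms(2) le_Suc_ex by blast
  have "(a + 1) * (a + 1 - r) + (x + s) + (a + 1) = (a + 1) * (a + 1) + 2 * s"
    using assms(1) by (simp add: y algebra_simps)
  then have eq: "(a + 1) * (a + 1 - r) + (x + s) = (a + 1) * a + 2 * s" by simp
  show ?thesis unfolding eq by simp
qed

lemma even_sum_add:
  assumes "\<And>k. k \<in> A \<Longrightarrow> even (f k + g k :: nat)"
  shows "even (sum f A + sum g A)"
  using assms by (simp only: sum.distrib[symmetric]) (rule dvd_sum)

context defect_matching begin

lemma sum_level_counts:
  "(\<Sum>r=1..a. card {k \<in> {1..n}. brow a (b k) \<le> r}) = (\<Sum>k=1..n. a + 1 - brow a (b k))"
proof -
  have "(\<Sum>r=1..a. card {k \<in> {1..n}. brow a (b k) \<le> r}) =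
      (\<Sum>r=1..a. \<Sum>k=1..n. if brow a (b k) \<le> r then 1 else 0)"
    by (simp add: sum.If_cases Int_def)
  also have "\<dots> = (\<Sum>k=1..n. \<Sum>r=1..a. if brow a (b k) \<le> r then 1 else 0)" by (rule sum.swap)
  also have "\<dots> = (\<Sum>k=1..n. a + 1 - brow a (b k))"
  proof (intro sum.cong refl)
    fix k assume "k \<in> {1..n}"
    have "{r \<in> {1..a}. brow a (b k) \<le> r} = {brow a (b k)..a}"
      using black_code(3)[of a "b k"] by auto
    then show "(\<Sum>r=1..a. if brow a (b k) \<le> r then 1 else 0) = a + 1 - brow a (b k)"
      by (simp add: sum.If_cases Int_def)
  qed
  finally show ?thesis .
qed

lemma sum_right_counts:
  "(\<Sum>r=1..a. card (Dn r) * e r) = (\<Sum>k\<in>right. card (Dn (brow a (b k))))"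
proof -
  have "(\<Sum>r=1..a. card (Dn r) * e r) = (\<Sum>r=1..a. \<Sum>k\<in>right. if brow a (b k) = r then card (Dn r) else 0)"
    using fin by (simp add: e_def sum.If_cases Int_def mult.commute)
  also have "\<dots> = (\<Sum>k\<in>right. \<Sum>r=1..a. if brow a (b k) = r then card (Dn r) else 0)" by (rule sum.swap)
  also have "\<dots> = (\<Sum>k\<in>right. card (Dn (brow a (b k))))"
  proof (intro sum.cong refl)
    fix k assume "k \<in> right"
    then have "brow a (b k) \<in> {1..a}"
      using black_code(3)[of a "b k"] brow_le[of a "b k"] b_range a by (auto simp: right_def)
    then show "(\<Sum>r=1..a. if brow a (b k) = r then card (Dn r) else 0) = card (Dn (brow a (b k)))"
      by simp
  qed
  finally show ?thesis .
qed

text \<open>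
  Being at the end of its row, \<open>b k\<close> is the last of the removed black squares in the
  rows up to its own, so the count in \<open>card_Dn\<close> equals \<open>k\<close>.
\<close>

lemma card_Dn_right:
  assumes k: "k \<in> right"
  shows "card (Dn (brow a (b k))) + k = brow a (b k) + near_count"
proof -
  have k1: "k \<in> {1..n}" "bcol a (b k) = a" using k by (auto simp: right_def)
  have r: "1 \<le> brow a (b k)" "brow a (b k) \<le> a"
    using black_code(3)[of a "b k"] brow_le[of a "b k"] b_range[OF k1(1)] a by auto
  have "{l \<in> {1..n}. brow a (b l) \<le> brow a (b k)} = {1..k}"
  proof (intro equalityI subsetI)
    fix l assume l: "l \<in> {l \<in> {1..n}. brow a (b l) \<le> brow a (b k)}"
    then have "\<not> b k < b l"
      using black_code_less[of "b k" "b l" a] k1 black_code(2)[of a "b l"] by auto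
    then show "l \<in> {1..k}" using l k1 b_less[of k l] by auto
  next
    fix l assume l: "l \<in> {1..k}"
    then have "\<not> b k < b l" using b_less[of k l] k1 by auto
    then show "l \<in> {l \<in> {1..n}. brow a (b l) \<le> brow a (b k)}"
      using l k1 black_code_less[of "b k" "b l" a] by auto
  qed
  then show ?thesis using card_Dn[OF r] by (simp add: near_count_def)
qed

text \<open>
  Everything in the exponent obtained from \<open>normal_sign\<close> and
  \<open>mix_parity\<close> that refers to the matching is either a sum of the numbers \<open>card
  (Dn r)\<close> or covered by \<open>far_sum_parity\<close>, hence determined by the removed
  squares.
\<close>

theorem kasteleyn_sign:
  "of_int (sign p) * (\<Prod>i\<in>{0..<N} - w ` {1..n}. kast a i (p i)) = (-1) ^ sign_exponent"
proof -
  let ?I = "{1..n}" and ?d = "\<lambda>r. card (Dn r)"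
  \<comment> \<open>the exponent as it comes out of the inversion count; the numbered facts rewrite it modulo two\<close>
  define X where "X = (\<Sum>k\<in>?I. mix k) + ((\<Sum>r=1..a. ?d r * (a + ?d r + e r)) + (\<Sum>i\<in>Dn a. z i))"
  have "of_int (sign p) = (-1 :: real) ^ ((\<Sum>i\<in>U. c i) + (\<Sum>k\<in>?I. mix k))"
  proof -
    have "sign p = (-1) ^ ((\<Sum>i\<in>U. c i) + (\<Sum>k\<in>?I. mix k))"
      using sign_eq_inversions[OF finite_atLeastLessThan p] unfolding card_inversions .
    then show ?thesis by simp
  qed
  then have eq: "of_int (sign p) * (\<Prod>i\<in>{0..<N} - w ` ?I. kast a i (p i)) = (-1) ^ X"
    using normal_sign by (simp add: X_def power_add U_def S_def mult_ac)
  have far_sub: "far \<subseteq> ?I" by (auto simp: far_def)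
  have 1: "even ((\<Sum>k\<in>?I. mix k) + (\<Sum>k\<in>?I. w k + b k))"
    using mix_parity by (intro even_sum_add)
  \<comment> \<open>the square of a number has the parity of the number\<close>
  have 2: "even ((\<Sum>r=1..a. ?d r * (a + ?d r + e r)) + ((a + 1) * (\<Sum>r=1..a. ?d r) + (\<Sum>r=1..a. ?d r * e r)))"
    unfolding sum_distrib_left sum.distrib[symmetric] by (rule dvd_sum) auto
  have 3: "even ((\<Sum>k\<in>right. ?d (brow a (b k))) + (\<Sum>k\<in>right. brow a (b k) + near_count + k))"
  proof (rule even_sum_add)
    fix k assume "k \<in> right"
    then show "even (?d (brow a (b k)) + (brow a (b k) + near_count + k))"
      using shifted_parity[OF card_Dn_right[of k]] by blast
  qed
  have "(\<Sum>r=1..a. ?d r) + (\<Sum>k\<in>?I. a + 1 - brow a (b k)) = (\<Sum>r=1..a. r + near_count)"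
    unfolding sum_level_counts[symmetric] sum.distrib[symmetric]
    using card_Dn by (intro sum.cong) (auto simp: near_count_def)
  then have "(a + 1) * (\<Sum>r=1..a. ?d r) + (a + 1) * (\<Sum>k\<in>?I. a + 1 - brow a (b k)) =
      (a + 1) * (\<Sum>r=1..a. r) + (a + 1) * a * near_count"
    by (simp only: distrib_left[symmetric] sum.distrib) (simp add: algebra_simps)
  then have 4: "even ((a + 1) * (\<Sum>r=1..a. ?d r) + (a + 1) * (\<Sum>k\<in>?I. a + 1 - brow a (b k)) + (a + 1) * (\<Sum>r=1..a. r))"
    by simp
  have "even ((a + 1) * (a + 1 - brow a (b k)) + (b k + bcol a (b k)))" if k: "k \<in> ?I" for k
    by (rule column_parity[OF black_code(1)]) (use brow_le b_range[OF k] a in simp)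
  then have 5: "even ((a + 1) * (\<Sum>k\<in>?I. a + 1 - brow a (b k)) + (\<Sum>k\<in>?I. b k + bcol a (b k)))"
    unfolding sum_distrib_left by (intro even_sum_add)
  have 6: "(\<Sum>k\<in>?I. bcol a (b k)) = (\<Sum>k\<in>right. a)"
  proof (rule sum.mono_neutral_cong_right)
    show "\<forall>k\<in>?I - right. bcol a (b k) = 0" using b_col unfolding right_def by blast
  qed (auto simp: right_def)
  \<comment> \<open>in row \<open>a\<close> the code determines the column up to the multiple \<open>a * a\<close>, and \<open>a * a + a\<close> is even\<close>
  have 7: "even ((\<Sum>k\<in>far. w k) + ((\<Sum>k\<in>far. a + wcol a (w k) + n + k) + (\<Sum>k\<in>far. 1 + n + k)))"
    unfolding sum.distrib[of _ _ far, symmetric]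
  proof (rule dvd_sum)
    fix k assume "k \<in> far"
    then have "w k + 1 = a * a + wcol a (w k)"
      using white_code[of a "w k"] a by (auto simp: far_def)
    then have eq: "w k + (a + wcol a (w k) + n + k + (1 + n + k)) = a * (a + 1) + 2 * (wcol a (w k) + n + k)"
      by (simp add: algebra_simps)
    show "even (w k + (a + wcol a (w k) + n + k + (1 + n + k)))" unfolding eq by simp
  qed
  have 8: "(\<Sum>k\<in>?I. w k + b k) = (\<Sum>k\<in>?I - far. w k) + (\<Sum>k\<in>far. w k) + (\<Sum>k\<in>?I. b k)"
    using sum.subset_diff[OF far_sub, of w] by (simp add: sum.distrib)
  have 9: "(\<Sum>k\<in>?I. b k + bcol a (b k)) = (\<Sum>k\<in>?I. b k) + (\<Sum>k\<in>?I. bcol a (b k))"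
    "(\<Sum>k\<in>right. a + brow a (b k) + near_count + k) =
       (\<Sum>k\<in>right. a) + (\<Sum>k\<in>right. brow a (b k) + near_count + k)"
    by (simp_all add: sum.distrib)
  have "even (X + sign_exponent)"
    using 1 2 3 4 5 7 far_sum_parity
    unfolding X_def sign_exponent_def 6 8 9 sum_right_counts even_add by argo
  then show ?thesis unfolding eq by (rule neg_one_power_eqI)
qed
end

section \<open>Rows of the inverse Kasteleyn matrix\<close>

text \<open>
  For \<open>u + v = 1\<close>, the probability that the \<open>n\<close>-th success precedes the
  \<open>m\<close>-th failure in independent trials with success probability \<open>u\<close>.
\<close>

definition half_bezout :: "'a::comm_ring_1 \<Rightarrow> 'a \<Rightarrow> nat \<Rightarrow> nat \<Rightarrow> 'a" where
  "half_bezout u v n m = u ^ n * (\<Sum>k<m. of_nat ((n + k - 1) choose k) * v ^ k)"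

text \<open>
  In terms of trials, the case distinction on the outcome of the first one.
\<close>

lemma half_bezout_rec:
  "half_bezout u v (Suc n) (Suc m) = u * half_bezout u v n (Suc m) + v * half_bezout u v (Suc n) m"
proof -
  have pascal: "(n + Suc k) choose Suc k = ((n + Suc k - 1) choose Suc k) + ((n + k) choose k)" for k
    by (cases n) (simp_all add: choose_reduce_nat)
  have "(\<Sum>k<Suc m. of_nat ((Suc n + k - 1) choose k) * v ^ k) =
      1 + (\<Sum>k<m. of_nat ((n + Suc k) choose Suc k) * v ^ Suc k)"
    by (subst sum.lessThan_Suc_shift) simp
  also have "\<dots> = (1 + (\<Sum>k<m. of_nat ((n + Suc k - 1) choose Suc k) * v ^ Suc k)) +
      v * (\<Sum>k<m. of_nat ((Suc n + k - 1) choose k) * v ^ k)"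
    unfolding pascal
    by (simp add: algebra_simps sum.distrib sum_distrib_left del: binomial_Suc_Suc)
  also have "1 + (\<Sum>k<m. of_nat ((n + Suc k - 1) choose Suc k) * v ^ Suc k) =
      (\<Sum>k<Suc m. of_nat ((n + k - 1) choose k) * v ^ k)"
    by (subst sum.lessThan_Suc_shift) simp
  finally show ?thesis unfolding half_bezout_def by (simp only: power_Suc) (simp only: algebra_simps)
qed

lemma half_bezout_0: "half_bezout u v 0 (Suc m) = 1" "half_bezout u v n 0 = 0"
proof -
  have "(\<Sum>k<m. of_nat ((Suc k - 1) choose Suc k) * v ^ Suc k) = 0"
    by (intro sum.neutral) (auto simp: binomial_eq_0)
  then show "half_bezout u v 0 (Suc m) = 1"
    unfolding half_bezout_def by (subst sum.lessThan_Suc_shift) simp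
qed (simp add: half_bezout_def)

text \<open>
  Either the \<open>n\<close>-th success or the \<open>m\<close>-th failure comes first. The
  identity is used with linear polynomials in place of \<open>u\<close> and \<open>v\<close>, as
  an explicit Bezout relation between \<open>u ^ n\<close> and \<open>v ^ m\<close>.
\<close>

lemma bezout_binomial:
  assumes "u + v = 1" "n > 0 \<or> m > 0"
  shows "half_bezout u v n m + half_bezout v u m n = 1"
  using assms(2)
proof (induction "n + m" arbitrary: n m rule: less_induct)
  case less
  show ?case
  proof (cases n)
    case 0
    then show ?thesis using less by (cases m) (simp_all add: half_bezout_0)
  next
    case (Suc n')
    show ?thesis
    proof (cases m)
      case 0
      then show ?thesis using Suc by (simp add: half_bezout_0)
    next
      case m: (Suc m')
      have "half_bezout u v n m + half_bezout v u m n =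
          u * (half_bezout u v n' m + half_bezout v u m n') + v * (half_bezout u v n m' + half_bezout v u m' n)"
        unfolding Suc m half_bezout_rec by (simp add: algebra_simps)
      then show ?thesis using less.hyps[of n' m] less.hyps[of n m'] Suc m assms(1) by simp
    qed
  qed
qed

definition half_sum :: "real poly" where "half_sum = [:1/2, 1/2:]"
definition half_diff :: "real poly" where "half_diff = [:1/2, -1/2:]"

lemma half_sum_diff: "half_sum + half_diff = 1"
  by (simp add: half_sum_def half_diff_def one_pCons)

text \<open>
  The Taylor polynomial of \<open>(1 - x) ^ (- n)\<close> with \<open>m\<close> terms.
\<close>

definition trunc_poly :: "nat \<Rightarrow> nat \<Rightarrow> real poly \<Rightarrow> real poly" where
  "trunc_poly n m x = (\<Sum>k<m. of_nat ((n + k - 1) choose k) * x ^ k)"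

text \<open>
  In row \<open>p\<close>, the generating function, over the columns, of the row of the inverse
  Kasteleyn matrix that belongs to the black square \<open>B(r, 0)\<close>. Away from \<open>p =
  r\<close> the passage from one row to the next multiplies by \<open>half_sum\<close> and divides
  by \<open>half_diff\<close>; the two branches stay polynomial of degree less than
  \<open>a\<close> by starting with suitable powers, and the truncated series make them fit
  together at \<open>p = r\<close>.
\<close>

definition green_poly :: "nat \<Rightarrow> nat \<Rightarrow> nat \<Rightarrow> real poly" where
  "green_poly a r p =
    (if p < r then smult (1/2) (half_sum ^ p * half_diff ^ (r - 1 - p) * trunc_poly r (a - r + 1) half_diff)
     else smult (-1/2) (half_sum ^ (p - r) * half_diff ^ (a - p) * trunc_poly (a - r + 1) r half_sum))"

lemma degree_half: "degree (half_sum ^ k) \<le> k" "degree (half_diff ^ k) \<le> k"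
  using degree_power_le[of half_sum k] degree_power_le[of half_diff k]
  by (simp_all add: half_sum_def half_diff_def)

lemma degree_trunc_poly:
  assumes "m > 0" "degree x \<le> 1"
  shows "degree (trunc_poly n m x) \<le> m - 1"
  unfolding trunc_poly_def
proof (rule degree_sum_le)
  fix k assume "k \<in> {..<m}"
  have "degree (of_nat ((n + k - 1) choose k) * x ^ k) \<le> degree (x ^ k)"
    by (metis degree_mult_le degree_of_nat add_0)
  also have "\<dots> \<le> degree x * k" by (rule degree_power_le)
  also have "\<dots> \<le> 1 * k" using assms(2) by (rule mult_le_mono1)
  also have "\<dots> \<le> m - 1" using \<open>k \<in> {..<m}\<close> by auto
  finally show "degree (of_nat ((n + k - 1) choose k) * x ^ k) \<le> m - 1" .
qed simp

lemma degree_green_poly: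
  assumes r: "1 \<le> r" "r \<le> a" and p: "p \<le> a"
  shows "degree (green_poly a r p) < a"
proof (cases "p < r")
  case True
  let ?A = "half_sum ^ p" and ?B = "half_diff ^ (r - 1 - p)" and ?C = "trunc_poly r (a - r + 1) half_diff"
  have "degree (green_poly a r p) \<le> degree (?A * ?B * ?C)" using True by (simp add: green_poly_def)
  also have "\<dots> \<le> degree ?A + degree ?B + degree ?C"
    by (meson add_le_mono1 degree_mult_le le_trans)
  also have "\<dots> \<le> p + (r - 1 - p) + (a - r)"
    using degree_half(1)[of p] degree_half(2)[of "r - 1 - p"] degree_trunc_poly[of "a - r + 1" half_diff r]
    by (intro add_mono) (auto simp: half_diff_def)
  finally show ?thesis using True r by linarith
next
  case False
  let ?A = "half_sum ^ (p - r)" and ?B = "half_diff ^ (a - p)" and ?C = "trunc_poly (a - r + 1) r half_sum"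
  have "degree (green_poly a r p) \<le> degree (?A * ?B * ?C)" using False by (simp add: green_poly_def)
  also have "\<dots> \<le> degree ?A + degree ?B + degree ?C"
    by (meson add_le_mono1 degree_mult_le le_trans)
  also have "\<dots> \<le> (p - r) + (a - p) + (r - 1)"
    using degree_half(1)[of "p - r"] degree_half(2)[of "a - p"] degree_trunc_poly[of r half_sum "a - r + 1"] r
    by (intro add_mono) (auto simp: half_sum_def)
  finally show ?thesis using False r p by linarith
qed

text \<open>
  For \<open>p \<noteq> r\<close> the two terms cancel by construction; for \<open>p = r\<close>
  the equation is \<open>bezout_binomial\<close> with exponents \<open>r\<close> and \<open>a - r
  + 1\<close>.
\<close>

lemma green_poly_rec:
  assumes r: "1 \<le> r" "r \<le> a" and p: "1 \<le> p" "p \<le> a"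
  shows "[:1, 1:] * green_poly a r (p - 1) - [:1, -1:] * green_poly a r p = (if p = r then 1 else 0)"
proof -
  have two: "[:1, 1:] = smult 2 half_sum" "[:1, -1:] = smult 2 half_diff"
    by (simp_all add: half_sum_def half_diff_def)
  consider "p < r" | "p = r" | "p > r" by linarith
  then show ?thesis
  proof cases
    case 1
    obtain s where s: "p = Suc s" using p by (cases p) auto
    have "r - 1 - s = Suc (r - 1 - p)" using 1 s by simp
    then show ?thesis using 1 s by (simp add: two green_poly_def algebra_simps)
  next
    case 2
    obtain s where s: "r = Suc s" using r by (cases r) auto
    have "half_bezout half_sum half_diff r (a - r + 1) + half_bezout half_diff half_sum (a - r + 1) r = 1"
      using r by (intro bezout_binomial half_sum_diff) auto
    then have "half_sum ^ r * trunc_poly r (a - r + 1) half_diff +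
        half_diff ^ (a - r + 1) * trunc_poly (a - r + 1) r half_sum = 1"
      by (simp add: half_bezout_def trunc_poly_def)
    then show ?thesis using 2 s by (simp add: two green_poly_def algebra_simps)
  next
    case 3
    obtain s where s: "p = Suc s" using p by (cases p) auto
    have "a - s = Suc (a - p)" "p - r = Suc (s - r)" using 3 s p by auto
    then show ?thesis using 3 s by (simp add: two green_poly_def algebra_simps)
  qed
qed

lemma coeff_half_diff_power: "coeff (half_diff ^ k) q = (-1) ^ q * real (k choose q) / 2 ^ k"
proof -
  have "half_diff = smult (-1/2) [:-1, 1:]" by (simp add: half_diff_def)
  then have eq: "half_diff ^ k = smult ((-1/2) ^ k) ([:-1, 1:] ^ k)" by (metis smult_power)
  show ?thesis
  proof (cases "q \<le> k")
    case True
    have c: "coeff ([:-1, 1 :: real:] ^ k) q = of_nat (k choose q) * 1 ^ q * (-1) ^ (k - q)"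
      using True by (rule coeff_linear_poly_power)
    have "coeff (half_diff ^ k) q = (-1) ^ k / 2 ^ k * (of_nat (k choose q) * 1 ^ q * (-1) ^ (k - q))"
      by (simp only: eq coeff_smult power_divide c)
    also have "\<dots> = ((-1) ^ k * (-1) ^ (k - q)) * real (k choose q) / 2 ^ k" by simp
    also have "(-1 :: real) ^ k * (-1) ^ (k - q) = (-1) ^ q"
      using True by (simp add: power_add[symmetric] minus_one_power_iff)
    finally show ?thesis .
  next
    case False
    then have "degree (half_diff ^ k) < q" using degree_half(2)[of k] by linarith
    then show ?thesis using False by (simp add: coeff_eq_0 binomial_eq_0)
  qed
qed

text \<open>
  In row \<open>0\<close> the polynomial is a combination of powers of \<open>half_diff\<close>.
  Reversing the order of summation (\<open>l = a - r - k\<close>) makes the power of two in the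
  denominator uniform.
\<close>

lemma coeff_green_poly_0:
  assumes r: "1 \<le> r" "r \<le> a"
  shows "coeff (green_poly a r 0) q =
    (-1) ^ q * (\<Sum>l\<le>a - r. 2 ^ l * real ((a - 1 - l) choose (r - 1)) * real ((a - 1 - l) choose q)) / 2 ^ a"
proof -
  let ?f = "\<lambda>k. real ((r - 1 + k) choose (r - 1)) * real ((r - 1 + k) choose q)"
  have "green_poly a r 0 =
      smult (1/2) (\<Sum>k<a - r + 1. of_nat ((r + k - 1) choose k) * half_diff ^ (r - 1 + k))"
  proof -
    have "green_poly a r 0 = smult (1/2) (half_diff ^ (r - 1) * trunc_poly r (a - r + 1) half_diff)"
      using r by (simp add: green_poly_def)
    also have "half_diff ^ (r - 1) * trunc_poly r (a - r + 1) half_diff =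
        (\<Sum>k<a - r + 1. of_nat ((r + k - 1) choose k) * half_diff ^ (r - 1 + k))"
      unfolding trunc_poly_def sum_distrib_left by (intro sum.cong refl) (simp only: power_add mult_ac)
    finally show ?thesis .
  qed
  then have "coeff (green_poly a r 0) q =
      1/2 * (\<Sum>k<a - r + 1. real ((r + k - 1) choose k) * coeff (half_diff ^ (r - 1 + k)) q)"
    by (simp add: coeff_sum of_nat_poly)
  also have "\<dots> = (\<Sum>k<a - r + 1. (-1) ^ q * ?f k / 2 ^ (r + k))"
    unfolding sum_distrib_left
  proof (intro sum.cong refl)
    fix k
    obtain s where s: "r = Suc s" using r by (cases r) auto
    have "(s + k) choose k = (s + k) choose s"
      using binomial_symmetric[of k "s + k"] by simp
    then show "1/2 * (real ((r + k - 1) choose k) * coeff (half_diff ^ (r - 1 + k)) q) =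
        (-1) ^ q * ?f k / 2 ^ (r + k)"
      by (simp add: s coeff_half_diff_power)
  qed
  also have "\<dots> = (\<Sum>l<a - r + 1. (-1) ^ q * ?f (a - r + 1 - Suc l) / 2 ^ (r + (a - r + 1 - Suc l)))"
    by (rule sum.nat_diff_reindex[symmetric])
  also have "\<dots> = (\<Sum>l<a - r + 1. (-1) ^ q * (2 ^ l * real ((a - 1 - l) choose (r - 1)) * real ((a - 1 - l) choose q)) / 2 ^ a)"
  proof (intro sum.cong refl)
    fix l assume "l \<in> {..<a - r + 1}"
    then have l: "l \<le> a - r" by auto
    have "r - 1 + (a - r + 1 - Suc l) = a - 1 - l" "r + (a - r + 1 - Suc l) = a - l" using l r by auto
    moreover have "(2 :: real) ^ a = 2 ^ (a - l) * 2 ^ l" using l r by (simp add: power_add[symmetric])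
    ultimately show "(-1) ^ q * ?f (a - r + 1 - Suc l) / 2 ^ (r + (a - r + 1 - Suc l)) =
        (-1) ^ q * (2 ^ l * real ((a - 1 - l) choose (r - 1)) * real ((a - 1 - l) choose q)) / 2 ^ a"
      by simp
  qed
  also have "{..<a - r + 1} = {..a - r}" by auto
  finally show ?thesis by (simp add: sum_distrib_left sum_divide_distrib)
qed

definition kast_mat :: "nat \<Rightarrow> real mat" where
  "kast_mat a = mat (a * (a + 1)) (a * (a + 1)) (\<lambda>(i, j). kast a i j)"

lemma kast_mat_carrier: "kast_mat a \<in> carrier_mat (a * (a + 1)) (a * (a + 1))"
  by (simp add: kast_mat_def)

lemma sum_white_codes:
  assumes a: "a > 0"
  shows "(\<Sum>i<a * (a + 1). f (wrow a i) (wcol a i)) = (\<Sum>p\<le>a. \<Sum>q=1..a. f p q)"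
proof -
  have "(\<Sum>i<a * (a + 1). f (wrow a i) (wcol a i)) = (\<Sum>(p, q)\<in>{..a} \<times> {1..a}. f p q)"
  proof (rule sum.reindex_bij_witness[where i = "\<lambda>(p, q). p * a + q - 1" and j = "\<lambda>i. (wrow a i, wcol a i)"])
    fix i assume i: "i \<in> {..<a * (a + 1)}"
    show "(case (wrow a i, wcol a i) of (p, q) \<Rightarrow> p * a + q - 1) = i" using white_code(1)[OF a, of i] by simp
    show "(wrow a i, wcol a i) \<in> {..a} \<times> {1..a}"
      using i wrow_le[OF a, of i] white_code(2)[OF a, of i] by simp
  next
    fix x assume x: "x \<in> {..a} \<times> {1..a}"
    then obtain p s where ps: "x = (p, Suc s)" "p \<le> a" "s < a"
      by (cases x; cases "snd x") auto
    show "(wrow a (case x of (p, q) \<Rightarrow> p * a + q - 1), wcol a (case x of (p, q) \<Rightarrow> p * a + q - 1)) = x"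
      using ps by (simp add: wrow_def wcol_def)
    have "p * a + s < p * a + a" using ps by simp
    also have "\<dots> \<le> a * a + a" using ps by simp
    finally show "(case x of (p, q) \<Rightarrow> p * a + q - 1) \<in> {..<a * (a + 1)}" using ps by simp
  qed simp
  then show ?thesis by (simp add: sum.cartesian_product)
qed

text \<open>
  The column of \<open>B(p, s)\<close> involves the white squares in rows \<open>p\<close> and
  \<open>p - 1\<close> and columns \<open>s\<close> and \<open>s + 1\<close>, so the sum is the
  \<open>s\<close>-th coefficient of the left side of \<open>green_poly_rec\<close>. The degree
  bound takes care of the column \<open>a + 1\<close>, in which there are no white squares.
\<close>

lemma green_row:
  assumes a: "a > 0" and r: "1 \<le> r" "r \<le> a" and j: "j < a * (a + 1)"
  shows "(\<Sum>i<a * (a + 1). coeff (green_poly a r (wrow a i)) (wcol a i - 1) * kast a i j) =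
    (if j = (r - 1) * (a + 1) then 1 else 0)"
proof -
  let ?G = "green_poly a r" and ?p = "brow a j" and ?s = "bcol a j"
  have p: "1 \<le> ?p" "?p \<le> a" and s: "?s \<le> a"
    using black_code(2,3)[of a j] brow_le[OF a j] by auto
  \<comment> \<open>multiplication by the variable shifts columns; for \<open>?s = 0\<close> the coefficient is \<open>0\<close>, as it should be\<close>
  let ?c = "\<lambda>P. coeff (pCons 0 P) ?s"
  have pick: "(\<Sum>q=1..a. coeff P (q - 1) * (if ?s = q then x else 0)) = ?c P * x" for P and x :: real
  proof -
    have "(\<Sum>q=1..a. coeff P (q - 1) * (if ?s = q then x else 0)) =
        (\<Sum>q=1..a. if ?s = q then coeff P (?s - 1) * x else 0)"
      by (intro sum.cong) auto
    then show ?thesis using s by (cases ?s) (auto simp: coeff_pCons)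
  qed
  have pick': "(\<Sum>q=1..a. coeff P (q - 1) * (if ?s + 1 = q then x else 0)) = coeff P ?s * x"
    if "degree P < a" for P and x :: real
  proof -
    have "(\<Sum>q=1..a. coeff P (q - 1) * (if ?s + 1 = q then x else 0)) =
        (\<Sum>q=1..a. if ?s + 1 = q then coeff P ?s * x else 0)"
      by (intro sum.cong) auto
    also have "\<dots> = (if ?s + 1 \<in> {1..a} then coeff P ?s * x else 0)" by (rule sum.delta') simp
    also have "\<dots> = coeff P ?s * x"
    proof (cases "?s = a")
      case True
      then have "coeff P ?s = 0" using that by (intro coeff_eq_0) simp
      then show ?thesis by simp
    qed (use s in simp)
    finally show ?thesis .
  qed
  let ?k = "\<lambda>p' q. (if ?p = p' then (if ?s = q then 1 else 0) + (if ?s + 1 = q then -1 else 0) else 0) +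
      (if ?p = p' + 1 then (if ?s = q then 1 else 0) + (if ?s + 1 = q then 1 else 0) else (0 :: real))"
  have "(\<Sum>i<a * (a + 1). coeff (?G (wrow a i)) (wcol a i - 1) * kast a i j) =
      (\<Sum>i<a * (a + 1). coeff (?G (wrow a i)) (wcol a i - 1) * ?k (wrow a i) (wcol a i))"
    by (intro sum.cong refl arg_cong2[of _ _ _ _ "(*)"]) (auto simp: kast_def)
  also have "\<dots> = (\<Sum>p'\<le>a. \<Sum>q=1..a. coeff (?G p') (q - 1) * ?k p' q)"
    by (rule sum_white_codes[OF a, of "\<lambda>p' q. coeff (?G p') (q - 1) * ?k p' q"])
  also have "\<dots> = (\<Sum>p'\<le>a. (if ?p = p' then ?c (?G ?p) - coeff (?G ?p) ?s else 0) +
      (if p' = ?p - 1 then ?c (?G (?p - 1)) + coeff (?G (?p - 1)) ?s else 0))"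
  proof (intro sum.cong refl)
    fix p' assume "p' \<in> {..a}"
    then have deg: "degree (?G p') < a" using degree_green_poly[OF r] by simp
    have "(\<Sum>q=1..a. coeff (?G p') (q - 1) * ?k p' q) =
        (if ?p = p' then (\<Sum>q=1..a. coeff (?G p') (q - 1) * (if ?s = q then 1 else 0)) +
           (\<Sum>q=1..a. coeff (?G p') (q - 1) * (if ?s + 1 = q then -1 else 0)) else 0) +
        (if ?p = p' + 1 then (\<Sum>q=1..a. coeff (?G p') (q - 1) * (if ?s = q then 1 else 0)) +
           (\<Sum>q=1..a. coeff (?G p') (q - 1) * (if ?s + 1 = q then 1 else 0)) else 0)"
      by (simp add: distrib_left sum.distrib)
    then show "(\<Sum>q=1..a. coeff (?G p') (q - 1) * ?k p' q) =
        (if ?p = p' then ?c (?G ?p) - coeff (?G ?p) ?s else 0) +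
        (if p' = ?p - 1 then ?c (?G (?p - 1)) + coeff (?G (?p - 1)) ?s else 0)"
      using p unfolding pick pick'[OF deg] by auto
  qed
  also have "\<dots> = ?c (?G ?p) - coeff (?G ?p) ?s + (?c (?G (?p - 1)) + coeff (?G (?p - 1)) ?s)"
    using p by (simp add: sum.distrib)
  also have "\<dots> = coeff ([:1, 1:] * ?G (?p - 1) - [:1, -1:] * ?G ?p) ?s"
    by (cases ?s) simp_all
  also have "\<dots> = (if j = (r - 1) * (a + 1) then 1 else 0)"
  proof -
    have "j = (r - 1) * (a + 1) \<longleftrightarrow> ?p = r \<and> ?s = 0"
    proof
      assume "j = (r - 1) * (a + 1)"
      then have "j div (a + 1) = r - 1" "j mod (a + 1) = 0" by (simp_all only: nonzero_mult_div_cancel_right mod_mult_self2_is_0)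
      then show "?p = r \<and> ?s = 0" using r by (simp add: brow_def bcol_def)
    next
      assume "?p = r \<and> ?s = 0"
      then have "j + (a + 1) = r * (a + 1)" using black_code(1)[of j a] by simp
      then show "j = (r - 1) * (a + 1)" using r by (cases r) auto
    qed
    then show ?thesis unfolding green_poly_rec[OF r p] by (auto simp: coeff_1)
  qed
  finally show ?thesis .
qed

text \<open>
  A row vector \<open>y\<close> with \<open>y K = e_b\<close> satisfies \<open>det K \<cdot> y = y
  K (adj K) = e_b (adj K)\<close>.
\<close>

lemma adj_kast_mat_left:
  assumes a: "a > 0" and r: "1 \<le> r" "r \<le> a" and i: "i < a * (a + 1)"
  shows "adj_mat (kast_mat a) $$ ((r - 1) * (a + 1), i) =
    det (kast_mat a) * coeff (green_poly a r (wrow a i)) (wcol a i - 1)"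
proof -
  let ?N = "a * (a + 1)" and ?K = "kast_mat a" and ?b = "(r - 1) * (a + 1)"
  let ?y = "\<lambda>i. coeff (green_poly a r (wrow a i)) (wcol a i - 1)"
  note adj = adj_mat[OF kast_mat_carrier[of a]]
  have b: "?b < ?N" using r a by (simp del: mult_Suc_right)
  have "det ?K * ?y i = (\<Sum>l<?N. ?y l * (det ?K \<cdot>\<^sub>m 1\<^sub>m ?N) $$ (l, i))"
  proof -
    have "(\<Sum>l<?N. ?y l * (det ?K \<cdot>\<^sub>m 1\<^sub>m ?N) $$ (l, i)) = (\<Sum>l<?N. if l = i then ?y i * det ?K else 0)"
      using i by (intro sum.cong) auto
    then show ?thesis using i by simp
  qed
  also have "\<dots> = (\<Sum>l<?N. ?y l * (\<Sum>j<?N. kast a l j * adj_mat ?K $$ (j, i)))"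
  proof (intro sum.cong refl arg_cong2[of _ _ _ _ "(*)"])
    fix l assume "l \<in> {..<?N}"
    then have "(?K * adj_mat ?K) $$ (l, i) = (\<Sum>j<?N. kast a l j * adj_mat ?K $$ (j, i))"
      using i adj(1) by (auto simp: kast_mat_def scalar_prod_def atLeast0LessThan intro!: sum.cong)
    then show "(det ?K \<cdot>\<^sub>m 1\<^sub>m ?N) $$ (l, i) = (\<Sum>j<?N. kast a l j * adj_mat ?K $$ (j, i))"
      by (simp only: adj(2))
  qed
  also have "\<dots> = (\<Sum>j<?N. (\<Sum>l<?N. ?y l * kast a l j) * adj_mat ?K $$ (j, i))"
    unfolding sum_distrib_left sum_distrib_right mult.assoc[symmetric] by (rule sum.swap)
  also have "\<dots> = (\<Sum>j<?N. if j = ?b then adj_mat ?K $$ (?b, i) else 0)"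
    using green_row[OF a r] by (intro sum.cong) auto
  also have "\<dots> = adj_mat ?K $$ (?b, i)" using b by simp
  finally show ?thesis ..
qed

section \<open>Determinants count tilings\<close>

definition wcell :: "nat \<Rightarrow> nat \<Rightarrow> cell" where "wcell a i = white_square a (wrow a i) (wcol a i)"
definition bcell :: "nat \<Rightarrow> nat \<Rightarrow> cell" where "bcell a j = black_square a (brow a j) (bcol a j)"

lemma white_square_inject: "white_square a p q = white_square a p' q' \<longleftrightarrow> p = p' \<and> q = q'"
  by (auto simp: white_square_def)

lemma black_square_inject: "black_square a p q = black_square a p' q' \<longleftrightarrow> p = p' \<and> q = q'"
  by (auto simp: black_square_def)

lemma white_neq_black: "white_square a p q \<noteq> black_square a p' q'"
  unfolding white_square_def black_square_def prod.inject by presburger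

lemma white_code_eqI: "a > 0 \<Longrightarrow> wrow a i = wrow a j \<Longrightarrow> wcol a i = wcol a j \<Longrightarrow> i = j"
  using white_code(1)[of a i] white_code(1)[of a j] by simp

lemma black_code_eqI: "brow a i = brow a j \<Longrightarrow> bcol a i = bcol a j \<Longrightarrow> i = j"
  using black_code(1)[of i a] black_code(1)[of j a] by simp

lemma inj_wcell: "a > 0 \<Longrightarrow> inj (wcell a)"
  by (rule injI) (auto simp: wcell_def white_square_inject intro: white_code_eqI)

lemma inj_bcell: "inj (bcell a)"
  by (rule injI) (auto simp: bcell_def black_square_inject intro: black_code_eqI)

lemma wcell_neq_bcell: "wcell a i \<noteq> bcell a j"
  by (simp add: wcell_def bcell_def white_neq_black)

lemma wcell_code: "1 \<le> q \<Longrightarrow> q \<le> a \<Longrightarrow> wcell a (p * a + q - 1) = white_square a p q"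
  by (cases q) (simp_all add: wcell_def wrow_def wcol_def)

lemma bcell_code: "1 \<le> p \<Longrightarrow> q \<le> a \<Longrightarrow> bcell a ((p - 1) * (a + 1) + q) = black_square a p q"
proof -
  assume "1 \<le> p" "q \<le> a"
  moreover have "((p - 1) * (a + 1) + q) div (a + 1) = p - 1" "((p - 1) * (a + 1) + q) mod (a + 1) = q"
    using \<open>q \<le> a\<close> by (simp_all only: div_mult_self3 mod_mult_self3) auto
  ultimately show ?thesis by (simp only: bcell_def brow_def bcol_def) simp
qed

lemma white_code_bound: "(p :: nat) \<le> a \<Longrightarrow> 1 \<le> q \<Longrightarrow> q \<le> a \<Longrightarrow> p * a + q - 1 < a * (a + 1)"
proof -
  assume pq: "p \<le> a" "1 \<le> q" "q \<le> a"
  have "p * a + q - 1 < p * a + a" using pq by (cases q) simp_all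
  also have "\<dots> \<le> a * a + a" using pq by simp
  finally show ?thesis by simp
qed

lemma black_code_bound: "(1 :: nat) \<le> p \<Longrightarrow> p \<le> a \<Longrightarrow> q \<le> a \<Longrightarrow> (p - 1) * (a + 1) + q < a * (a + 1)"
proof -
  assume pq: "1 \<le> p" "p \<le> a" "q \<le> a"
  have "(p - 1) * (a + 1) + q < (p - 1) * (a + 1) + (a + 1)"
    by (rule add_strict_left_mono) (use pq in simp)
  also have "\<dots> = p * (a + 1)" using pq by (cases p) simp_all
  also have "\<dots> \<le> a * (a + 1)" using pq by (intro mult_le_mono1)
  finally show ?thesis .
qed

lemma aztec_diamond_codes:
  assumes a: "a > 0"
  shows "aztec_diamond a = wcell a ` {0..<a * (a + 1)} \<union> bcell a ` {0..<a * (a + 1)}"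
proof -
  have "wcell a ` {0..<a * (a + 1)} = {white_square a p q | p q. p \<le> a \<and> 1 \<le> q \<and> q \<le> a}"
  proof (intro equalityI subsetI)
    fix x assume "x \<in> wcell a ` {0..<a * (a + 1)}"
    then show "x \<in> {white_square a p q | p q. p \<le> a \<and> 1 \<le> q \<and> q \<le> a}"
      using wrow_le[OF a] white_code(2)[OF a] unfolding wcell_def by fastforce
  next
    fix x assume "x \<in> {white_square a p q | p q. p \<le> a \<and> 1 \<le> q \<and> q \<le> a}"
    then obtain p q where pq: "p \<le> a" "1 \<le> q" "q \<le> a" and x: "x = white_square a p q" by blast
    then have "x = wcell a (p * a + q - 1)" by (simp only: wcell_code)
    then show "x \<in> wcell a ` {0..<a * (a + 1)}" using white_code_bound[OF pq] by auto
  qed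
  moreover have "bcell a ` {0..<a * (a + 1)} = {black_square a p q | p q. 1 \<le> p \<and> p \<le> a \<and> q \<le> a}"
  proof (intro equalityI subsetI)
    fix x assume "x \<in> bcell a ` {0..<a * (a + 1)}"
    then show "x \<in> {black_square a p q | p q. 1 \<le> p \<and> p \<le> a \<and> q \<le> a}"
      using brow_le[OF a] black_code(2,3)[of a] unfolding bcell_def by fastforce
  next
    fix x assume "x \<in> {black_square a p q | p q. 1 \<le> p \<and> p \<le> a \<and> q \<le> a}"
    then obtain p q where pq: "1 \<le> p" "p \<le> a" "q \<le> a" and x: "x = black_square a p q" by blast
    then have "x = bcell a ((p - 1) * (a + 1) + q)" by (simp only: bcell_code)
    then show "x \<in> bcell a ` {0..<a * (a + 1)}" using black_code_bound[OF pq] by auto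
  qed
  ultimately show ?thesis by (simp add: aztec_diamond_eq)
qed

lemma white_parity: "even (fst (white_square a p q) + snd (white_square a p q) + int a)"
  by (simp add: white_square_def)

lemma black_parity: "odd (fst (black_square a p q) + snd (black_square a p q) + int a)"
  by (simp add: black_square_def)

lemma white_not_adjacent: "\<not> share_edge (wcell a i) (wcell a j)"
  using share_edge_parity[of "wcell a i" "wcell a j"] white_parity[of a] unfolding wcell_def
  by (meson even_add)

lemma black_not_adjacent: "\<not> share_edge (bcell a i) (bcell a j)"
  using share_edge_parity[of "bcell a i" "bcell a j"] black_parity[of a] unfolding bcell_def
  by (meson even_add)

lemma share_edge_white_black:
  "share_edge (white_square a p q) (black_square a p' q') \<longleftrightarrow>
     (p' = p \<or> p' = p + 1) \<and> (q' = q \<or> q' + 1 = q)"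
proof -
  have "share_edge (white_square a p q) (black_square a p' q') \<longleftrightarrow>
      \<bar>(int q - int q') + (int p' - int p) - 1\<bar> + \<bar>(int q - int q') - (int p' - int p)\<bar> = 1"
    by (simp add: share_edge_def white_square_def black_square_def algebra_simps)
  also have "\<dots> \<longleftrightarrow> (int p' - int p = 0 \<or> int p' - int p = 1) \<and> (int q - int q' = 0 \<or> int q - int q' = 1)"
    by arith
  also have "\<dots> \<longleftrightarrow> (p' = p \<or> p' = p + 1) \<and> (q' = q \<or> q' + 1 = q)" by auto
  finally show ?thesis .
qed

lemma share_edge_kast: "share_edge (wcell a i) (bcell a j) \<longleftrightarrow> kast a i j \<noteq> 0"
  unfolding wcell_def bcell_def share_edge_white_black by (auto simp: kast_def)

context defects begin

definition region :: "cell set" where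
  "region = aztec_diamond a - (wcell a ` w ` {1..n} \<union> bcell a ` b ` {1..n})"

text \<open>
  The terms of the determinant that belong to tilings all equal \<open>(-1) ^
  sign_exponent\<close> by \<open>kasteleyn_sign\<close>, and the others contain a zero weight.
\<close>

lemma det_region:
  "det (unit_rows (kast_mat a) (w ` {1..n}) (\<lambda>i. b (inv_into {1..n} w i))) =
     (-1) ^ sign_exponent * real (M region)"
proof -
  let ?S = "w ` {1..n}" and ?b = "\<lambda>i. b (inv_into {1..n} w i)"
  let ?P = "{p. p permutes {0..<N} \<and> (\<forall>i\<in>?S. p i = ?b i)}"
  let ?Q = "{p. p permutes {0..<N} \<and> (\<forall>i\<in>?S. p i = ?b i) \<and>
    (\<forall>i\<in>{0..<N} - ?S. share_edge (wcell a i) (bcell a (p i)))}"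
  have bw: "?b (w k) = b k" if "k \<in> {1..n}" for k
    unfolding inv_into_f_f[OF inj_w that] ..
  have S: "?S \<subseteq> {0..<N}" using w_range by auto
  have bS: "?b ` ?S = b ` {1..n}" unfolding image_image by (rule image_cong[OF refl bw])
  have "inj_on ?b ?S"
  proof (rule inj_onI)
    fix x y assume xy: "x \<in> ?S" "y \<in> ?S" "?b x = ?b y"
    then obtain k l where kl: "k \<in> {1..n}" "l \<in> {1..n}" "x = w k" "y = w l" by blast
    then have "b k = b l" using xy(3) bw[OF kl(1)] bw[OF kl(2)] by metis
    then show "x = y" using inj_onD[OF inj_b _ kl(1,2)] kl by metis
  qed
  moreover have "?b ` ?S \<subseteq> {0..<N}" unfolding bS using b_range by auto
  ultimately have "M ((wcell a ` {0..<N} \<union> bcell a ` {0..<N}) - (wcell a ` ?S \<union> bcell a ` ?b ` ?S)) = card ?Q"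
    using a S inj_on_subset[OF inj_wcell] inj_on_subset[OF inj_bcell]
    by (intro M_eq_card_permutations)
      (auto simp: white_not_adjacent black_not_adjacent wcell_neq_bcell)
  then have MQ: "M region = card ?Q"
    unfolding region_def bS using a by (simp only: aztec_diamond_codes)
  have val: "signof p * (\<Prod>i\<in>{0..<N} - ?S. kast_mat a $$ (i, p i)) =
      (if p \<in> ?Q then (-1) ^ sign_exponent else 0)" if p: "p \<in> ?P" for p
  proof -
    have perm: "p permutes {0..<N}" using p by simp
    have eq: "(\<Prod>i\<in>{0..<N} - ?S. kast_mat a $$ (i, p i)) = (\<Prod>i\<in>{0..<N} - ?S. kast a i (p i))"
      using permutes_mem[OF perm] by (intro prod.cong) (auto simp: kast_mat_def)
    show ?thesis
    proof (cases "p \<in> ?Q")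
      case True
      then have "defect_matching a n w b p"
        using bw by unfold_locales (auto simp: share_edge_kast)
      then show ?thesis using True defect_matching.kasteleyn_sign eq by (simp del: mem_Collect_eq)
    next
      case False
      then obtain i where "i \<in> {0..<N} - ?S" "kast a i (p i) = 0"
        using p by (auto simp: share_edge_kast)
      then have "(\<Prod>i\<in>{0..<N} - ?S. kast a i (p i)) = 0" by (intro prod_zero) auto
      then show ?thesis using False eq by (simp del: mem_Collect_eq)
    qed
  qed
  have "det (unit_rows (kast_mat a) ?S ?b) = (\<Sum>p\<in>?P. if p \<in> ?Q then (-1) ^ sign_exponent else 0)"
    unfolding det_unit_rows[OF kast_mat_carrier S] by (intro sum.cong refl val)
  also have "\<dots> = (\<Sum>p\<in>?Q. (-1) ^ sign_exponent)"
  proof (rule sum.mono_neutral_cong_right)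
    show "finite ?P" by (rule finite_subset[OF _ finite_permutations[of "{0..<N}"]]) auto
  qed auto
  finally show ?thesis using MQ by simp
qed
end

text \<open>
  The case without removed squares.
\<close>

lemma det_kast_mat:
  assumes a: "a \<ge> 1"
  shows "det (kast_mat a) = (-1) ^ ((a + 1) * (\<Sum>r=1..a. r)) * real (M (aztec_diamond a))"
proof -
  interpret defects a 0 id id using a by unfold_locales (auto simp: strict_mono_on_def)
  have "unit_rows (kast_mat a) {} b = kast_mat a" for b
    by (rule eq_matI) (auto simp: unit_rows_def)
  then show ?thesis
    using det_region by (simp add: sign_exponent_def far_def right_def region_def)
qed

text \<open>
  The case of one removed square of each colour, with the sign spelled out: when pairs of squares
  are compared with the whole set, each pair needs its own sign.
\<close>

lemma adj_kast_mat:
  assumes a: "a \<ge> 1" and i: "i < a * (a + 1)" "wrow a i = 0 \<or> wrow a i = a"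
    and j: "j < a * (a + 1)" "bcol a j = 0 \<or> bcol a j = a"
  shows "adj_mat (kast_mat a) $$ (j, i) =
    (-1) ^ ((a + 1) * (\<Sum>r=1..a. r) + (if wrow a i = a then 1 else i) +
      (if bcol a j = a then a + brow a j + (if wrow a i = a then 1 else 0) else 0)) *
    real (M (aztec_diamond a - {wcell a i, bcell a j}))"
proof -
  interpret defects a 1 "\<lambda>_. i" "\<lambda>_. j" using assms by unfold_locales (auto simp: strict_mono_on_def)
  have far: "far = (if wrow a i = a then {1} else {})" unfolding far_def by auto
  have right: "right = (if bcol a j = a then {1} else {})" unfolding right_def by auto
  have "adj_mat (kast_mat a) $$ (j, i) = det (unit_rows (kast_mat a) {i} (\<lambda>_. j))"
    using i j by (intro adj_mat_entry_eq_det_unit_rows[OF kast_mat_carrier])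
  also have "\<dots> = (-1) ^ sign_exponent * real (M region)"
    using det_region by simp
  also have "region = aztec_diamond a - {wcell a i, bcell a j}" unfolding region_def by auto
  also have "(-1 :: real) ^ sign_exponent =
    (-1) ^ ((a + 1) * (\<Sum>r=1..a. r) + (if wrow a i = a then 1 else i) +
      (if bcol a j = a then a + brow a j + (if wrow a i = a then 1 else 0) else 0))"
    unfolding sign_exponent_def near_count_def far right by (rule neg_one_power_eqI) auto
  finally show ?thesis .
qed

section \<open>The cyclic order of the removed squares\<close>

lemma sorting_permutation:
  fixes key :: "nat \<Rightarrow> nat"
  assumes inj: "inj_on key {1..m}"
  defines "L \<equiv> sorted_list_of_set (key ` {1..m})"
  obtains \<tau> where "\<tau> permutes {1..m}"
    and "\<And>i. i \<in> {1..m} \<Longrightarrow> L ! (\<tau> i - 1) = key i"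
    and "\<And>i j. i \<in> {1..m} \<Longrightarrow> j \<in> {1..m} \<Longrightarrow> \<tau> i < \<tau> j \<longleftrightarrow> key i < key j"
proof -
  have len: "length L = m" using inj by (simp add: L_def card_image)
  have set_L: "set L = key ` {1..m}" by (simp add: L_def)
  have sorted: "sorted_wrt (<) L" unfolding L_def by simp
  define g where "g l = L ! (l - 1)" for l
  have g_mono: "g l < g l'" if "l \<in> {1..m}" "l' \<in> {1..m}" "l < l'" for l l'
    unfolding g_def using that len by (intro sorted_wrt_nth_less[OF sorted]) auto
  have g_inj: "inj_on g {1..m}"
    using g_mono by (intro linorder_inj_onI') fastforce
  have "g ` {1..m} = set L"
  proof
    show "g ` {1..m} \<subseteq> set L" using len by (auto simp: g_def)
    show "set L \<subseteq> g ` {1..m}"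
    proof
      fix x assume "x \<in> set L"
      then obtain l where "l < m" "x = L ! l" using len by (metis in_set_conv_nth)
      then show "x \<in> g ` {1..m}" by (intro image_eqI[of _ _ "Suc l"]) (auto simp: g_def)
    qed
  qed
  then have gb: "bij_betw g {1..m} (key ` {1..m})" using g_inj set_L by (simp add: bij_betw_def)
  define \<tau> where "\<tau> i = (if i \<in> {1..m} then inv_into {1..m} g (key i) else i)" for i
  have "bij_betw (inv_into {1..m} g \<circ> key) {1..m} {1..m}"
    using bij_betw_trans[OF bij_betw_imageI[OF inj refl] bij_betw_inv_into[OF gb]] .
  then have "bij_betw \<tau> {1..m} {1..m}"
    by (rule iffD1[OF bij_betw_cong, rotated]) (simp add: \<tau>_def)
  then have perm: "\<tau> permutes {1..m}" by (rule bij_imp_permutes) (simp only: \<tau>_def if_False)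
  have g\<tau>: "g (\<tau> i) = key i" if "i \<in> {1..m}" for i
  proof -
    have "key i \<in> g ` {1..m}" using gb that by (auto simp: bij_betw_def)
    then show ?thesis using that by (simp only: \<tau>_def if_True f_inv_into_f)
  qed
  have "\<tau> i < \<tau> j \<longleftrightarrow> key i < key j" if ij: "i \<in> {1..m}" "j \<in> {1..m}" for i j
  proof -
    note mem = permutes_mem[OF perm ij(1)] permutes_mem[OF perm ij(2)]
    show ?thesis
      using g_mono[OF mem] g_mono[OF mem(2,1)] g\<tau>[OF ij(1)] g\<tau>[OF ij(2)]
      by (metis less_asym' less_irrefl_nat linorder_neqE_nat)
  qed
  then show ?thesis using that perm g\<tau> unfolding g_def by blast
qed

text \<open>
  The boundary squares in their cyclic order from the south corner, numbered from
  \<open>0\<close>.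
\<close>

definition boundary_cell :: "nat \<Rightarrow> nat \<Rightarrow> cell" where
  "boundary_cell a i =
    (if i < a then white_square a 0 (i + 1)
     else if i < 2 * a then black_square a (i - a + 1) a
     else if i < 3 * a then white_square a a (3 * a - i)
     else black_square a (4 * a - i) 0)"

lemma boundary_squares_eq_map: "boundary_squares a = map (boundary_cell a) [0..<4 * a]"
proof (rule nth_equalityI)
  show "length (boundary_squares a) = length (map (boundary_cell a) [0..<4 * a])"
    by (simp add: boundary_squares_def del: upt_Suc)
  fix i assume "i < length (boundary_squares a)"
  then have i: "i < 4 * a" by (simp add: boundary_squares_def del: upt_Suc)
  have rev: "rev [Suc 0..<Suc a] ! k = a - k" if "k < a" for k
    using that by (subst rev_nth) (simp_all del: upt_Suc)
  have multiples: "a + (a + a) = 3 * a" "a + (a + a + a) = 4 * a" by simp_all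
  have "boundary_squares a ! i = boundary_cell a i"
    using i by (auto simp: boundary_squares_def nth_append boundary_cell_def rev multiples simp del: upt_Suc)
  then show "boundary_squares a ! i = map (boundary_cell a) [0..<4 * a] ! i" using i by simp
qed

lemma inj_boundary_cell:
  assumes "a \<ge> 1" shows "inj_on (boundary_cell a) {0..<4 * a}"
proof (rule inj_onI)
  fix i j assume "i \<in> {0..<4 * a}" "j \<in> {0..<4 * a}" "boundary_cell a i = boundary_cell a j"
  then show "i = j"
    using assms white_neq_black[of a] white_neq_black[of a, symmetric]
    by (auto simp: boundary_cell_def white_square_inject black_square_inject split: if_splits)
qed

text \<open>
  The number of a boundary square in the order of \<open>boundary_cell\<close>, in terms of its
  code.
\<close>

definition white_position :: "nat \<Rightarrow> nat \<Rightarrow> nat" where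
  "white_position a i = (if wrow a i = a then 3 * a - wcol a i else wcol a i - 1)"

definition black_position :: "nat \<Rightarrow> nat \<Rightarrow> nat" where
  "black_position a j = (if bcol a j = a then a + brow a j - 1 else 4 * a - brow a j)"

lemma white_position:
  assumes a: "a \<ge> 1" and i: "wrow a i = 0 \<or> wrow a i = a"
  shows "white_position a i < 4 * a" "boundary_cell a (white_position a i) = wcell a i"
  using white_code(2)[of a i] a i
  by (auto simp: white_position_def boundary_cell_def wcell_def)

lemma black_position:
  assumes a: "a \<ge> 1" and j: "bcol a j = 0 \<or> bcol a j = a" "j < a * (a + 1)"
  shows "black_position a j < 4 * a" "boundary_cell a (black_position a j) = bcell a j"
proof -
  have "1 \<le> brow a j" "brow a j \<le> a" using black_code(3)[of a j] brow_le[of a j] a j by auto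
  then show "black_position a j < 4 * a" "boundary_cell a (black_position a j) = bcell a j"
    using a j by (auto simp: black_position_def boundary_cell_def bcell_def)
qed

text \<open>
  The full diamond has equally many squares of both colours.
\<close>

lemma M_monochromatic:
  assumes a: "a \<ge> 1" and X: "X \<noteq> {}"
    and mono: "X \<subseteq> wcell a ` {0..<a * (a + 1)} \<or> X \<subseteq> bcell a ` {0..<a * (a + 1)}"
  shows "M (aztec_diamond a - X) = 0"
proof (rule ccontr)
  assume "M (aztec_diamond a - X) \<noteq> 0"
  then obtain T where T: "T \<in> domino_tilings (aztec_diamond a - X)"
    by (metis M_def card.empty equals0I)
  let ?W = "wcell a ` {0..<a * (a + 1)}" and ?B = "bcell a ` {0..<a * (a + 1)}"
  have AD: "aztec_diamond a = ?W \<union> ?B" using a by (intro aztec_diamond_codes) auto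
  have fin: "finite ?W" "finite ?B" "finite X" using mono by (auto intro: finite_subset)
  have disj: "?W \<inter> ?B = {}" using wcell_neq_bcell by blast
  have cards: "card ?W = a * (a + 1)" "card ?B = a * (a + 1)"
    using card_image[OF inj_on_subset[OF inj_wcell[of a]]] card_image[OF inj_on_subset[OF inj_bcell[of a]]] a
    by auto
  let ?E = "{c \<in> aztec_diamond a - X. even (fst c + snd c)}" and ?O = "{c \<in> aztec_diamond a - X. odd (fst c + snd c)}"
  have par: "even (fst c + snd c) \<longleftrightarrow> even (int a)" if "c \<in> ?W" for c
    using that white_parity[of a] unfolding wcell_def by (auto simp: even_add)
  have par': "even (fst c + snd c) \<longleftrightarrow> odd (int a)" if "c \<in> ?B" for c
    using that black_parity[of a] unfolding bcell_def by (auto simp: even_add)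
  have EO: "?E = ?W - X \<and> ?O = ?B - X \<or> ?E = ?B - X \<and> ?O = ?W - X"
  proof (cases "even (int a)")
    case True
    then have "?E = ?W - X" "?O = ?B - X" unfolding AD using par par' disj by blast+
    then show ?thesis by (intro disjI1 conjI)
  next
    case False
    then have "?O = ?W - X" "?E = ?B - X" unfolding AD using par par' disj by blast+
    then show ?thesis by (intro disjI2 conjI)
  qed
  have "card ?E = card ?O" using tiling_balanced[OF T] fin AD by simp
  with EO have eq: "card (?W - X) = card (?B - X)" by (elim disjE conjE) (simp_all only:)
  have pos: "card X > 0" using X fin by (simp add: card_gt_0_iff)
  from mono show False
  proof
    assume XW: "X \<subseteq> ?W"
    then have "?B - X = ?B" using disj by blast
    moreover have "card (?W - X) = card ?W - card X" using fin XW by (intro card_Diff_subset)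
    moreover have "card X \<le> card ?W" using fin XW by (intro card_mono)
    ultimately show False using eq cards pos by simp
  next
    assume XB: "X \<subseteq> ?B"
    then have "?W - X = ?W" using disj by blast
    moreover have "card (?B - X) = card ?B - card X" using fin XB by (intro card_Diff_subset)
    moreover have "card X \<le> card ?B" using fin XB by (intro card_mono)
    ultimately show False using eq cards pos by simp
  qed
qed

lemma card_parity_classes:
  fixes A B C D :: "(nat \<times> nat) set"
  assumes "finite A" "finite B" "finite C" "finite D"
    and A: "\<And>x. x \<in> A \<Longrightarrow> odd (fst x) \<and> odd (snd x)" and B: "\<And>x. x \<in> B \<Longrightarrow> even (fst x) \<and> even (snd x)"
    and C: "\<And>x. x \<in> C \<Longrightarrow> odd (fst x) \<and> even (snd x)" and D: "\<And>x. x \<in> D \<Longrightarrow> even (fst x) \<and> odd (snd x)"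
  shows "card (A \<union> B \<union> C \<union> D) = card A + card B + card C + card D"
proof -
  have "A \<inter> B = {}" "(A \<union> B) \<inter> C = {}" "(A \<union> B \<union> C) \<inter> D = {}"
    using A B C D by blast+
  then show ?thesis using assms(1-4) by (simp add: card_Un_disjoint)
qed

context defects begin

text \<open>
  The removed squares are first listed alternately, \<open>w 1, b 1, w 2, b 2, \<dots>\<close>,
  which is the natural order for a bipartite Pfaffian. The keys tell where they stand on the
  boundary.
\<close>

definition position_key :: "nat \<Rightarrow> nat" where
  "position_key x = (if odd x then white_position a (w ((x + 1) div 2)) else black_position a (b (x div 2)))"

lemma position_key_odd: "k \<in> {1..n} \<Longrightarrow> position_key (2 * k - 1) = white_position a (w k)"
  by (auto simp: position_key_def)

lemma position_key_even: "position_key (2 * k) = black_position a (b k)"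
  by (simp add: position_key_def)

lemma odd_even_cases:
  assumes "x \<in> {1..2 * n}"
  obtains k where "k \<in> {1..n}" "x = 2 * k - 1" | k where "k \<in> {1..n}" "x = 2 * k"
proof (cases "even x")
  case True
  then show ?thesis using assms that(2)[of "x div 2"] by auto
next
  case False
  then show ?thesis using assms that(1)[of "(x + 1) div 2"] by (auto elim!: oddE)
qed

text \<open>
  Codes increase along the southeastern side, which comes first, and decrease along the
  northwestern one.
\<close>

lemma white_position_less:
  assumes kl: "k \<in> {1..n}" "l \<in> {1..n}" "k < l"
  shows "white_position a (w l) < white_position a (w k) \<longleftrightarrow> k \<in> far"
proof -
  have lt: "w k < w l" using w_less kl by simp
  then have rows: "wrow a (w k) < wrow a (w l) \<or> wrow a (w k) = wrow a (w l) \<and> wcol a (w k) < wcol a (w l)"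
    using white_code_less[of a "w k" "w l"] a by simp
  have "wcol a (w k) \<le> a" "wcol a (w l) \<le> a" "1 \<le> wcol a (w k)" "1 \<le> wcol a (w l)"
    using white_code(2)[of a] a by auto
  then show ?thesis
    using rows w_row[OF kl(1)] w_row[OF kl(2)] kl a by (auto simp: white_position_def far_def)
qed

text \<open>
  Codes increase along the northeastern side and decrease along the southwestern one, which comes
  last.
\<close>

lemma black_position_less:
  assumes kl: "k \<in> {1..n}" "l \<in> {1..n}" "k < l"
  shows "black_position a (b l) < black_position a (b k) \<longleftrightarrow> k \<notin> right"
proof -
  have lt: "b k < b l" using b_less kl by simp
  then have rows: "brow a (b k) < brow a (b l) \<or> brow a (b k) = brow a (b l) \<and> bcol a (b k) < bcol a (b l)"
    using black_code_less[of "b k" "b l" a] by simp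
  have "brow a (b k) \<le> a" "brow a (b l) \<le> a" "1 \<le> brow a (b k)" "1 \<le> brow a (b l)"
    using black_code(3)[of a] brow_le[of a] b_range kl a by auto
  then show ?thesis
    using rows b_col[OF kl(1)] b_col[OF kl(2)] kl a by (auto simp: black_position_def right_def)
qed

text \<open>
  The sides follow each other in the order southeast, northeast, northwest, southwest; only the
  middle two have a black side before a white one.
\<close>

lemma black_before_white:
  assumes kl: "k \<in> {1..n}" "l \<in> {1..n}"
  shows "black_position a (b l) < white_position a (w k) \<longleftrightarrow> k \<in> far \<and> l \<in> right"
    and "white_position a (w k) < black_position a (b l) \<longleftrightarrow> \<not> (k \<in> far \<and> l \<in> right)"
proof -
  have "wcol a (w k) \<le> a" "1 \<le> wcol a (w k)" "brow a (b l) \<le> a" "1 \<le> brow a (b l)"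
    using white_code(2)[of a] black_code(3)[of a] brow_le[of a] b_range kl a by auto
  then show "black_position a (b l) < white_position a (w k) \<longleftrightarrow> k \<in> far \<and> l \<in> right"
    "white_position a (w k) < black_position a (b l) \<longleftrightarrow> \<not> (k \<in> far \<and> l \<in> right)"
    using w_row[OF kl(1)] b_col[OF kl(2)] kl a
    by (auto simp: white_position_def black_position_def far_def right_def)
qed

lemma inj_position_key: "inj_on position_key {1..2 * n}"
proof (rule inj_onI)
  fix x y assume xy: "x \<in> {1..2 * n}" "y \<in> {1..2 * n}" and eq: "position_key x = position_key y"
  have WB: False if "k \<in> {1..n}" "l \<in> {1..n}" "white_position a (w k) = black_position a (b l)" for k l
    using black_before_white[OF that(1,2)] that(3) by auto
  have WW: "k = l" if kl: "k \<in> {1..n}" "l \<in> {1..n}" "white_position a (w k) = white_position a (w l)" for k l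
  proof -
    have "wcell a (w k) = wcell a (w l)"
      using white_position(2)[OF a w_row[OF kl(1)]] white_position(2)[OF a w_row[OF kl(2)]] kl(3) by simp
    then show ?thesis using inj_wcell[of a] a inj_onD[OF inj_w _ kl(1,2)] by (auto dest: injD)
  qed
  have BB: "k = l" if kl: "k \<in> {1..n}" "l \<in> {1..n}" "black_position a (b k) = black_position a (b l)" for k l
  proof -
    have "bcell a (b k) = bcell a (b l)"
      using black_position(2)[OF a b_col[OF kl(1)] b_range[OF kl(1)]]
        black_position(2)[OF a b_col[OF kl(2)] b_range[OF kl(2)]] kl(3) by simp
    then show ?thesis using inj_bcell[of a] inj_onD[OF inj_b _ kl(1,2)] by (auto dest: injD)
  qed
  show "x = y"
    using xy(1)
  proof (cases rule: odd_even_cases)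
    case (1 k)
    show ?thesis using xy(2)
    proof (cases rule: odd_even_cases)
      case (1 l)
      then show ?thesis using eq WW[of k l] position_key_odd \<open>k \<in> {1..n}\<close> \<open>x = 2 * k - 1\<close> by metis
    next
      case (2 l)
      then show ?thesis using eq WB[of k l] position_key_odd position_key_even \<open>k \<in> {1..n}\<close> \<open>x = 2 * k - 1\<close> by metis
    qed
  next
    case (2 k)
    show ?thesis using xy(2)
    proof (cases rule: odd_even_cases)
      case (1 l)
      then show ?thesis using eq WB[of l k] position_key_odd position_key_even \<open>k \<in> {1..n}\<close> \<open>x = 2 * k\<close> by metis
    next
      case (2 l)
      then show ?thesis using eq BB[of k l] position_key_even \<open>k \<in> {1..n}\<close> \<open>x = 2 * k\<close> by metis
    qed
  qed
qed

lemma card_pairs_from: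
  assumes "A \<subseteq> {1..n}"
  shows "card {(k, l). k \<in> A \<and> l \<in> {1..n} \<and> k < l} = (\<Sum>k\<in>A. n - k)"
proof -
  have "{(k, l). k \<in> A \<and> l \<in> {1..n} \<and> k < l} = (SIGMA k:A. {k<..n})"
    using assms by auto
  moreover have "finite A" using assms finite_subset by blast
  ultimately show ?thesis by simp
qed

text \<open>
  Inversions between squares of the same colour depend only on the side of the first one. Those
  between different colours are, modulo two, the pairs on the northwestern and northeastern sides
  together with all pairs of indices \<open>k < l\<close>; the latter combine with the inversions
  between black squares.
\<close>

lemma position_key_inversions:
  "even (card {(i, j). i \<in> {1..2*n} \<and> j \<in> {1..2*n} \<and> i < j \<and> position_key j < position_key i} +
     ((\<Sum>k\<in>far. n - k) + (\<Sum>k\<in>right. n - k) + card far * card right))"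
proof -
  let ?I = "{1..n}" and ?inv = "{(i, j). i \<in> {1..2*n} \<and> j \<in> {1..2*n} \<and> i < j \<and> position_key j < position_key i}"
  \<comment> \<open>the pairs in which the black square comes first\<close>
  let ?R = "\<lambda>k l. k \<in> far \<and> l \<in> right"
  let ?WW = "{(k, l). k \<in> far \<and> l \<in> ?I \<and> k < l}" and ?BB = "{(k, l). k \<in> ?I - right \<and> l \<in> ?I \<and> k < l}"
  let ?WB = "{(k, l). k \<in> ?I \<and> l \<in> ?I \<and> k \<le> l \<and> ?R k l}"
  let ?BW = "{(l, k). l \<in> ?I \<and> k \<in> ?I \<and> l < k \<and> \<not> ?R k l}"
  \<comment> \<open>not inversions themselves: \<open>?Y\<close> completes both \<open>?WB\<close> and \<open>?BW\<close> to sets of known size\<close>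
  let ?Y = "{(l, k). l \<in> ?I \<and> k \<in> ?I \<and> l < k \<and> ?R k l}"
  let ?fWW = "\<lambda>(k, l). (2*k - 1, 2*l - 1 :: nat)" and ?fBB = "\<lambda>(k, l). (2*k, 2*l :: nat)"
    and ?fWB = "\<lambda>(k, l). (2*k - 1, 2*l :: nat)" and ?fBW = "\<lambda>(l, k). (2*l, 2*k - 1 :: nat)"
  have sub: "far \<subseteq> ?I" "right \<subseteq> ?I" by (auto simp: far_def right_def)
  have fin: "finite ?WW" "finite ?BB" "finite ?WB" "finite ?BW" "finite ?Y"
    by (rule finite_subset[of _ "?I \<times> ?I"]; use sub in auto)+
  have "?inv = ?fWW ` ?WW \<union> ?fBB ` ?BB \<union> ?fWB ` ?WB \<union> ?fBW ` ?BW"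
  proof (rule equalityI; (intro Un_least image_subsetI | rule subsetI))
    fix x assume "x \<in> ?inv"
    then obtain i j where x: "x = (i, j)" "i \<in> {1..2*n}" "j \<in> {1..2*n}" "i < j" "position_key j < position_key i"
      by blast
    show "x \<in> ?fWW ` ?WW \<union> ?fBB ` ?BB \<union> ?fWB ` ?WB \<union> ?fBW ` ?BW"
      using x(2)
    proof (cases rule: odd_even_cases)
      case k: (1 k)
      show ?thesis using x(3)
      proof (cases rule: odd_even_cases)
        case l: (1 l)
        have "k < l" using x k l by auto
        moreover have "white_position a (w l) < white_position a (w k)"
          using x(5) unfolding k(2) l(2) position_key_odd[OF k(1)] position_key_odd[OF l(1)] .
        ultimately have "(k, l) \<in> ?WW" using white_position_less[OF k(1) l(1)] l(1) by simp
        then have "?fWW (k, l) \<in> ?fWW ` ?WW" by (rule imageI)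
        then show ?thesis using x k l by simp
      next
        case l: (2 l)
        have "k \<le> l" using x k l by auto
        moreover have "black_position a (b l) < white_position a (w k)"
          using x(5) unfolding k(2) l(2) position_key_odd[OF k(1)] position_key_even .
        ultimately have "(k, l) \<in> ?WB" using black_before_white(1)[OF k(1) l(1)] k(1) l(1) by simp
        then have "?fWB (k, l) \<in> ?fWB ` ?WB" by (rule imageI)
        then show ?thesis using x k l by simp
      qed
    next
      case k: (2 k)
      show ?thesis using x(3)
      proof (cases rule: odd_even_cases)
        case l: (1 l)
        have "k < l" using x k l by auto
        moreover have "white_position a (w l) < black_position a (b k)"
          using x(5) unfolding k(2) l(2) position_key_odd[OF l(1)] position_key_even .
        ultimately have "(k, l) \<in> ?BW" using black_before_white(2)[OF l(1) k(1)] k(1) l(1) by simp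
        then have "?fBW (k, l) \<in> ?fBW ` ?BW" by (rule imageI)
        then show ?thesis using x k l by simp
      next
        case l: (2 l)
        have "k < l" using x k l by auto
        moreover have "black_position a (b l) < black_position a (b k)"
          using x(5) unfolding k(2) l(2) position_key_even .
        ultimately have "(k, l) \<in> ?BB" using black_position_less[OF k(1) l(1)] k(1) l(1) by simp
        then have "?fBB (k, l) \<in> ?fBB ` ?BB" by (rule imageI)
        then show ?thesis using x k l by simp
      qed
    qed
  next
    fix y assume "y \<in> ?WW"
    then obtain k l where y: "y = (k, l)" "k \<in> far" "l \<in> ?I" "k < l" by blast
    then have k: "k \<in> ?I" using sub by blast
    have "position_key (2*l - 1) < position_key (2*k - 1)"
      unfolding position_key_odd[OF k] position_key_odd[OF y(3)]
      using y white_position_less[OF k y(3)] by blast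
    then show "?fWW y \<in> ?inv" using y k by auto
  next
    fix y assume "y \<in> ?BB"
    then obtain k l where y: "y = (k, l)" "k \<in> ?I - right" "l \<in> ?I" "k < l" by blast
    then have "position_key (2*l) < position_key (2*k)"
      unfolding position_key_even using black_position_less[of k l] by blast
    then show "?fBB y \<in> ?inv" using y by auto
  next
    fix y assume "y \<in> ?WB"
    then obtain k l where y: "y = (k, l)" "k \<in> ?I" "l \<in> ?I" "k \<le> l" "?R k l" by blast
    then have "position_key (2*l) < position_key (2*k - 1)"
      unfolding position_key_even position_key_odd[OF y(2)] using black_before_white(1)[of k l] by blast
    then show "?fWB y \<in> ?inv" using y by auto
  next
    fix y assume "y \<in> ?BW"
    then obtain k l where y: "y = (l, k)" "l \<in> ?I" "k \<in> ?I" "l < k" "\<not> ?R k l" by blast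
    then have "position_key (2*k - 1) < position_key (2*l)"
      unfolding position_key_even position_key_odd[OF y(3)] using black_before_white(2)[of k l] by blast
    then show "?fBW y \<in> ?inv" using y by auto
  qed
  moreover have "card (?fWW ` ?WW \<union> ?fBB ` ?BB \<union> ?fWB ` ?WB \<union> ?fBW ` ?BW) =
      card (?fWW ` ?WW) + card (?fBB ` ?BB) + card (?fWB ` ?WB) + card (?fBW ` ?BW)"
  proof (rule card_parity_classes)
    fix x assume "x \<in> ?fWW ` ?WW"
    then obtain k l where "x = (2*k - 1, 2*l - 1)" "k \<in> far" "l \<in> ?I" by auto
    moreover then have "k \<in> ?I" using sub by blast
    ultimately show "odd (fst x) \<and> odd (snd x)" by auto
  qed (use fin in auto)
  moreover have "card (?fWW ` ?WW) = card ?WW" "card (?fBB ` ?BB) = card ?BB"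
    "card (?fWB ` ?WB) = card ?WB" "card (?fBW ` ?BW) = card ?BW"
    using sub by (auto intro!: card_image simp: inj_on_def subset_eq)
  ultimately have "card ?inv = card ?WW + card ?BB + card ?WB + card ?BW"
    by (simp only:)
  moreover have "card ?WW = (\<Sum>k\<in>far. n - k)" using sub by (intro card_pairs_from)
  moreover have "card ?BB = (\<Sum>k\<in>?I - right. n - k)" by (intro card_pairs_from) auto
  moreover have "card ?WB + card ?Y = card far * card right"
  proof -
    have "1 \<le> k \<and> k \<le> n" if "k \<in> far \<or> k \<in> right" for k using sub that by auto
    then have "far \<times> right = ?WB \<union> prod.swap ` ?Y" by (auto simp: image_iff)
    moreover have "?WB \<inter> prod.swap ` ?Y = {}" by auto
    moreover have "card (prod.swap ` ?Y) = card ?Y" by (intro card_image) auto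
    ultimately show ?thesis
      using fin card_Un_disjoint[of ?WB "prod.swap ` ?Y"] card_cartesian_product[of far right]
      by (simp only: finite_imageI)
  qed
  moreover have "card ?BW + card ?Y = (\<Sum>k\<in>?I. n - k)"
  proof -
    have "{(k, l). k \<in> ?I \<and> l \<in> ?I \<and> k < l} = ?BW \<union> ?Y" by auto
    moreover have "?BW \<inter> ?Y = {}" by auto
    ultimately show ?thesis
      using fin card_Un_disjoint[of ?BW ?Y] card_pairs_from[of ?I] by (simp only: subset_refl)
  qed
  moreover have "(\<Sum>k\<in>?I. n - k) = (\<Sum>k\<in>?I - right. n - k) + (\<Sum>k\<in>right. n - k)"
    by (rule sum.subset_diff[OF sub(2)]) simp
  ultimately have "card ?inv + ((\<Sum>k\<in>far. n - k) + (\<Sum>k\<in>right. n - k) + card far * card right) + 2 * card ?Y =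
      2 * ((\<Sum>k\<in>far. n - k) + (\<Sum>k\<in>?I. n - k) + card far * card right)"
    by simp
  moreover have "even x" if "x + 2 * y = 2 * z" for x y z :: nat using that by presburger
  ultimately show ?thesis by blast
qed
end

section \<open>From the Jacobi identity to the Pfaffian\<close>

context defects begin

text \<open>
  The Jacobi identity, with the removed squares numbered from \<open>1\<close> in both colours.
  Inverting the permutations puts them on the black squares, as in
  \<open>pfaffian_bipartite\<close>.
\<close>

lemma jacobi_defects:
  assumes n: "n \<ge> 1" and nz: "det (kast_mat a) \<noteq> 0"
  shows "(-1) ^ sign_exponent * real (M region) * det (kast_mat a) ^ (n - 1) =
    (\<Sum>\<pi> | \<pi> permutes {1..n}. of_int (sign \<pi>) * (\<Prod>k=1..n. adj_mat (kast_mat a) $$ (b (\<pi> k), w k)))"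
proof -
  let ?I = "{1..n}" and ?adj = "adj_mat (kast_mat a)"
  let ?b = "\<lambda>i. b (inv_into ?I w i)"
  have bw: "?b (w k) = b k" if "k \<in> ?I" for k unfolding inv_into_f_f[OF inj_w that] ..
  have S: "w ` ?I \<subseteq> {0..<N}" "w ` ?I \<noteq> {}" using w_range n by auto
  have bS: "?b ` w ` ?I \<subseteq> {0..<N}" using bw b_range by (auto simp: image_image)
  have cardS: "card (w ` ?I) = n" using card_image[OF inj_w] by simp
  have bij_w: "bij_betw w ?I (w ` ?I)" using inj_w by (simp add: bij_betw_def)
  have bij: "bij_betw (map_permutation ?I w) {\<pi>. \<pi> permutes ?I} {p. p permutes w ` ?I}"
  proof -
    have "map_permutation ?I w = (\<lambda>\<pi> x. if x \<in> w ` ?I then w (\<pi> (inv_into ?I w x)) else x)"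
      by (auto simp: fun_eq_iff map_permutation_def restrict_id_def)
    then show ?thesis using bij_betw_permutations[OF bij_w] by simp
  qed
  have term_eq: "(\<Prod>i\<in>w ` ?I. ?adj $$ (?b i, map_permutation ?I w \<pi> i)) = (\<Prod>k=1..n. ?adj $$ (b k, w (\<pi> k)))"
    if p: "\<pi> permutes ?I" for \<pi>
  proof -
    have "(\<Prod>i\<in>w ` ?I. ?adj $$ (?b i, map_permutation ?I w \<pi> i)) =
        (\<Prod>k\<in>?I. ?adj $$ (?b (w k), map_permutation ?I w \<pi> (w k)))"
      using inj_w by (rule prod.reindex_cong) auto
    also have "\<dots> = (\<Prod>k=1..n. ?adj $$ (b k, w (\<pi> k)))"
    proof (rule prod.cong[OF refl])
      fix k assume k: "k \<in> ?I"
      show "?adj $$ (?b (w k), map_permutation ?I w \<pi> (w k)) = ?adj $$ (b k, w (\<pi> k))"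
        unfolding bw[OF k] map_permutation_apply[OF inj_w k] ..
    qed
    finally show ?thesis .
  qed
  have "(-1) ^ sign_exponent * real (M region) * det (kast_mat a) ^ (n - 1) =
      (\<Sum>p | p permutes w ` ?I. signof p * (\<Prod>i\<in>w ` ?I. ?adj $$ (?b i, p i)))"
    using det_unit_rows_jacobi[OF kast_mat_carrier nz S bS] unfolding det_region cardS .
  also have "\<dots> = (\<Sum>\<pi> | \<pi> permutes ?I. signof (map_permutation ?I w \<pi>) *
      (\<Prod>i\<in>w ` ?I. ?adj $$ (?b i, map_permutation ?I w \<pi> i)))"
    by (rule sum.reindex_bij_betw[OF bij, symmetric])
  also have "\<dots> = (\<Sum>\<pi> | \<pi> permutes ?I. of_int (sign \<pi>) * (\<Prod>k=1..n. ?adj $$ (b k, w (\<pi> k))))"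
    using inj_w by (intro sum.cong refl) (simp add: sign_map_permutation term_eq del: One_nat_def)
  also have "\<dots> = (\<Sum>\<pi> | \<pi> permutes ?I. of_int (sign (Hilbert_Choice.inv \<pi>)) *
      (\<Prod>k=1..n. ?adj $$ (b k, w (Hilbert_Choice.inv \<pi> k))))"
    by (rule sum_permutations_inverse)
  also have "\<dots> = (\<Sum>\<pi> | \<pi> permutes ?I. of_int (sign \<pi>) * (\<Prod>k=1..n. ?adj $$ (b (\<pi> k), w k)))"
  proof (intro sum.cong refl)
    fix \<pi> assume "\<pi> \<in> {\<pi>. \<pi> permutes ?I}"
    then have p: "\<pi> permutes ?I" by simp
    have "sign (Hilbert_Choice.inv \<pi>) = sign \<pi>"
      by (rule sign_inverse[OF permutes_imp_permutation[OF _ p]]) simp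
    moreover have "(\<Prod>k=1..n. ?adj $$ (b k, w (Hilbert_Choice.inv \<pi> k))) = (\<Prod>k=1..n. ?adj $$ (b (\<pi> k), w k))"
      using prod.permute[OF p, of "\<lambda>k. ?adj $$ (b k, w (Hilbert_Choice.inv \<pi> k))"] permutes_inverses(2)[OF p]
      by (simp add: o_def)
    ultimately show "of_int (sign (Hilbert_Choice.inv \<pi>)) * (\<Prod>k=1..n. ?adj $$ (b k, w (Hilbert_Choice.inv \<pi> k))) =
        of_int (sign \<pi>) * (\<Prod>k=1..n. ?adj $$ (b (\<pi> k), w k))" by simp
  qed
  finally show ?thesis .
qed

definition defect_cells :: "cell set" where
  "defect_cells = wcell a ` w ` {1..n} \<union> bcell a ` b ` {1..n}"

text \<open>
  The removed squares in cyclic order, starting from the south corner.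
\<close>

definition listing :: "cell list" where
  "listing = filter (\<lambda>c. c \<in> defect_cells) (boundary_squares a)"

definition sorted_keys :: "nat list" where
  "sorted_keys = sorted_list_of_set (position_key ` {1..2 * n})"

lemma position_key_cell:
  assumes x: "x \<in> {1..2 * n}"
  shows "position_key x < 4 * a" "boundary_cell a (position_key x) \<in> defect_cells"
    "odd x \<Longrightarrow> boundary_cell a (position_key x) = wcell a (w ((x + 1) div 2))"
    "even x \<Longrightarrow> boundary_cell a (position_key x) = bcell a (b (x div 2))"
proof -
  have "position_key x < 4 * a \<and> boundary_cell a (position_key x) \<in> defect_cells \<and>
    (odd x \<longrightarrow> boundary_cell a (position_key x) = wcell a (w ((x + 1) div 2))) \<and>
    (even x \<longrightarrow> boundary_cell a (position_key x) = bcell a (b (x div 2)))"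
  proof (cases "even x")
    case True
    then have "x div 2 \<in> {1..n}" using x by auto
    then show ?thesis
      using True black_position[OF a b_col b_range, of "x div 2"]
      by (auto simp: position_key_def defect_cells_def)
  next
    case False
    then have "(x + 1) div 2 \<in> {1..n}" using x by (auto elim!: oddE)
    then show ?thesis
      using False white_position[OF a w_row, of "(x + 1) div 2"]
      by (auto simp: position_key_def defect_cells_def)
  qed
  then show "position_key x < 4 * a" "boundary_cell a (position_key x) \<in> defect_cells"
    "odd x \<Longrightarrow> boundary_cell a (position_key x) = wcell a (w ((x + 1) div 2))"
    "even x \<Longrightarrow> boundary_cell a (position_key x) = bcell a (b (x div 2))" by blast+
qed

lemma listing_eq: "listing = map (boundary_cell a) sorted_keys"
proof -
  let ?P = "filter (\<lambda>i. boundary_cell a i \<in> defect_cells) [0..<4 * a]"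
  have "set ?P = position_key ` {1..2 * n}"
  proof (intro equalityI subsetI)
    fix i assume "i \<in> set ?P"
    then have i: "i < 4 * a" "boundary_cell a i \<in> defect_cells" by auto
    then consider k where "k \<in> {1..n}" "boundary_cell a i = wcell a (w k)"
      | k where "k \<in> {1..n}" "boundary_cell a i = bcell a (b k)"
      unfolding defect_cells_def by blast
    then obtain x where x: "x \<in> {1..2 * n}" "boundary_cell a i = boundary_cell a (position_key x)"
    proof cases
      case (1 k)
      have x: "2 * k - 1 \<in> {1..2 * n}" and k: "odd (2 * k - 1)" "(2 * k - 1 + 1) div 2 = k" using 1 by auto
      show ?thesis using that[OF x] position_key_cell(3)[OF x k(1)] unfolding k(2) 1(2) by simp
    next
      case (2 k)
      have x: "2 * k \<in> {1..2 * n}" and k: "even (2 * k)" "2 * k div 2 = k" using 2 by auto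
      show ?thesis using that[OF x] position_key_cell(4)[OF x k(1)] unfolding k(2) 2(2) by simp
    qed
    then have "i = position_key x"
      using inj_onD[OF inj_boundary_cell[OF a] x(2)] i(1) position_key_cell(1)[OF x(1)] by simp
    then show "i \<in> position_key ` {1..2 * n}" using x(1) by blast
  next
    fix i assume "i \<in> position_key ` {1..2 * n}"
    then show "i \<in> set ?P" using position_key_cell(1,2) by auto
  qed
  moreover have "sorted_list_of_set (set ?P) = ?P"
    by (intro sorted_list_of_set.idem_if_sorted_distinct) (auto simp: sorted_wrt_filter)
  ultimately have "sorted_keys = ?P" by (simp add: sorted_keys_def)
  then show ?thesis by (simp add: listing_def boundary_squares_eq_map filter_map o_def)
qed

lemma length_listing: "length listing = 2 * n"
  using card_image[OF inj_position_key] by (simp add: listing_eq sorted_keys_def)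

definition pair_count :: "nat \<Rightarrow> nat \<Rightarrow> real" where
  "pair_count i j = real (M (aztec_diamond a - {listing ! (i - 1), listing ! (j - 1)}))"

text \<open>
  The left side is the entry of the skew-symmetric matrix for \<open>w k\<close> and \<open>b
  l\<close>, with the white square as row index: it is negative if the black square comes first.
  This sign is the part of the sign of the adjugate entry that is not a product of a function of
  \<open>k\<close> and a function of \<open>l\<close>, so the two matrices differ only by signs
  attached to rows and columns.
\<close>

lemma skew_entry:
  assumes kl: "k \<in> {1..n}" "l \<in> {1..n}"
  shows "(if k \<in> far \<and> l \<in> right then -1 else 1) * real (M (aztec_diamond a - {wcell a (w k), bcell a (b l)})) =
    (-1) ^ ((a + 1) * (\<Sum>r=1..a. r) + (if k \<in> far then 1 else w k) + (if l \<in> right then a + brow a (b l) else 0)) *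
    adj_mat (kast_mat a) $$ (b l, w k)"
proof -
  let ?t = "(a + 1) * (\<Sum>r=1..a. r)" and ?f = "if k \<in> far then 1 else w k"
    and ?g = "if l \<in> right then a + brow a (b l) else 0" and ?h = "if k \<in> far \<and> l \<in> right then 1 else 0 :: nat"
  have "adj_mat (kast_mat a) $$ (b l, w k) =
      (-1) ^ (?t + ?f + ?g + ?h) * real (M (aztec_diamond a - {wcell a (w k), bcell a (b l)}))"
  proof -
    have far: "k \<in> far \<longleftrightarrow> wrow a (w k) = a" and right: "l \<in> right \<longleftrightarrow> bcol a (b l) = a"
      using kl by (simp_all add: far_def right_def)
    show ?thesis
      unfolding adj_kast_mat[OF a w_range[OF kl(1)] w_row[OF kl(1)] b_range[OF kl(2)] b_col[OF kl(2)]] far right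
      by (rule arg_cong2[of _ _ _ _ "(*)"], rule neg_one_power_eqI) auto
  qed
  then have "(-1) ^ (?t + ?f + ?g) * adj_mat (kast_mat a) $$ (b l, w k) =
      ((-1) ^ (?t + ?f + ?g) * (-1) ^ (?t + ?f + ?g)) * (-1) ^ ?h *
      real (M (aztec_diamond a - {wcell a (w k), bcell a (b l)}))"
    by (simp only: power_add mult_ac)
  also have "(-1) ^ (?t + ?f + ?g) * (-1) ^ (?t + ?f + ?g) = (1 :: real)"
    by (simp only: power_mult_distrib[symmetric]) simp
  finally show ?thesis by simp
qed

text \<open>
  Sorting turns the alternate order of the removed squares into the cyclic one. In the alternate
  order the matrix is bipartite, so \<open>pfaffian_bipartite\<close> expresses its Pfaffian by
  the entries of \<open>skew_entry\<close>, and \<open>jacobi_defects\<close> evaluates the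
  resulting determinant. What is left is to see that the signs of the sorting permutation, of rows
  and columns, of \<open>kasteleyn_sign\<close> and of \<open>det K\<close> multiply to
  \<open>1\<close>.
\<close>

lemma pfaffian_listing:
  assumes n: "n \<ge> 1" and nz: "det (kast_mat a) \<noteq> 0"
  shows "pfaffian n (skew_matrix pair_count) = real (M (aztec_diamond a)) ^ (n - 1) * real (M region)"
proof -
  let ?I = "{1..n}" and ?A = "skew_matrix pair_count" and ?adj = "adj_mat (kast_mat a)"
  let ?t = "(a + 1) * (\<Sum>r=1..a. r)"
  let ?f = "\<lambda>k. if k \<in> far then 1 else w k" and ?g = "\<lambda>l. if l \<in> right then a + brow a (b l) else 0"
  obtain \<tau> where \<tau>: "\<tau> permutes {1..2 * n}"
    and nth: "\<And>i. i \<in> {1..2 * n} \<Longrightarrow> sorted_keys ! (\<tau> i - 1) = position_key i"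
    and less: "\<And>i j. i \<in> {1..2 * n} \<Longrightarrow> j \<in> {1..2 * n} \<Longrightarrow> \<tau> i < \<tau> j \<longleftrightarrow> position_key i < position_key j"
    using sorting_permutation[OF inj_position_key] unfolding sorted_keys_def by blast
  have cell: "listing ! (\<tau> i - 1) = boundary_cell a (position_key i)" if i: "i \<in> {1..2 * n}" for i
  proof -
    have "\<tau> i - 1 < length sorted_keys"
      using permutes_mem[OF \<tau> i] length_listing by (auto simp: listing_eq)
    then show ?thesis using nth[OF i] by (simp add: listing_eq)
  qed
  have skew: "?A i j = - ?A j i" for i j by (simp add: skew_matrix_def)
  have bip: "?A (\<tau> i) (\<tau> j) = 0" if ij: "i \<in> {1..2 * n}" "j \<in> {1..2 * n}" "even i \<longleftrightarrow> even j" for i j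
  proof -
    have "{listing ! (\<tau> i - 1), listing ! (\<tau> j - 1)} \<subseteq> wcell a ` {0..<N} \<or>
        {listing ! (\<tau> i - 1), listing ! (\<tau> j - 1)} \<subseteq> bcell a ` {0..<N}"
    proof (cases "even i")
      case True
      then have "i div 2 \<in> ?I" "j div 2 \<in> ?I" using ij by auto
      then show ?thesis
        using True ij position_key_cell(4) cell b_range by (simp del: One_nat_def)
    next
      case False
      then have "(i + 1) div 2 \<in> ?I" "(j + 1) div 2 \<in> ?I" using ij by (auto elim!: oddE)
      then show ?thesis
        using False ij position_key_cell(3) cell w_range by (simp del: One_nat_def)
    qed
    then have "M (aztec_diamond a - {listing ! (\<tau> i - 1), listing ! (\<tau> j - 1)}) = 0"
      using a by (intro M_monochromatic) auto
    then show ?thesis by (simp add: skew_matrix_def pair_count_def insert_commute)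
  qed
  have entry: "?A (\<tau> (2 * k - 1)) (\<tau> (2 * l)) = (-1) ^ (?t + ?f k + ?g l) * ?adj $$ (b l, w k)"
    if kl: "k \<in> ?I" "l \<in> ?I" for k l
  proof -
    have mem: "2 * k - 1 \<in> {1..2 * n}" "2 * l \<in> {1..2 * n}" using kl by auto
    have cells: "listing ! (\<tau> (2 * k - 1) - 1) = wcell a (w k)" "listing ! (\<tau> (2 * l) - 1) = bcell a (b l)"
      unfolding cell[OF mem(1)] cell[OF mem(2)] position_key_odd[OF kl(1)] position_key_even
      using white_position(2)[OF a w_row[OF kl(1)]] black_position(2)[OF a b_col[OF kl(2)] b_range[OF kl(2)]]
      by simp_all
    have "\<tau> (2 * l) < \<tau> (2 * k - 1) \<longleftrightarrow> k \<in> far \<and> l \<in> right"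
      "\<tau> (2 * k - 1) < \<tau> (2 * l) \<longleftrightarrow> \<not> (k \<in> far \<and> l \<in> right)"
      unfolding less[OF mem] less[OF mem(2,1)] position_key_odd[OF kl(1)] position_key_even
      by (rule black_before_white[OF kl])+
    then have "?A (\<tau> (2 * k - 1)) (\<tau> (2 * l)) =
        (if k \<in> far \<and> l \<in> right then -1 else 1) * real (M (aztec_diamond a - {wcell a (w k), bcell a (b l)}))"
      unfolding skew_matrix_def pair_count_def cells by (simp add: insert_commute)
    then show ?thesis unfolding skew_entry[OF kl] .
  qed
  let ?inv = "card {(i, j). i \<in> {1..2*n} \<and> j \<in> {1..2*n} \<and> i < j \<and> position_key j < position_key i}"
  have sign: "sign \<tau> = (-1) ^ ?inv"
  proof -
    have "{(i, j). i \<in> {1..2*n} \<and> j \<in> {1..2*n} \<and> i < j \<and> \<tau> j < \<tau> i} =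
        {(i, j). i \<in> {1..2*n} \<and> j \<in> {1..2*n} \<and> i < j \<and> position_key j < position_key i}"
      using less by blast
    then show ?thesis using sign_eq_inversions[OF finite_atLeastAtMost \<tau>] by simp
  qed
  \<comment> \<open>the signs of rows and columns occur once in each product, whatever the permutation\<close>
  define Y where "Y = (\<Sum>k\<in>?I. ?t + ?f k + ?g k)"
  have prod_entry: "(\<Prod>k=1..n. ?A (\<tau> (2*k - 1)) (\<tau> (2 * \<pi> k))) = (-1) ^ Y * (\<Prod>k=1..n. ?adj $$ (b (\<pi> k), w k))"
    if p: "\<pi> permutes ?I" for \<pi>
  proof -
    have "(\<Prod>k=1..n. ?A (\<tau> (2*k - 1)) (\<tau> (2 * \<pi> k))) =
        (\<Prod>k=1..n. (-1) ^ (?t + ?f k + ?g (\<pi> k)) * ?adj $$ (b (\<pi> k), w k))"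
      by (intro prod.cong refl entry permutes_mem[OF p])
    also have "\<dots> = (-1) ^ (\<Sum>k\<in>?I. ?t + ?f k + ?g (\<pi> k)) * (\<Prod>k=1..n. ?adj $$ (b (\<pi> k), w k))"
      by (simp only: prod.distrib power_sum)
    also have "(\<Sum>k\<in>?I. ?g (\<pi> k)) = (\<Sum>k\<in>?I. ?g k)"
      using sum.permute[OF p, of ?g] by (simp add: o_def)
    then have "(\<Sum>k\<in>?I. ?t + ?f k + ?g (\<pi> k)) = Y"
      by (simp only: Y_def sum.distrib)
    finally show ?thesis .
  qed
  have collect: "x ^ i * (x ^ y * (x ^ s * r * (x ^ t * d) ^ m)) = x ^ (i + y + s + t * m) * (d ^ m * r)"
    for x r d :: real and i y s t m :: nat
    by (simp add: power_add power_mult power_mult_distrib)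
  have "pfaffian n ?A = of_int (sign \<tau>) * (\<Sum>\<pi> | \<pi> permutes ?I. of_int (sign \<pi>) *
      (\<Prod>k=1..n. ?A (\<tau> (2*k - 1)) (\<tau> (2 * \<pi> k))))"
    using \<tau> skew bip by (rule pfaffian_bipartite[where A = "?A" and \<tau> = \<tau> and n = n])
  also have "\<dots> = (-1) ^ ?inv * ((-1) ^ Y * (\<Sum>\<pi> | \<pi> permutes ?I. of_int (sign \<pi>) * (\<Prod>k=1..n. ?adj $$ (b (\<pi> k), w k))))"
    unfolding sign sum_distrib_left
  proof (intro sum.cong refl)
    fix \<pi> assume "\<pi> \<in> {\<pi>. \<pi> permutes ?I}"
    then have p: "\<pi> permutes ?I" by simp
    show "of_int ((-1) ^ ?inv) * (of_int (sign \<pi>) * (\<Prod>k=1..n. ?A (\<tau> (2*k - 1)) (\<tau> (2 * \<pi> k)))) =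
        (-1) ^ ?inv * ((-1) ^ Y * (of_int (sign \<pi>) * (\<Prod>k=1..n. ?adj $$ (b (\<pi> k), w k))))"
      unfolding prod_entry[OF p] by simp
  qed
  also have "\<dots> = (-1) ^ (?inv + Y + sign_exponent + ?t * (n - 1)) *
      (real (M (aztec_diamond a)) ^ (n - 1) * real (M region))"
    unfolding jacobi_defects[OF n nz, symmetric] det_kast_mat[OF a]
    by (rule collect)
  also have "(-1 :: real) ^ (?inv + Y + sign_exponent + ?t * (n - 1)) = (-1) ^ (0 :: nat)"
  proof (rule neg_one_power_eqI)
    have sub: "far \<subseteq> ?I" "right \<subseteq> ?I" by (auto simp: far_def right_def)
    have fin: "finite far" "finite right" using sub finite_subset by blast+
    have Y: "Y = n * ?t + (card far + (\<Sum>k\<in>?I - far. w k)) + (\<Sum>k\<in>right. a + brow a (b k))"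
    proof -
      have "(\<Sum>k\<in>?I. ?f k) = (\<Sum>k\<in>far. ?f k) + (\<Sum>k\<in>?I - far. ?f k)"
        using sum.subset_diff[OF sub(1), of ?f] by simp
      also have "\<dots> = card far + (\<Sum>k\<in>?I - far. w k)" by simp
      finally have "(\<Sum>k\<in>?I. ?f k) = card far + (\<Sum>k\<in>?I - far. w k)" .
      moreover have "(\<Sum>k\<in>?I. ?g k) = (\<Sum>k\<in>right. a + brow a (b k))"
        using sub by (intro sum.mono_neutral_cong_right) auto
      ultimately show ?thesis unfolding Y_def sum.distrib by simp
    qed
    have far: "even ((\<Sum>k\<in>far. n - k) + (card far + (\<Sum>k\<in>far. 1 + n + k)))"
    proof -
      have "even ((n - k) + (1 + (1 + n + k)))" if "k \<in> far" for k
      proof -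
        have "(n - k) + (1 + (1 + n + k)) = 2 * (n + 1)" using that sub by auto
        then show ?thesis by simp
      qed
      then have "even ((\<Sum>k\<in>far. n - k) + (\<Sum>k\<in>far. 1 + (1 + n + k)))" by (rule even_sum_add)
      then show ?thesis by (simp only: sum.distrib[of "\<lambda>_. 1"]) simp
    qed
    have right: "even ((\<Sum>k\<in>right. n - k) + card far * card right + ((\<Sum>k\<in>right. a + brow a (b k)) +
        (\<Sum>k\<in>right. a + brow a (b k) + near_count + k)))"
    proof -
      have cards: "card far + near_count = n"
        using sub fin card_Diff_subset[OF fin(1) sub(1)] card_mono[OF _ sub(1)] by (simp add: near_count_def)
      have "even ((n - k) + (card far + ((a + brow a (b k)) + (a + brow a (b k) + near_count + k))))"
        if "k \<in> right" for k
      proof -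
        have "k \<le> n" using that sub by auto
        moreover have "even ((m - k) + (f + (x + (x + c + k))))" if "f + c = m" "k \<le> m" for f c m k x :: nat
          using that by presburger
        ultimately show ?thesis using cards by blast
      qed
      then have "even ((\<Sum>k\<in>right. n - k) + (\<Sum>k\<in>right. card far + ((a + brow a (b k)) + (a + brow a (b k) + near_count + k))))"
        by (rule even_sum_add)
      moreover have "(\<Sum>k\<in>right. card far + ((a + brow a (b k)) + (a + brow a (b k) + near_count + k))) =
          card far * card right + ((\<Sum>k\<in>right. a + brow a (b k)) + (\<Sum>k\<in>right. a + brow a (b k) + near_count + k))"
        by (simp only: sum.distrib[of "\<lambda>_. card far"] sum.distrib[of "\<lambda>k. a + brow a (b k)"]) simp
      ultimately show ?thesis by (simp only: add.assoc)
    qed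
    obtain m where m: "n = Suc m" using n by (cases n) auto
    have eq: "n * ?t + ?t + ?t * (n - 1) = 2 * (n * ?t)" unfolding m by simp
    have "even (n * ?t + ?t + ?t * (n - 1))" unfolding eq by simp
    then show "even (?inv + Y + sign_exponent + ?t * (n - 1) + 0)"
      using position_key_inversions far right
      unfolding add_0_right Y sign_exponent_def even_add by argo
  qed
  finally show ?thesis by simp
qed
end

section \<open>Removing two squares at a corner\<close>

definition square_region :: "nat \<Rightarrow> (nat \<Rightarrow> nat \<Rightarrow> bool) \<Rightarrow> (nat \<Rightarrow> nat \<Rightarrow> bool) \<Rightarrow> cell set" where
  "square_region a P Q = {white_square a p q | p q. P p q} \<union> {black_square a p q | p q. Q p q}"

lemma white_in_region: "white_square a p q \<in> square_region a P Q \<longleftrightarrow> P p q"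
proof -
  have "\<not> (\<exists>p' q'. white_square a p q = black_square a p' q' \<and> Q p' q')"
    by (simp add: white_neq_black)
  then show ?thesis unfolding square_region_def Un_iff mem_Collect_eq white_square_inject by blast
qed

lemma black_in_region: "black_square a p q \<in> square_region a P Q \<longleftrightarrow> Q p q"
proof -
  have "\<not> (\<exists>p' q'. black_square a p q = white_square a p' q' \<and> P p' q')"
    by (metis white_neq_black)
  then show ?thesis unfolding square_region_def Un_iff mem_Collect_eq black_square_inject by blast
qed

lemma square_region_cases:
  assumes "x \<in> square_region a P Q"
  obtains p q where "x = white_square a p q" "P p q" | p q where "x = black_square a p q" "Q p q"
  using assms that unfolding square_region_def by blast

lemma square_region_diff:
  assumes "\<And>p q. P' p q \<longleftrightarrow> P p q \<and> (p, q) \<noteq> (p0, q0)" "\<And>p q. Q' p q \<longleftrightarrow> Q p q \<and> (p, q) \<noteq> (p1, q1)"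
  shows "square_region a P Q - {white_square a p0 q0, black_square a p1 q1} = square_region a P' Q'"
proof (intro equalityI subsetI)
  fix x assume x: "x \<in> square_region a P Q - {white_square a p0 q0, black_square a p1 q1}"
  then have "x \<in> square_region a P Q" by blast
  then show "x \<in> square_region a P' Q'"
    using x assms by (cases rule: square_region_cases) (auto simp: white_in_region black_in_region)
next
  fix x assume "x \<in> square_region a P' Q'"
  then show "x \<in> square_region a P Q - {white_square a p0 q0, black_square a p1 q1}"
    using assms white_neq_black[of a] white_neq_black[of a, symmetric]
    by (cases rule: square_region_cases)
      (auto simp: white_in_region black_in_region white_square_inject black_square_inject)
qed

lemma same_colour_not_adjacent:
  "\<not> share_edge (white_square a p q) (white_square a p' q')"
  "\<not> share_edge (black_square a p q) (black_square a p' q')"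
proof -
  show "\<not> share_edge (white_square a p q) (white_square a p' q')"
    using share_edge_parity[of "white_square a p q" "white_square a p' q'"] white_parity[of a]
    by (meson even_add)
  show "\<not> share_edge (black_square a p q) (black_square a p' q')"
    using share_edge_parity[of "black_square a p q" "black_square a p' q'"] black_parity[of a]
    by (meson even_add)
qed

lemma forced_at_black:
  assumes "Q p q" "P p' q'" "p = p' \<or> p = p' + 1" "q = q' \<or> q + 1 = q'"
    and "\<And>p'' q''. P p'' q'' \<Longrightarrow> (p = p'' \<or> p = p'' + 1) \<and> (q = q'' \<or> q + 1 = q'') \<Longrightarrow> (p'', q'') = (p', q')"
  shows "M (square_region a P Q) = M (square_region a P Q - {white_square a p' q', black_square a p q})"
proof -
  have "M (square_region a P Q) = M (square_region a P Q - {black_square a p q, white_square a p' q'})"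
  proof (rule M_forced_domino)
    show "black_square a p q \<in> square_region a P Q" "white_square a p' q' \<in> square_region a P Q"
      using assms(1,2) by (simp_all add: white_in_region black_in_region)
    show "share_edge (black_square a p q) (white_square a p' q')"
      unfolding share_edge_sym[of "black_square a p q"] share_edge_white_black using assms(3,4) by blast
    fix e assume "e \<in> square_region a P Q" and e: "share_edge (black_square a p q) e"
    then show "e = white_square a p' q'"
    proof (cases rule: square_region_cases)
      case (1 p'' q'')
      have "share_edge (white_square a p'' q'') (black_square a p q)"
        using e unfolding 1(1) by (simp only: share_edge_sym)
      then have "(p'', q'') = (p', q')" unfolding share_edge_white_black by (rule assms(5)[OF 1(2)])
      then show ?thesis using 1 by simp
    next
      case 2
      then show ?thesis using e same_colour_not_adjacent by blast
    qed
  qed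
  then show ?thesis by (simp only: insert_commute)
qed

lemma forced_at_white:
  assumes "Q p q" "P p' q'" "p = p' \<or> p = p' + 1" "q = q' \<or> q + 1 = q'"
    and "\<And>p'' q''. Q p'' q'' \<Longrightarrow> (p'' = p' \<or> p'' = p' + 1) \<and> (q'' = q' \<or> q'' + 1 = q') \<Longrightarrow> (p'', q'') = (p, q)"
  shows "M (square_region a P Q) = M (square_region a P Q - {white_square a p' q', black_square a p q})"
proof (rule M_forced_domino)
  show "black_square a p q \<in> square_region a P Q" "white_square a p' q' \<in> square_region a P Q"
    using assms(1,2) by (simp_all add: white_in_region black_in_region)
  show "share_edge (white_square a p' q') (black_square a p q)"
    unfolding share_edge_white_black using assms(3,4) by blast
  fix e assume "e \<in> square_region a P Q" and e: "share_edge (white_square a p' q') e"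
  then show "e = black_square a p q"
  proof (cases rule: square_region_cases)
    case (2 p'' q'')
    have "(p'', q'') = (p, q)"
      using e unfolding 2(1) share_edge_white_black by (rule assms(5)[OF 2(2)])
    then show ?thesis using 2 by simp
  next
    case 1
    then show ?thesis using e same_colour_not_adjacent by blast
  qed
qed

text \<open>
  Without its east corner, the northeastern side is matched from east to north: each black square
  \<open>B(k, a + 1)\<close> has lost its partner in the previous row and must be covered together
  with \<open>W(k, a + 1)\<close>. This takes away the last column. Then the same happens along
  the northwestern side, from the west corner on. The squares left over form the diamond of order
  \<open>a\<close>, one unit lower.
\<close>

lemma M_aztec_corner_removed:
  "M (aztec_diamond (Suc a) - {white_square (Suc a) 0 (Suc a), black_square (Suc a) (Suc a) 0}) = M (aztec_diamond a)"
proof -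
  let ?A = "Suc a"
  \<comment> \<open>the white and black squares left after the first \<open>k\<close> steps along the northeastern side\<close>
  let ?P = "\<lambda>k p q. p \<le> ?A \<and> 1 \<le> q \<and> q \<le> ?A \<and> \<not> (p \<le> k \<and> q = ?A)"
  let ?Q = "\<lambda>k p q. 1 \<le> p \<and> p \<le> ?A \<and> q \<le> ?A \<and> (p, q) \<noteq> (?A, 0) \<and> \<not> (p \<le> k \<and> q = ?A)"
  \<comment> \<open>the same along the northwestern side, when the last column is gone\<close>
  let ?P' = "\<lambda>k p q. p \<le> ?A \<and> 1 \<le> q \<and> q \<le> a \<and> \<not> (p = ?A \<and> q \<le> k)"
  let ?Q' = "\<lambda>k p q. 1 \<le> p \<and> p \<le> ?A \<and> q \<le> a \<and> \<not> (p = ?A \<and> q \<le> k)"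
  have start: "aztec_diamond ?A - {white_square ?A 0 ?A, black_square ?A ?A 0} = square_region ?A (?P 0) (?Q 0)"
  proof -
    have "aztec_diamond ?A = square_region ?A (\<lambda>p q. p \<le> ?A \<and> 1 \<le> q \<and> q \<le> ?A) (\<lambda>p q. 1 \<le> p \<and> p \<le> ?A \<and> q \<le> ?A)"
      by (simp only: aztec_diamond_eq square_region_def)
    then show ?thesis by (simp only:) (rule square_region_diff; auto)
  qed
  have east: "M (square_region ?A (?P 0) (?Q 0)) = M (square_region ?A (?P k) (?Q k))" if "k \<le> ?A" for k
    using that
  proof (induction k)
    case (Suc k)
    have "M (square_region ?A (?P k) (?Q k)) =
        M (square_region ?A (?P k) (?Q k) - {white_square ?A (Suc k) ?A, black_square ?A (Suc k) ?A})"
      using Suc.prems by (intro forced_at_black) auto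
    also have "square_region ?A (?P k) (?Q k) - {white_square ?A (Suc k) ?A, black_square ?A (Suc k) ?A} =
        square_region ?A (?P (Suc k)) (?Q (Suc k))"
      using Suc.prems by (intro square_region_diff) auto
    finally show ?case using Suc by simp
  qed simp
  have middle: "square_region ?A (?P ?A) (?Q ?A) = square_region ?A (?P' 0) (?Q' 0)"
    by (intro arg_cong2[of _ _ _ _ "square_region ?A"] ext) auto
  have west: "M (square_region ?A (?P' 0) (?Q' 0)) = M (square_region ?A (?P' k) (?Q' k))" if "k \<le> a" for k
    using that
  proof (induction k)
    case (Suc k)
    have "M (square_region ?A (?P' k) (?Q' k)) =
        M (square_region ?A (?P' k) (?Q' k) - {white_square ?A ?A (Suc k), black_square ?A ?A (Suc k)})"
      using Suc.prems by (intro forced_at_white) auto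
    also have "square_region ?A (?P' k) (?Q' k) - {white_square ?A ?A (Suc k), black_square ?A ?A (Suc k)} =
        square_region ?A (?P' (Suc k)) (?Q' (Suc k))"
      using Suc.prems by (intro square_region_diff) auto
    finally show ?case using Suc by simp
  qed simp
  let ?f = "\<lambda>c :: cell. (fst c, snd c - 1)" and ?g = "\<lambda>c :: cell. (fst c, snd c + 1)"
  have shift: "?f (white_square a p q) = white_square ?A p q" "?f (black_square a p q) = black_square ?A p q" for p q
    by (simp_all add: white_square_def black_square_def)
  have "square_region ?A (?P' a) (?Q' a) = ?f ` aztec_diamond a"
  proof -
    have "square_region ?A (?P' a) (?Q' a) =
        square_region ?A (\<lambda>p q. p \<le> a \<and> 1 \<le> q \<and> q \<le> a) (\<lambda>p q. 1 \<le> p \<and> p \<le> a \<and> q \<le> a)"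
      by (intro arg_cong2[of _ _ _ _ "square_region ?A"] ext) (auto simp: le_Suc_eq)
    also have "\<dots> = ?f ` square_region a (\<lambda>p q. p \<le> a \<and> 1 \<le> q \<and> q \<le> a) (\<lambda>p q. 1 \<le> p \<and> p \<le> a \<and> q \<le> a)"
    proof (intro equalityI subsetI)
      fix x assume "x \<in> square_region ?A (\<lambda>p q. p \<le> a \<and> 1 \<le> q \<and> q \<le> a) (\<lambda>p q. 1 \<le> p \<and> p \<le> a \<and> q \<le> a)"
      then show "x \<in> ?f ` square_region a (\<lambda>p q. p \<le> a \<and> 1 \<le> q \<and> q \<le> a) (\<lambda>p q. 1 \<le> p \<and> p \<le> a \<and> q \<le> a)"
      proof (cases rule: square_region_cases)
        case (1 p q)
        then show ?thesis
          by (intro image_eqI[of _ _ "white_square a p q"]) (simp_all only: shift white_in_region)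
      next
        case (2 p q)
        then show ?thesis
          by (intro image_eqI[of _ _ "black_square a p q"]) (simp_all only: shift black_in_region)
      qed
    next
      fix x assume "x \<in> ?f ` square_region a (\<lambda>p q. p \<le> a \<and> 1 \<le> q \<and> q \<le> a) (\<lambda>p q. 1 \<le> p \<and> p \<le> a \<and> q \<le> a)"
      then obtain y where x: "x = ?f y"
        and y: "y \<in> square_region a (\<lambda>p q. p \<le> a \<and> 1 \<le> q \<and> q \<le> a) (\<lambda>p q. 1 \<le> p \<and> p \<le> a \<and> q \<le> a)" by blast
      show "x \<in> square_region ?A (\<lambda>p q. p \<le> a \<and> 1 \<le> q \<and> q \<le> a) (\<lambda>p q. 1 \<le> p \<and> p \<le> a \<and> q \<le> a)"
        using y by (cases rule: square_region_cases) (simp_all only: x shift white_in_region black_in_region)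
    qed
    also have "square_region a (\<lambda>p q. p \<le> a \<and> 1 \<le> q \<and> q \<le> a) (\<lambda>p q. 1 \<le> p \<and> p \<le> a \<and> q \<le> a) = aztec_diamond a"
      by (simp only: aztec_diamond_eq square_region_def)
    finally show ?thesis .
  qed
  moreover have "M (?f ` aztec_diamond a) = M (aztec_diamond a)"
    by (rule M_isometry[where g = ?g]) (auto simp: share_edge_def)
  ultimately show ?thesis
    using east[of ?A] west[of a] by (simp only: start middle le_refl simp_thms)
qed

text \<open>
  Both sides are the absolute value of an entry of the adjugate of the Kasteleyn matrix.
\<close>

lemma M_boundary_pair_green:
  assumes a: "a \<ge> 1" and p: "1 \<le> p" "p \<le> a" and q: "1 \<le> q" "q \<le> a"
  shows "real (M (aztec_diamond a - {white_square a 0 q, black_square a p 0})) =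
    real (M (aztec_diamond a)) / 2 ^ a *
      (\<Sum>l\<le>a - p. 2 ^ l * real ((a - 1 - l) choose (p - 1)) * real ((a - 1 - l) choose (q - 1)))"
    (is "?L = ?D / _ * ?G")
proof -
  let ?i = "q - 1" and ?j = "(p - 1) * (a + 1)"
  have i: "?i < a * (a + 1)" "wrow a ?i = 0" "wcol a ?i = q" "wcell a ?i = white_square a 0 q"
    using white_code_bound[of 0 a q] q by (auto simp: wrow_def wcol_def wcell_def)
  have j: "?j < a * (a + 1)" "bcell a ?j = black_square a p 0" "bcol a ?j = 0"
    using black_code_bound[of p a 0] bcell_code[of p 0 a] p by (simp_all add: bcol_def del: mult_Suc_right)
  have "\<bar>adj_mat (kast_mat a) $$ (?j, ?i)\<bar> = ?L"
    using adj_kast_mat[OF a i(1) disjI1[OF i(2)] j(1) disjI1[OF j(3)]] i j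
    by (simp add: abs_mult power_abs)
  moreover have "\<bar>adj_mat (kast_mat a) $$ (?j, ?i)\<bar> = ?D * (?G / 2 ^ a)"
  proof -
    have "?G \<ge> 0" by (intro sum_nonneg) auto
    then show ?thesis
      using adj_kast_mat_left[OF _ p i(1)] a
      unfolding i(2,3) coeff_green_poly_0[OF p] det_kast_mat[OF a]
      by (simp add: abs_mult power_abs)
  qed
  ultimately show ?thesis by simp
qed

text \<open>
  For the squares at the east and the west corner, the sum in \<open>M_boundary_pair_green\<close>
  is \<open>1\<close>. With \<open>M_aztec_corner_removed\<close> this gives \<open>M (AD(a + 1))
  = 2 ^ (a + 1) * M (AD(a))\<close>.
\<close>

theorem M_aztec_diamond: "M (aztec_diamond a) = 2 ^ (a * (a + 1) div 2)"
proof (induction a)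
  case 0
  have "aztec_diamond 0 = {}" by (simp add: aztec_diamond_eq)
  moreover have "domino_tilings {} = {{}}"
    by (auto simp: domino_tilings_def dominoes_def)
  ultimately show ?case by (simp add: M_def)
next
  case (Suc a)
  have "real (M (aztec_diamond a)) = real (M (aztec_diamond (Suc a))) / 2 ^ Suc a"
    using M_boundary_pair_green[of "Suc a" "Suc a" "Suc a"] by (simp add: M_aztec_corner_removed)
  then have "real (M (aztec_diamond (Suc a))) = 2 ^ Suc a * 2 ^ (a * (a + 1) div 2)"
    using Suc by (simp add: field_simps)
  also have "\<dots> = 2 ^ (Suc a + a * (a + 1) div 2)" by (rule power_add[symmetric])
  also have "Suc a + a * (a + 1) div 2 = Suc a * (Suc a + 1) div 2"
  proof -
    have "Suc a * (Suc a + 1) = a * (a + 1) + 2 * Suc a" by simp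
    then show ?thesis by simp
  qed
  finally show ?case by (metis of_nat_eq_iff of_nat_numeral of_nat_power)
qed

text \<open>
  Converts the quotients of Pochhammer symbols in the hypergeometric terms to quotients of
  binomial coefficients, factor by factor via absorption.
\<close>

lemma binomial_pochhammer_ratio:
  assumes "m \<le> x" "x \<le> y"
  shows "real (y choose x) * pochhammer (- real x) m = real ((y - m) choose (x - m)) * pochhammer (- real y) m"
  using assms(1)
proof (induction m)
  case (Suc m)
  obtain x' y' where xy: "x - m = Suc x'" "y - m = Suc y'"
    using Suc.prems assms(2) by (metis Suc_diff_Suc Suc_le_lessD le_trans less_le_trans)
  have "real (y choose x) * pochhammer (- real x) (Suc m) =
      real ((y - m) choose (x - m)) * pochhammer (- real y) m * (- real x + real m)"
    using Suc by (simp add: pochhammer_Suc)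
  also have "- real x + real m = - real (x - m)" using Suc.prems by simp
  also have "real ((y - m) choose (x - m)) * pochhammer (- real y) m * - real (x - m) =
      - real ((x - m) * ((y - m) choose (x - m))) * pochhammer (- real y) m" by simp
  also have "(x - m) * ((y - m) choose (x - m)) = (y - m) * ((y - Suc m) choose (x - Suc m))"
    using xy binomial_absorption[of x' "Suc y'"] by (simp add: Suc_diff_Suc diff_Suc)
  also have "- real ((y - m) * ((y - Suc m) choose (x - Suc m))) * pochhammer (- real y) m =
      real ((y - Suc m) choose (x - Suc m)) * (pochhammer (- real y) m * (- real y + real m))"
    using Suc.prems assms(2) by (simp add: of_nat_diff algebra_simps)
  finally show ?case by (simp add: pochhammer_Suc)
qed simp

lemma hyp_3F2_eq_sum:
  assumes i: "1 \<le> i" "i \<le> a" and j: "1 \<le> j" "j \<le> a"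
  shows "real ((a - 1) choose (i - 1)) * real ((a - 1) choose (j - 1)) *
      hyp_3F2 (min i j) 1 (1 - real i) (1 - real j) (1 - real a) (1 - real a) 2 =
    (\<Sum>l<min i j. 2 ^ l * real ((a - 1 - l) choose (a - i)) * real ((a - 1 - l) choose (a - j)))"
proof -
  have "real ((a - 1) choose (i - 1)) * real ((a - 1) choose (j - 1)) *
      (pochhammer 1 l * pochhammer (1 - real i) l * pochhammer (1 - real j) l /
        (pochhammer (1 - real a) l * pochhammer (1 - real a) l) * (2 ^ l / fact l)) =
    2 ^ l * real ((a - 1 - l) choose (a - i)) * real ((a - 1 - l) choose (a - j))"
    if l: "l < min i j" for l
  proof -
    have minus: "1 - real x = - real (x - 1)" if "1 \<le> x" for x using that by simp
    have nz: "pochhammer (1 - real a) l \<noteq> 0"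
      unfolding minus[OF order_trans[OF i]] using l i by (auto simp: pochhammer_eq_0_iff)
    have ratio: "real ((a - 1) choose (x - 1)) * pochhammer (1 - real x) l =
        real ((a - 1 - l) choose (a - x)) * pochhammer (1 - real a) l" if x: "1 \<le> x" "x \<le> a" "l < x" for x
    proof -
      have "l \<le> x - 1" "x - 1 \<le> a - 1" using x by auto
      then have "real ((a - 1) choose (x - 1)) * pochhammer (- real (x - 1)) l =
          real ((a - 1 - l) choose (x - 1 - l)) * pochhammer (- real (a - 1)) l"
        by (rule binomial_pochhammer_ratio)
      moreover have "(a - 1 - l) choose (x - 1 - l) = (a - 1 - l) choose (a - x)"
        using binomial_symmetric[of "x - 1 - l" "a - 1 - l"] x by simp
      ultimately show ?thesis
        unfolding minus[OF x(1)] minus[OF order_trans[OF x(1,2)]] by (simp only:)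
    qed
    have "real ((a - 1) choose (i - 1)) * real ((a - 1) choose (j - 1)) *
      (pochhammer 1 l * pochhammer (1 - real i) l * pochhammer (1 - real j) l /
        (pochhammer (1 - real a) l * pochhammer (1 - real a) l) * (2 ^ l / fact l)) =
      (real ((a - 1) choose (i - 1)) * pochhammer (1 - real i) l) *
      (real ((a - 1) choose (j - 1)) * pochhammer (1 - real j) l) * 2 ^ l /
        (pochhammer (1 - real a) l * pochhammer (1 - real a) l)"
    proof -
      have "A * B * (F * P * Q / (R * R) * (T / F)) = (A * P) * (B * Q) * T / (R * R)"
        if "F \<noteq> 0" for A B F P Q R T :: real using that by simp
      moreover have "pochhammer 1 l = (fact l :: real)" by (simp add: pochhammer_fact)
      ultimately show ?thesis by (simp only: fact_nonzero not_False_eq_True)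
    qed
    also have "\<dots> = 2 ^ l * real ((a - 1 - l) choose (a - i)) * real ((a - 1 - l) choose (a - j))"
    proof -
      have "l < i" "l < j" using l by auto
      then show ?thesis unfolding ratio[OF i \<open>l < i\<close>] ratio[OF j \<open>l < j\<close>] using nz by (simp add: field_simps)
    qed
    finally show ?thesis .
  qed
  then show ?thesis unfolding hyp_3F2_def sum_distrib_left by (intro sum.cong) auto
qed

text \<open>
  On both sides positions count towards the south corner, hence the indices \<open>a + 1 -
  i\<close> and \<open>a + 1 - j\<close>. In \<open>M_boundary_pair_green\<close> the summation
  range is determined by one of the two squares; the terms from \<open>min i j\<close> on vanish.
\<close>

lemma M_south_corner:
  assumes i: "1 \<le> i" "i \<le> a" and j: "1 \<le> j" "j \<le> a"
  shows "real (M (aztec_diamond a - {white_square a 0 (a + 1 - i), black_square a (a + 1 - j) 0})) =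
    2 ^ (a * (a - 1) div 2) * real ((a - 1) choose (i - 1)) * real ((a - 1) choose (j - 1)) *
      hyp_3F2 (min i j) 1 (1 - real i) (1 - real j) (1 - real a) (1 - real a) 2"
proof -
  let ?t = "\<lambda>l. 2 ^ l * real ((a - 1 - l) choose (a - j)) * real ((a - 1 - l) choose (a - i))"
  have "real (M (aztec_diamond a - {white_square a 0 (a + 1 - i), black_square a (a + 1 - j) 0})) =
      real (M (aztec_diamond a)) / 2 ^ a * (\<Sum>l\<le>a - (a + 1 - j). ?t l)"
    using M_boundary_pair_green[of a "a + 1 - j" "a + 1 - i"] i j by simp
  also have "(\<Sum>l\<le>a - (a + 1 - j). ?t l) = (\<Sum>l<min i j. ?t l)"
  proof (rule sum.mono_neutral_right)
    show "\<forall>l\<in>{..a - (a + 1 - j)} - {..<min i j}. ?t l = 0"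
      using i j by (auto simp: binomial_eq_0_iff)
  qed (use j in auto)
  also have "real (M (aztec_diamond a)) / 2 ^ a = 2 ^ (a * (a - 1) div 2)"
  proof -
    have "a * (a + 1) div 2 = a * (a - 1) div 2 + a" using i by (cases a) auto
    then show ?thesis by (simp add: M_aztec_diamond power_add)
  qed
  also have "(\<Sum>l<min i j. ?t l) = real ((a - 1) choose (i - 1)) * real ((a - 1) choose (j - 1)) *
      hyp_3F2 (min i j) 1 (1 - real i) (1 - real j) (1 - real a) (1 - real a) 2"
    unfolding hyp_3F2_eq_sum[OF i j] by (intro sum.cong refl) (simp only: mult_ac)
  finally show ?thesis by (simp only: mult.assoc)
qed

lemma aztec_diamond_symmetric:
  "(x, y) \<in> aztec_diamond a \<longleftrightarrow> (y, x) \<in> aztec_diamond a"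
  "(x, y) \<in> aztec_diamond a \<longleftrightarrow> (- 1 - y, - 1 - x) \<in> aztec_diamond a"
proof -
  have refl_max: "max \<bar>- 1 - z\<bar> \<bar>- 1 - z + 1\<bar> = max \<bar>z\<bar> \<bar>z + 1\<bar>" for z :: int
  proof -
    have "\<bar>- 1 - z\<bar> = \<bar>z + 1\<bar>" "\<bar>- 1 - z + 1\<bar> = \<bar>z\<bar>" by arith+
    then show ?thesis by (simp only: max.commute)
  qed
  show "(x, y) \<in> aztec_diamond a \<longleftrightarrow> (y, x) \<in> aztec_diamond a"
    "(x, y) \<in> aztec_diamond a \<longleftrightarrow> (- 1 - y, - 1 - x) \<in> aztec_diamond a"
    unfolding aztec_diamond_iff refl_max by (simp_all only: add.commute)
qed

text \<open>
  Stated for the two diagonal reflections because they preserve colours. In terms of lower left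
  corners the second one sends \<open>(x, y)\<close> to \<open>(- 1 - y, - 1 - x)\<close>.
\<close>

lemma M_aztec_reflect:
  fixes f :: "cell \<Rightarrow> cell"
  assumes f: "f = (\<lambda>(x, y). (y, x)) \<or> f = (\<lambda>(x, y). (- 1 - y, - 1 - x))"
  shows "M (aztec_diamond a - {f c, f d}) = M (aztec_diamond a - {c, d})"
proof -
  have ff: "f (f c) = c" for c using f by (cases c) auto
  have mem: "f c \<in> aztec_diamond a \<longleftrightarrow> c \<in> aztec_diamond a" for c
    using f aztec_diamond_symmetric[of _ _ a] by (cases c) auto
  have "f ` (aztec_diamond a - {c, d}) = aztec_diamond a - {f c, f d}"
  proof (intro equalityI subsetI)
    fix x assume "x \<in> aztec_diamond a - {f c, f d}"
    moreover have "x = f c" if "f x = c" for c using that ff[of x] by simp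
    ultimately have "f x \<in> aztec_diamond a - {c, d}" using mem by blast
    then show "x \<in> f ` (aztec_diamond a - {c, d})" by (intro image_eqI[of _ _ "f x"]) (simp_all add: ff)
  next
    fix x assume "x \<in> f ` (aztec_diamond a - {c, d})"
    then obtain y where y: "x = f y" "y \<in> aztec_diamond a" "y \<noteq> c" "y \<noteq> d" by blast
    have "f y \<noteq> f c'" if "y \<noteq> c'" for c' using that ff by metis
    then show "x \<in> aztec_diamond a - {f c, f d}" using y mem[of y] by simp
  qed
  moreover have "share_edge (f c) (f d) \<longleftrightarrow> share_edge c d" for c d
  proof -
    have refl_dist: "\<bar>(- 1 - u) - (- 1 - v)\<bar> = \<bar>u - v\<bar>" for u v :: int by (simp add: abs_minus_commute)
    from f show ?thesis
    proof
      assume "f = (\<lambda>(x, y). (y, x))"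
      then show ?thesis by (simp only: share_edge_def case_prod_beta fst_conv snd_conv add.commute)
    next
      assume "f = (\<lambda>(x, y). (- 1 - y, - 1 - x))"
      then show ?thesis by (simp only: share_edge_def case_prod_beta fst_conv snd_conv refl_dist add.commute)
    qed
  qed
  ultimately show ?thesis using M_isometry[of f f "aztec_diamond a - {c, d}", OF ff ff] by simp
qed

section \<open>Arbitrary boundary squares\<close>

lemma pfaffian_rotate_list:
  fixes h :: "'c \<Rightarrow> 'c \<Rightarrow> real"
  assumes n: "n \<ge> 1" and len: "length ds = 2 * n" and sym: "\<And>x y. h x y = h y x"
  shows "pfaffian n (skew_matrix (\<lambda>i j. h (rotate k ds ! (i - 1)) (rotate k ds ! (j - 1)))) =
    pfaffian n (skew_matrix (\<lambda>i j. h (ds ! (i - 1)) (ds ! (j - 1))))"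
proof (induction k)
  case (Suc k)
  let ?xs = "rotate k ds"
  let ?f = "\<lambda>i j. h (?xs ! (i - 1)) (?xs ! (j - 1))"
  have nth: "rotate (Suc k) ds ! (i - 1) = ?xs ! (rotation (2 * n) i - 1)" if i: "i \<in> {1..2 * n}" for i
  proof (cases "i = 2 * n")
    case True
    then show ?thesis using i len by (simp add: nth_rotate1 rotation_def)
  next
    case False
    then obtain l where l: "i = Suc l" "Suc l < 2 * n" using i by (cases i) auto
    then show ?thesis using len by (simp add: nth_rotate1 rotation_def)
  qed
  have "pfaffian n (skew_matrix (\<lambda>i j. h (rotate (Suc k) ds ! (i - 1)) (rotate (Suc k) ds ! (j - 1)))) =
      pfaffian n (skew_matrix (\<lambda>i j. ?f (rotation (2 * n) i) (rotation (2 * n) j)))"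
    by (rule pfaffian_cong) (simp only: skew_matrix_def nth)
  also have "\<dots> = pfaffian n (skew_matrix ?f)"
    by (rule pfaffian_rotate[OF n, of ?f]) (rule sym)
  finally show ?case using Suc by simp
qed simp

lemma strict_mono_enumeration:
  fixes C :: "nat set"
  assumes "finite C"
  obtains f where "strict_mono_on {1..card C} f" "f ` {1..card C} = C"
proof
  let ?L = "sorted_list_of_set C"
  have len: "length ?L = card C" by simp
  have sorted: "sorted_wrt (<) ?L" by simp
  show "strict_mono_on {1..card C} (\<lambda>k. ?L ! (k - 1))"
    by (rule strict_mono_onI) (use len in \<open>auto intro!: sorted_wrt_nth_less[OF sorted]\<close>)
  have "(\<lambda>k. ?L ! (k - 1)) ` {1..card C} = set ?L"
  proof (intro equalityI subsetI)
    fix x assume "x \<in> set ?L"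
    then obtain l where "l < card C" "x = ?L ! l" using len by (metis in_set_conv_nth)
    then show "x \<in> (\<lambda>k. ?L ! (k - 1)) ` {1..card C}" by (intro image_eqI[of _ _ "Suc l"]) auto
  next
    fix x assume "x \<in> (\<lambda>k. ?L ! (k - 1)) ` {1..card C}"
    then obtain k where "k \<in> {1..card C}" "x = ?L ! (k - 1)" by blast
    then show "x \<in> set ?L" using len by (metis nth_mem atLeastAtMost_iff diff_less le_trans less_le_trans zero_less_one nat_less_le less_imp_diff_less Suc_pred' Suc_le_eq One_nat_def)
  qed
  then show "(\<lambda>k. ?L ! (k - 1)) ` {1..card C} = C" using assms by simp
qed

lemma in_white_boundary: "x \<in> white_boundary a \<longleftrightarrow> (\<exists>q. 1 \<le> q \<and> q \<le> a \<and> (x = white_square a 0 q \<or> x = white_square a a q))"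
  unfolding white_boundary_def by (auto simp: image_iff Bex_def less_Suc_eq_le simp del: upt_Suc)

lemma in_black_boundary: "x \<in> black_boundary a \<longleftrightarrow> (\<exists>p. 1 \<le> p \<and> p \<le> a \<and> (x = black_square a p a \<or> x = black_square a p 0))"
  unfolding black_boundary_def by (auto simp: image_iff Bex_def less_Suc_eq_le simp del: upt_Suc)

lemma white_boundary_code:
  assumes x: "x \<in> white_boundary a"
  obtains i where "i < a * (a + 1)" "wrow a i = 0 \<or> wrow a i = a" "wcell a i = x"
proof -
  obtain p q where pq: "p = 0 \<or> p = a" "1 \<le> q" "q \<le> a" "x = white_square a p q"
    using x unfolding in_white_boundary by blast
  have "wcell a (p * a + q - 1) = x" using pq by (simp only: wcell_code)
  moreover then have "wrow a (p * a + q - 1) = p" unfolding pq(4) wcell_def white_square_inject by blast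
  moreover have "p * a + q - 1 < a * (a + 1)" using pq by (intro white_code_bound) auto
  ultimately show ?thesis using that pq(1) by blast
qed

lemma black_boundary_code:
  assumes x: "x \<in> black_boundary a"
  obtains j where "j < a * (a + 1)" "bcol a j = 0 \<or> bcol a j = a" "bcell a j = x"
proof -
  obtain p q where pq: "q = 0 \<or> q = a" "1 \<le> p" "p \<le> a" "x = black_square a p q"
    using x unfolding in_black_boundary by blast
  have q: "q \<le> a" using pq(1) by auto
  have "bcell a ((p - 1) * (a + 1) + q) = x" using pq q by (simp only: bcell_code)
  moreover then have "bcol a ((p - 1) * (a + 1) + q) = q" unfolding pq(4) bcell_def black_square_inject by blast
  moreover have "(p - 1) * (a + 1) + q < a * (a + 1)" using pq q by (intro black_code_bound) auto
  ultimately show ?thesis using that pq(1) by blast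
qed

lemma defects_of_boundary_sets:
  assumes a: "a \<ge> 1" and A: "A \<subseteq> white_boundary a" "card A = n" and B: "B \<subseteq> black_boundary a" "card B = n"
  obtains w b where "defects a n w b" "wcell a ` w ` {1..n} = A" "bcell a ` b ` {1..n} = B"
proof -
  let ?C = "{i \<in> {0..<a * (a + 1)}. wcell a i \<in> A}" and ?D = "{j \<in> {0..<a * (a + 1)}. bcell a j \<in> B}"
  have C: "wcell a ` ?C = A"
  proof (intro equalityI subsetI)
    fix x assume x: "x \<in> A"
    then obtain i where "i < a * (a + 1)" "wcell a i = x" using A(1) white_boundary_code by blast
    then show "x \<in> wcell a ` ?C" using x by auto
  qed auto
  have D: "bcell a ` ?D = B"
  proof (intro equalityI subsetI)
    fix x assume x: "x \<in> B"
    then obtain j where "j < a * (a + 1)" "bcell a j = x" using B(1) black_boundary_code by blast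
    then show "x \<in> bcell a ` ?D" using x by auto
  qed auto
  have cards: "card ?C = n" "card ?D = n"
    using card_image[OF inj_on_subset[OF inj_wcell[of a]], of ?C] card_image[OF inj_on_subset[OF inj_bcell[of a]], of ?D]
      C D A(2) B(2) a by auto
  obtain w where w: "strict_mono_on {1..n} w" "w ` {1..n} = ?C"
    using strict_mono_enumeration[of ?C] unfolding cards by auto
  obtain b where b: "strict_mono_on {1..n} b" "b ` {1..n} = ?D"
    using strict_mono_enumeration[of ?D] unfolding cards by auto
  have "defects a n w b"
  proof
    fix k assume k: "k \<in> {1..n}"
    have wk: "w k \<in> ?C" and bk: "b k \<in> ?D" using w(2) b(2) k by blast+
    then show "w k < a * (a + 1)" "b k < a * (a + 1)" by auto
    obtain i where i: "wrow a i = 0 \<or> wrow a i = a" "wcell a i = wcell a (w k)"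
      using wk A(1) white_boundary_code by blast
    then have "i = w k" using inj_wcell[of a] a by (auto dest: injD)
    then show "wrow a (w k) = 0 \<or> wrow a (w k) = a" using i(1) by simp
    obtain j where j: "bcol a j = 0 \<or> bcol a j = a" "bcell a j = bcell a (b k)"
      using bk B(1) black_boundary_code by blast
    then have "j = b k" using inj_bcell[of a] by (auto dest: injD)
    then show "bcol a (b k) = 0 \<or> bcol a (b k) = a" using j(1) by simp
  qed (use a w(1) b(1) in auto)
  then show ?thesis using that w(2) b(2) C D by simp
qed

definition transpose_cell :: "cell \<Rightarrow> cell" where "transpose_cell = (\<lambda>(x, y). (y, x))"
definition flip_cell :: "cell \<Rightarrow> cell" where "flip_cell = (\<lambda>(x, y). (- 1 - y, - 1 - x))"

text \<open>
  This reflection exchanges the southeastern with the northwestern side and reverses the other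
  two.
\<close>

lemma transpose_cell_squares:
  "p \<le> a \<Longrightarrow> transpose_cell (white_square a p q) = white_square a (a - p) q"
  "p \<le> a + 1 \<Longrightarrow> transpose_cell (black_square a p q) = black_square a (a + 1 - p) q"
  by (simp_all add: transpose_cell_def white_square_def black_square_def of_nat_diff)

text \<open>
  This reflection exchanges the southwestern with the northeastern side and reverses the other
  two.
\<close>

lemma flip_cell_squares:
  "q \<le> a + 1 \<Longrightarrow> flip_cell (white_square a p q) = white_square a p (a + 1 - q)"
  "q \<le> a \<Longrightarrow> flip_cell (black_square a p q) = black_square a p (a - q)"
  by (simp_all add: flip_cell_def white_square_def black_square_def of_nat_diff)

lemma M_east_corner:
  assumes "1 \<le> i" "i \<le> a" "1 \<le> j" "j \<le> a"
  shows "M (aztec_diamond a - {white_square a 0 i, black_square a (a + 1 - j) a}) =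
    M (aztec_diamond a - {white_square a 0 (a + 1 - i), black_square a (a + 1 - j) 0})"
proof -
  have "flip_cell (white_square a 0 i) = white_square a 0 (a + 1 - i)"
    "flip_cell (black_square a (a + 1 - j) a) = black_square a (a + 1 - j) 0"
    using flip_cell_squares(1)[of i a 0] flip_cell_squares(2)[of a a "a + 1 - j"] assms by simp_all
  then show ?thesis
    using M_aztec_reflect[OF disjI2[OF flip_cell_def]] by metis
qed

lemma M_north_corner:
  assumes "1 \<le> i" "i \<le> a" "1 \<le> j" "j \<le> a"
  shows "M (aztec_diamond a - {white_square a a i, black_square a j a}) =
    M (aztec_diamond a - {white_square a 0 (a + 1 - i), black_square a (a + 1 - j) 0})"
proof -
  have "transpose_cell (white_square a a i) = white_square a 0 i"
    "transpose_cell (black_square a j a) = black_square a (a + 1 - j) a"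
    using transpose_cell_squares(1)[of a a i] transpose_cell_squares(2)[of j a a] assms by simp_all
  then have "M (aztec_diamond a - {white_square a a i, black_square a j a}) =
      M (aztec_diamond a - {white_square a 0 i, black_square a (a + 1 - j) a})"
    using M_aztec_reflect[OF disjI1[OF transpose_cell_def]] by metis
  then show ?thesis using M_east_corner[OF assms] by simp
qed

lemma M_west_corner:
  assumes "1 \<le> i" "i \<le> a" "1 \<le> j" "j \<le> a"
  shows "M (aztec_diamond a - {white_square a a (a + 1 - i), black_square a j 0}) =
    M (aztec_diamond a - {white_square a 0 (a + 1 - i), black_square a (a + 1 - j) 0})"
proof -
  have "transpose_cell (white_square a a (a + 1 - i)) = white_square a 0 (a + 1 - i)"
    "transpose_cell (black_square a j 0) = black_square a (a + 1 - j) 0"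
    using transpose_cell_squares(1)[of a a "a + 1 - i"] transpose_cell_squares(2)[of j a 0] assms by simp_all
  then show ?thesis
    using M_aztec_reflect[OF disjI1[OF transpose_cell_def]] by metis
qed

lemma side_squares_nth:
  assumes "1 \<le> i" "i \<le> a"
  shows "side_squares a SE ! (i - 1) = white_square a 0 i" "rev (side_squares a SE) ! (i - 1) = white_square a 0 (a + 1 - i)"
    "side_squares a NE ! (i - 1) = black_square a i a" "rev (side_squares a NE) ! (i - 1) = black_square a (a + 1 - i) a"
    "side_squares a NW ! (i - 1) = white_square a a (a + 1 - i)" "rev (side_squares a NW) ! (i - 1) = white_square a a i"
    "side_squares a SW ! (i - 1) = black_square a (a + 1 - i) 0" "rev (side_squares a SW) ! (i - 1) = black_square a i 0"
proof -
  obtain k where k: "i = Suc k" using assms by (cases i) auto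
  have rev: "rev [Suc 0..<Suc a] ! k = a - k" using assms k by (subst rev_nth) (simp_all del: upt_Suc)
  show "side_squares a SE ! (i - 1) = white_square a 0 i" "rev (side_squares a SE) ! (i - 1) = white_square a 0 (a + 1 - i)"
    "side_squares a NE ! (i - 1) = black_square a i a" "rev (side_squares a NE) ! (i - 1) = black_square a (a + 1 - i) a"
    "side_squares a NW ! (i - 1) = white_square a a (a + 1 - i)" "rev (side_squares a NW) ! (i - 1) = white_square a a i"
    "side_squares a SW ! (i - 1) = black_square a (a + 1 - i) 0" "rev (side_squares a SW) ! (i - 1) = black_square a i 0"
    using assms k rev by (simp_all add: rev_map del: upt_Suc)
qed

lemma position_on_side: "position_on a s c x i \<Longrightarrow> x \<in> set (side_squares a s)"
proof -
  assume x: "position_on a s c x i"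
  let ?xs = "if c = last_corner s then side_squares a s else rev (side_squares a s)"
  have "length ?xs = a" by (cases s) simp_all
  then have "?xs ! (i - 1) \<in> set ?xs" using x by (intro nth_mem) (auto simp: position_on_def)
  then show ?thesis using x by (auto simp: position_on_def split: if_splits)
qed

text \<open>
  By the reflections the number depends only on the two distances to the common corner, and for
  the south corner it is known.
\<close>

lemma M_boundary_pair:
  assumes w: "w \<in> white_boundary a" and b: "b \<in> black_boundary a"
    and c: "common_corner s t c" and i: "position_on a s c w i" and j: "position_on a t c b j"
  shows "real (M (aztec_diamond a - {w, b})) =
    2 ^ (a * (a - 1) div 2) * real ((a - 1) choose (i - 1)) * real ((a - 1) choose (j - 1)) *
      hyp_3F2 (min i j) 1 (1 - real i) (1 - real j) (1 - real a) (1 - real a) 2"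
proof -
  have ij: "1 \<le> i" "i \<le> a" "1 \<le> j" "j \<le> a" using i j by (auto simp: position_on_def)
  have disj: "x \<notin> black_boundary a" if "x \<in> white_boundary a" for x
    using that white_neq_black unfolding in_white_boundary in_black_boundary by metis
  have s: "s = SE \<or> s = NW"
    using disj[OF w] position_on_side[OF i] unfolding black_boundary_def by (cases s) auto
  have t: "t = NE \<or> t = SW"
    using disj b position_on_side[OF j] unfolding white_boundary_def by (cases t) auto
  note pos = side_squares_nth[OF ij(1,2)] side_squares_nth[OF ij(3,4)]
  consider "s = SE" "t = NE" "c = East" | "s = SE" "t = SW" "c = South"
    | "s = NW" "t = NE" "c = North" | "s = NW" "t = SW" "c = West"
    using s t c by (auto simp: common_corner_def)
  then have "M (aztec_diamond a - {w, b}) =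
      M (aztec_diamond a - {white_square a 0 (a + 1 - i), black_square a (a + 1 - j) 0})"
  proof cases
    case 1
    then have "w = white_square a 0 i" "b = black_square a (a + 1 - j) a"
      using i j pos by (simp_all add: position_on_def del: side_squares.simps)
    then show ?thesis using M_east_corner[OF ij] by simp
  next
    case 2
    then have "w = white_square a 0 (a + 1 - i)" "b = black_square a (a + 1 - j) 0"
      using i j pos by (simp_all add: position_on_def del: side_squares.simps)
    then show ?thesis by simp
  next
    case 3
    then have "w = white_square a a i" "b = black_square a j a"
      using i j pos by (simp_all add: position_on_def del: side_squares.simps)
    then show ?thesis using M_north_corner[OF ij] by simp
  next
    case 4
    then have "w = white_square a a (a + 1 - i)" "b = black_square a j 0"
      using i j pos by (simp_all add: position_on_def del: side_squares.simps)
    then show ?thesis using M_west_corner[OF ij] by simp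
  qed
  then show ?thesis using M_south_corner[OF ij] by simp
qed

text \<open>
  Sorting the removed squares by code puts them into the form required by
  \<open>pfaffian_listing\<close>, and the given cyclic listing is a rotation of the one used
  there. The determinant of the Kasteleyn matrix is nonzero because the diamond has tilings.
\<close>

lemma M_boundary_condensation:
  fixes a n :: nat and \<alpha> \<beta> \<delta> :: "nat \<Rightarrow> cell"
  assumes a: "a \<ge> 1" and n: "n \<ge> 1"
    and \<alpha>: "inj_on \<alpha> {1..n}" "\<alpha> ` {1..n} \<subseteq> white_boundary a"
    and \<beta>: "inj_on \<beta> {1..n}" "\<beta> ` {1..n} \<subseteq> black_boundary a"
    and \<delta>: "cyclic_listing a (\<alpha> ` {1..n} \<union> \<beta> ` {1..n}) (map \<delta> [1..<2*n+1])"
  shows "real (M (aztec_diamond a - (\<alpha> ` {1..n} \<union> \<beta> ` {1..n}))) =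
    1 / real (M (aztec_diamond a)) ^ (n - 1) *
      pfaffian n (skew_matrix (\<lambda>i j. real (M (aztec_diamond a - {\<delta> i, \<delta> j}))))"
proof -
  have "card (\<alpha> ` {1..n}) = n" "card (\<beta> ` {1..n}) = n"
    using \<alpha>(1) \<beta>(1) by (simp_all add: card_image)
  then obtain w b where "defects a n w b"
    and cells: "wcell a ` w ` {1..n} = \<alpha> ` {1..n}" "bcell a ` b ` {1..n} = \<beta> ` {1..n}"
    using defects_of_boundary_sets[OF a \<alpha>(2) _ \<beta>(2)] by metis
  interpret defects a n w b by fact
  have reg: "region = aztec_diamond a - (\<alpha> ` {1..n} \<union> \<beta> ` {1..n})"
    unfolding region_def cells ..
  let ?h = "\<lambda>x y. real (M (aztec_diamond a - {x, y}))"
  obtain k where k: "map \<delta> [1..<2*n+1] = rotate k listing"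
    using \<delta> unfolding cyclic_listing_def listing_def defect_cells_def cells by blast
  have \<delta>_nth: "\<delta> i = rotate k listing ! (i - 1)" if i: "i \<in> {1..2 * n}" for i
  proof -
    have "map \<delta> [1..<2*n+1] ! (i - 1) = \<delta> ([1..<2*n+1] ! (i - 1))"
      by (rule nth_map) (use i in \<open>simp del: upt_Suc, linarith\<close>)
    also have "[1..<2*n+1] ! (i - 1) = 1 + (i - 1)"
      by (rule nth_upt) (use i in auto)
    finally have "map \<delta> [1..<2*n+1] ! (i - 1) = \<delta> i" using i by simp
    then show ?thesis unfolding k by simp
  qed
  have "pfaffian n (skew_matrix (\<lambda>i j. ?h (\<delta> i) (\<delta> j))) =
      pfaffian n (skew_matrix (\<lambda>i j. ?h (rotate k listing ! (i - 1)) (rotate k listing ! (j - 1))))"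
    by (rule pfaffian_cong) (simp only: skew_matrix_def \<delta>_nth)
  also have "\<dots> = pfaffian n (skew_matrix (\<lambda>i j. ?h (listing ! (i - 1)) (listing ! (j - 1))))"
    by (rule pfaffian_rotate_list[OF n length_listing]) (simp only: insert_commute)
  also have "\<dots> = pfaffian n (skew_matrix pair_count)"
    by (simp only: pair_count_def[abs_def])
  also have "\<dots> = real (M (aztec_diamond a)) ^ (n - 1) * real (M region)"
    using n by (intro pfaffian_listing) (simp_all add: det_kast_mat[OF a] M_aztec_diamond)
  finally show ?thesis unfolding reg by (simp add: M_aztec_diamond)
qed

theorem theorem2p3:
  fixes a n :: nat and \<alpha> \<beta> \<delta> :: "nat \<Rightarrow> cell"
  assumes "a \<ge> 1" and "n \<ge> 1"
    and "inj_on \<alpha> {1..n}" and "\<alpha> ` {1..n} \<subseteq> white_boundary a"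
    and "inj_on \<beta> {1..n}" and "\<beta> ` {1..n} \<subseteq> black_boundary a"
    and "cyclic_listing a (\<alpha> ` {1..n} \<union> \<beta> ` {1..n}) (map \<delta> [1..<2*n+1])"
  shows
    "real (M (aztec_diamond a - (\<alpha> ` {1..n} \<union> \<beta> ` {1..n}))) =
       1 / real (M (aztec_diamond a)) ^ (n - 1) *
       pfaffian n (skew_matrix (\<lambda>i j. real (M (aztec_diamond a - {\<delta> i, \<delta> j}))))
     \<and> (\<forall>w \<in> white_boundary a. \<forall>b \<in> black_boundary a.
          (\<exists>s t c. w \<in> set (side_squares a s) \<and> b \<in> set (side_squares a t) \<and> common_corner s t c) \<and>
          (\<forall>s t c i j. common_corner s t c \<and> position_on a s c w i \<and> position_on a t c b j \<longrightarrow>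
             real (M (aztec_diamond a - {w, b})) =
               2 ^ (a * (a - 1) div 2) * real ((a - 1) choose (i - 1)) * real ((a - 1) choose (j - 1)) *
               hyp_3F2 (min i j) 1 (1 - real i) (1 - real j) (1 - real a) (1 - real a) 2))
     \<and> (\<forall>i \<in> {1..n}. \<forall>j \<in> {1..n}. i \<noteq> j \<longrightarrow>
          M (aztec_diamond a - {\<alpha> i, \<alpha> j}) = 0 \<and> M (aztec_diamond a - {\<beta> i, \<beta> j}) = 0)"
proof (intro conjI ballI allI impI)
  show "real (M (aztec_diamond a - (\<alpha> ` {1..n} \<union> \<beta> ` {1..n}))) =
    1 / real (M (aztec_diamond a)) ^ (n - 1) *
      pfaffian n (skew_matrix (\<lambda>i j. real (M (aztec_diamond a - {\<delta> i, \<delta> j}))))"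
    using assms by (rule M_boundary_condensation)
next
  fix w b assume "w \<in> white_boundary a" "b \<in> black_boundary a"
  then obtain s t where "s = SE \<or> s = NW" "w \<in> set (side_squares a s)" "t = NE \<or> t = SW" "b \<in> set (side_squares a t)"
    unfolding white_boundary_def black_boundary_def by blast
  moreover have "\<exists>c. common_corner s t c" if "s = SE \<or> s = NW" "t = NE \<or> t = SW" for s t
    using that by (auto simp: common_corner_def)
  ultimately show "\<exists>s t c. w \<in> set (side_squares a s) \<and> b \<in> set (side_squares a t) \<and> common_corner s t c"
    by blast
next
  fix w b s t c i j assume "w \<in> white_boundary a" "b \<in> black_boundary a"
    "common_corner s t c \<and> position_on a s c w i \<and> position_on a t c b j"
  then show "real (M (aztec_diamond a - {w, b})) =
    2 ^ (a * (a - 1) div 2) * real ((a - 1) choose (i - 1)) * real ((a - 1) choose (j - 1)) *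
      hyp_3F2 (min i j) 1 (1 - real i) (1 - real j) (1 - real a) (1 - real a) 2"
    using M_boundary_pair by blast
next
  fix i j assume ij: "i \<in> {1..n}" "j \<in> {1..n}" "i \<noteq> j"
  have white: "x \<in> wcell a ` {0..<a * (a + 1)}" if x: "x \<in> white_boundary a" for x
    using white_boundary_code[OF x] by (metis atLeastLessThan_iff imageI le0)
  have black: "x \<in> bcell a ` {0..<a * (a + 1)}" if x: "x \<in> black_boundary a" for x
    using black_boundary_code[OF x] by (metis atLeastLessThan_iff imageI le0)
  have "\<alpha> i \<in> white_boundary a" "\<alpha> j \<in> white_boundary a" "\<beta> i \<in> black_boundary a" "\<beta> j \<in> black_boundary a"
    using assms ij by blast+
  then show "M (aztec_diamond a - {\<alpha> i, \<alpha> j}) = 0" "M (aztec_diamond a - {\<beta> i, \<beta> j}) = 0"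
    using assms(1) white black by (intro M_monochromatic; simp)+
qed

end
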